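(* Let $\pi$ be a unitary representation of a group $G$ in a Hilbert space $\mathcal H$. The system $(\mathbb S_{\mathcal H},G,\pi)$ has the concentration property if and only if at least one of the following holds: (a) $\pi$ has a non-zero invariant vector; or (b) $\dim\mathcal H=\infty$ and every subrepresentation of $\pi$ of finite codimension is amenable.
   Context: As usual for unitary representations, Hilbert spaces are complex. $G$ is an abstract group; no topology on $G$ and no continuity of $\pi$ is assumed. $\mathbb S_{\mathcal H}$ is the unit sphere of $\mathcal H$, with the uniform structure given by the norm distance, on which $G$ acts by the operators $\pi(g)$. Amenable representation (Bekka): a unitary representation $\pi$ of $G$ in $\mathcal H$ is amenable if there is a $G$-invariant state on the algebra $\mathcal L(\mathcal H)$ of all bounded operators, i.e. a linear functional $\phi\in\mathcal L(\mathcal H)^*$ with $\phi\ge 0$, $\phi(\mathbb I)=1$ and $\phi(\pi(g)T\pi(g)^{-1})=\phi(T)$ for all $T\in\mathcal L(\mathcal H)$, $g\in G$. Subrepresentations are restrictions of $\pi$ to closed $G$-invariant subspaces; one of finite codimension is one on a subspace of finite codimension (codimension $0$, i.e. $\pi$ itself, included). Concentration property: a set $A\subseteq\mathbb S_{\mathcal H}$ is essential if for every $\epsilon>0$ and every finite collection $g_1,\dots,g_n\in G$ one has $\bigcap_{i=1}^n\pi(g_i)\mathcal O_\epsilon(A)\ne\emptyset$, where $\mathcal O_\epsilon(A)$ is the $\epsilon$-neighbourhood of $A$ in $\mathbb S_{\mathcal H}$. The system $(\mathbb S_{\mathcal H},G,\pi)$ has the concentration property if every finite cover of $\mathbb S_{\mathcal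 H}$ by subsets contains an essential set. *)

theory Defs
  imports "HOL-Analysis.Analysis" "HOL-Algebra.Group"
begin

text \<open>
  The libraries provide only real inner product spaces. The inner product below is linear in its
  first argument. The topology, the metric and completeness are inherited from \<open>banach\<close>;
  positive definiteness follows from \<open>cinner_self\<close>. The zero space is a permitted instance.
\<close>

class complex_hilbert = banach +
  fixes scaleC :: "complex \<Rightarrow> 'a \<Rightarrow> 'a"  (infixr \<open>*\<^sub>C\<close> 75)
    and cinner :: "'a \<Rightarrow> 'a \<Rightarrow> complex"
  assumes scaleC_add_right: "a *\<^sub>C (x + y) = a *\<^sub>C x + a *\<^sub>C y"
    and scaleC_add_left: "(a + b) *\<^sub>C x = a *\<^sub>C x + b *\<^sub>C x"
    and scaleC_scaleC: "a *\<^sub>C b *\<^sub>C x = (a * b) *\<^sub>C x"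
    and scaleR_scaleC: "scaleR r x = complex_of_real r *\<^sub>C x"
    and cinner_commute: "cinner x y = cnj (cinner y x)"
    and cinner_add_left: "cinner (x + y) z = cinner x z + cinner y z"
    and cinner_scaleC_left: "cinner (a *\<^sub>C x) y = a * cinner x y"
    and cinner_self: "cinner x x = complex_of_real ((norm x)\<^sup>2)"

instantiation complex :: complex_hilbert
begin

definition scaleC_complex :: "complex \<Rightarrow> complex \<Rightarrow> complex"
  where "scaleC_complex a x = a * x"

definition cinner_complex :: "complex \<Rightarrow> complex \<Rightarrow> complex"
  where "cinner_complex x y = x * cnj y"

instance
proof
  fix a b x y z :: complex and r :: real
  show "a *\<^sub>C (x + y) = a *\<^sub>C x + a *\<^sub>C y" "(a + b) *\<^sub>C x = a *\<^sub>C x + b *\<^sub>C x"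
    "a *\<^sub>C b *\<^sub>C x = (a * b) *\<^sub>C x"
    by (simp_all add: scaleC_complex_def distrib_left distrib_right mult.assoc)
  show "scaleR r x = complex_of_real r *\<^sub>C x"
    by (simp add: scaleC_complex_def scaleR_conv_of_real)
  show "cinner x y = cnj (cinner y x)" "cinner (x + y) z = cinner x z + cinner y z"
    "cinner (a *\<^sub>C x) y = a * cinner x y"
    by (simp_all add: cinner_complex_def scaleC_complex_def distrib_right)
  show "cinner x x = complex_of_real ((norm x)\<^sup>2)"
    by (simp only: cinner_complex_def complex_norm_square)
qed

end

global_interpretation cvec: vector_space "scaleC :: complex \<Rightarrow> 'a \<Rightarrow> 'a::complex_hilbert"
proof
  fix x :: 'a
  have "(1::complex) *\<^sub>C x = scaleR 1 x"
    by (simp only: scaleR_scaleC of_real_1)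
  then show "(1::complex) *\<^sub>C x = x"
    by simp
qed (simp_all add: scaleC_add_right scaleC_add_left scaleC_scaleC)

definition finite_cdim :: "'h::complex_hilbert set \<Rightarrow> bool"
  where "finite_cdim V \<longleftrightarrow> (\<exists>B. finite B \<and> V \<subseteq> cvec.span B)"

definition finite_codim :: "'h::complex_hilbert set \<Rightarrow> bool"
  where "finite_codim K \<longleftrightarrow> (\<exists>B. finite B \<and> cvec.span (K \<union> B) = UNIV)"

definition unitary_op :: "('h::complex_hilbert \<Rightarrow> 'h) \<Rightarrow> bool"
  where "unitary_op U \<longleftrightarrow>
    Vector_Spaces.linear scaleC scaleC U \<and> surj U \<and> (\<forall>x y. cinner (U x) (U y) = cinner x y)"

definition unitary_group :: "('h::complex_hilbert \<Rightarrow> 'h) monoid"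
  where "unitary_group = \<lparr>carrier = {U. unitary_op U}, monoid.mult = (\<circ>), one = id\<rparr>"

definition unitary_rep :: "('g, 'm) monoid_scheme \<Rightarrow> ('g \<Rightarrow> 'h::complex_hilbert \<Rightarrow> 'h) \<Rightarrow> bool"
  where "unitary_rep G \<pi> \<longleftrightarrow> group G \<and> \<pi> \<in> hom G unitary_group"

text \<open>
  A closed subspace \<open>K\<close> is a Hilbert space in its own right. An operator on \<open>K\<close> is represented by
  the function on the ambient space that agrees with it on \<open>K\<close> and is \<open>0\<close> outside \<open>K\<close>; such a
  function is in general not linear on the ambient space. Sums, scalar multiples and composites
  of operators on \<open>K\<close> are then the pointwise ones, the identity of \<open>K\<close> is \<open>restrict_op K id\<close>, and
  \<open>onorm\<close> is the operator norm on \<open>K\<close>. For \<open>K = UNIV\<close> this is the usual algebra of bounded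
  operators.
\<close>

definition restrict_op :: "'h::complex_hilbert set \<Rightarrow> ('h \<Rightarrow> 'h) \<Rightarrow> 'h \<Rightarrow> 'h"
  where "restrict_op K T = (\<lambda>x. if x \<in> K then T x else 0)"

definition bounded_ops :: "'h::complex_hilbert set \<Rightarrow> ('h \<Rightarrow> 'h) set"
  where "bounded_ops K = {T.
    (\<forall>x\<in>K. T x \<in> K) \<and> (\<forall>x. x \<notin> K \<longrightarrow> T x = 0) \<and>
    (\<forall>x\<in>K. \<forall>y\<in>K. T (x + y) = T x + T y) \<and>
    (\<forall>c. \<forall>x\<in>K. T (c *\<^sub>C x) = c *\<^sub>C T x) \<and>
    (\<exists>B. \<forall>x\<in>K. norm (T x) \<le> B * norm x)}"

definition positive_op :: "'h::complex_hilbert set \<Rightarrow> ('h \<Rightarrow> 'h) \<Rightarrow> bool"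
  where "positive_op K T \<longleftrightarrow> T \<in> bounded_ops K \<and> (\<forall>x\<in>K. cinner (T x) x \<in> \<real>\<^sub>\<ge>\<^sub>0)"

text \<open>Only the values of \<open>\<phi>\<close> on \<open>bounded_ops K\<close> matter.\<close>

definition state_on :: "'h::complex_hilbert set \<Rightarrow> (('h \<Rightarrow> 'h) \<Rightarrow> complex) \<Rightarrow> bool"
  where "state_on K \<phi> \<longleftrightarrow>
    (\<forall>S\<in>bounded_ops K. \<forall>T\<in>bounded_ops K. \<phi> (\<lambda>x. S x + T x) = \<phi> S + \<phi> T) \<and>
    (\<forall>c. \<forall>T\<in>bounded_ops K. \<phi> (\<lambda>x. c *\<^sub>C T x) = c * \<phi> T) \<and>
    (\<exists>M. \<forall>T\<in>bounded_ops K. cmod (\<phi> T) \<le> M * onorm T) \<and>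
    (\<forall>T. positive_op K T \<longrightarrow> \<phi> T \<in> \<real>\<^sub>\<ge>\<^sub>0) \<and>
    \<phi> (restrict_op K id) = 1"

text \<open>Here \<open>\<rho>\<close> is a unitary representation of \<open>G\<close> in the Hilbert space \<open>K\<close>, so that
  \<open>\<rho> (inv\<^bsub>G\<^esub> g)\<close> is the inverse of \<open>\<rho> g\<close> on \<open>K\<close>.\<close>

definition amenable_rep ::
    "('g, 'm) monoid_scheme \<Rightarrow> 'h::complex_hilbert set \<Rightarrow> ('g \<Rightarrow> 'h \<Rightarrow> 'h) \<Rightarrow> bool"
  where "amenable_rep G K \<rho> \<longleftrightarrow>
    (\<exists>\<phi>. state_on K \<phi> \<and>
      (\<forall>g\<in>carrier G. \<forall>T\<in>bounded_ops K. \<phi> (\<rho> g \<circ> T \<circ> \<rho> (inv\<^bsub>G\<^esub> g)) = \<phi> T))"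

definition closed_invariant_subspace ::
    "('g, 'm) monoid_scheme \<Rightarrow> ('g \<Rightarrow> 'h::complex_hilbert \<Rightarrow> 'h) \<Rightarrow> 'h set \<Rightarrow> bool"
  where "closed_invariant_subspace G \<pi> K \<longleftrightarrow>
    cvec.subspace K \<and> closed K \<and> (\<forall>g\<in>carrier G. \<pi> g ` K \<subseteq> K)"

definition subrep ::
    "('g \<Rightarrow> 'h::complex_hilbert \<Rightarrow> 'h) \<Rightarrow> 'h set \<Rightarrow> 'g \<Rightarrow> 'h \<Rightarrow> 'h"
  where "subrep \<pi> K = (\<lambda>g. restrict_op K (\<pi> g))"

definition sphere_nhd :: "real \<Rightarrow> 'h::complex_hilbert set \<Rightarrow> 'h set"
  where "sphere_nhd \<epsilon> A = {x \<in> sphere 0 1. \<exists>a\<in>A. dist x a < \<epsilon>}"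

text \<open>The intersection is taken inside the sphere, so for \<open>F = {}\<close> it is the whole sphere
  (without this, it would be \<open>UNIV\<close>).\<close>

definition essential ::
    "('g, 'm) monoid_scheme \<Rightarrow> ('g \<Rightarrow> 'h::complex_hilbert \<Rightarrow> 'h) \<Rightarrow> 'h set \<Rightarrow> bool"
  where "essential G \<pi> A \<longleftrightarrow> A \<subseteq> sphere 0 1 \<and>
    (\<forall>\<epsilon>>0. \<forall>F. finite F \<and> F \<subseteq> carrier G \<longrightarrow>
      sphere 0 1 \<inter> (\<Inter>g\<in>F. \<pi> g ` sphere_nhd \<epsilon> A) \<noteq> {})"

definition concentration_property ::
    "('g, 'm) monoid_scheme \<Rightarrow> ('g \<Rightarrow> 'h::complex_hilbert \<Rightarrow> 'h) \<Rightarrow> bool"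
  where "concentration_property G \<pi> \<longleftrightarrow>
    (\<forall>\<C>. finite \<C> \<and> \<Union>\<C> = sphere 0 1 \<longrightarrow> (\<exists>A\<in>\<C>. essential G \<pi> A))"

end

theory Submission
  imports Defs "HOL-Probability.Distributions" "HOL-Library.Function_Algebras"
begin

text \<open>
  If every subrepresentation of finite codimension is amenable, two cases occur. If invariant states on
  orthogonal complements of finite-dimensional invariant subspaces always have a nonzero part on finite
  rank operators, then an eigenspace of that part is a new finite-dimensional invariant subspace, so there
  are such subspaces of arbitrarily large dimension, each with an exactly invariant normalised trace.
  Otherwise some invariant state kills all finite rank operators, and Hahn--Banach separation in the trace
  norm replaces it by almost invariant positive operators of finite rank, trace \<open>1\<close> and small
  operator norm. Either way there are Gaussian measures on \<open>\<H>\<close> whose covariance is almost invariant and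
  has trace \<open>1\<close> and small norm. Under such a measure a convex function with Lipschitz constant \<open>1\<close> is
  concentrated around its mean (Maurey--Pisier). Given a finite cover \<open>\<C>\<close> of the sphere, apply this to the
  support functions of its members: their maximum is the norm, so the mean of one of them nearly equals the
  mean of the norm. If that member were not essential, the mean of its support function over
  finitely many translates would stay a fixed factor below that of the norm, contradicting almost
  invariance of the measure.

  Conversely, covering the sphere by level sets shows that concentration yields unit vectors on which
  finitely many given bounded Lipschitz functions are almost invariant. A finite-dimensional invariant
  subspace without invariant vectors cannot carry a substantial component of such unit vectors, by
  compactness. Hence the vector states of their components in a subspace of finite codimension cluster, in
  the product topology, at an invariant state.
\<close>

text \<open>An invariant state need not come from vectors or density operators, so it cannot be
  evaluated on functions on the sphere; only finitely many group elements and finite rank operators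
  can be reached from it. The small operator norm is what makes those operators useful: the width of
  Gaussian concentration is governed by the largest eigenvalue of the covariance, the typical norm
  by its trace. A state living on one finite-dimensional invariant subspace would therefore be
  worthless, which is why amenability is also asked of the complements of such subspaces. Gaussian
  laws serve better than uniform measures on spheres because they are determined by the covariance,
  are transported by unitary operators, and have means that vary continuously with the covariance in
  trace norm. They occur here only as means of Lipschitz functions along finite lists of vectors,
  computed by iterated one-dimensional integrals. The members of a cover are arbitrary sets, and
  their support functions are convex and Lipschitz all the same.\<close>

section \<open>Complex Hilbert spaces\<close>

lemma cinner_add_right: "cinner x (y + z) = cinner x y + cinner (x::'a::complex_hilbert) z"
  by (simp add: cinner_commute[of x] cinner_add_left)

lemma cinner_scaleC_right: "cinner x (a *\<^sub>C y) = cnj a * cinner (x::'a::complex_hilbert) y"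
  by (simp add: cinner_commute[of x] cinner_scaleC_left)

lemma cinner_scaleR_left: "cinner (r *\<^sub>R x) y = of_real r * cinner (x::'a::complex_hilbert) y"
  by (simp add: scaleR_scaleC cinner_scaleC_left)

lemma cinner_scaleR_right: "cinner x (r *\<^sub>R y) = of_real r * cinner (x::'a::complex_hilbert) y"
  by (simp add: scaleR_scaleC cinner_scaleC_right)

lemma Re_cinner_self: "Re (cinner x x) = (norm (x::'a::complex_hilbert))\<^sup>2"
  by (simp add: cinner_self)

lemma Re_cinner_commute: "Re (cinner x y) = Re (cinner (y::'a::complex_hilbert) x)"
  by (subst cinner_commute) simp

lemma cmod_cinner_commute: "cmod (cinner x y) = cmod (cinner (y::'a::complex_hilbert) x)"
  by (subst cinner_commute) simp

lemma norm_scaleC: "norm (a *\<^sub>C x) = cmod a * norm (x::'a::complex_hilbert)"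
proof -
  have "complex_of_real ((norm (a *\<^sub>C x))\<^sup>2) = complex_of_real ((cmod a * norm x)\<^sup>2)"
    unfolding cinner_self[symmetric] cinner_scaleC_left cinner_scaleC_right
    by (simp only: cinner_self power_mult_distrib of_real_mult complex_norm_square mult_ac)
  then show ?thesis
    by (simp only: of_real_eq_iff) (simp add: power2_eq_iff_nonneg)
qed

lemma norm_add_sq:
  "(norm (x + y))\<^sup>2 = (norm x)\<^sup>2 + (norm y)\<^sup>2 + 2 * Re (cinner (x::'a::complex_hilbert) y)"
  unfolding Re_cinner_self[symmetric] cinner_add_left cinner_add_right
  using Re_cinner_commute[of x y] by simp

text \<open>Cauchy--Schwarz, by expanding the squared norm of
  \<open>norm y *\<^sub>R x - norm x *\<^sub>R y\<close>.\<close>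

lemma Re_cinner_le: "Re (cinner x y) \<le> norm x * norm (y::'a::complex_hilbert)"
proof (cases "x = 0 \<or> y = 0")
  case True
  then have "cinner x y = 0"
    using cinner_scaleR_left[of 0 x y] cinner_scaleR_right[of x 0 y] by auto
  then show ?thesis by simp
next
  case False
  let ?a = "norm x" and ?b = "norm y"
  have "0 \<le> (norm (?b *\<^sub>R x + (- ?a) *\<^sub>R y))\<^sup>2" by simp
  also have "\<dots> = 2 * (?a * ?b) * (?a * ?b - Re (cinner x y))"
    unfolding norm_add_sq
    by (simp only: cinner_scaleR_left cinner_scaleR_right power_mult_distrib norm_scaleR)
      (simp add: power2_eq_square algebra_simps)
  finally have "0 \<le> 2 * (?a * ?b) * (?a * ?b - Re (cinner x y))" .
  moreover have "0 < 2 * (?a * ?b)" using False by simp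
  ultimately show ?thesis using zero_le_mult_iff[of "2 * (?a * ?b)"] by auto
qed

lemma cmod_cinner_le: "cmod (cinner x y) \<le> norm x * norm (y::'a::complex_hilbert)"
proof -
  obtain u where u: "cmod u = 1" "u * cinner x y = of_real (cmod (cinner x y))"
  proof (cases "cinner x y = 0")
    case False
    let ?z = "cinner x y"
    have "cnj ?z * ?z = of_real (cmod ?z) * of_real (cmod ?z)"
      using complex_norm_square[of ?z] by (simp add: power2_eq_square mult.commute)
    then have "cnj ?z / of_real (cmod ?z) * ?z = of_real (cmod ?z)"
      using False by simp
    then show ?thesis
      using False by (intro that[of "cnj ?z / of_real (cmod ?z)"]) (simp_all add: norm_divide)
  qed (use that[of 1] in simp)
  have "cmod (cinner x y) = Re (cinner (u *\<^sub>C x) y)"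
    by (simp add: cinner_scaleC_left u)
  also have "\<dots> \<le> norm (u *\<^sub>C x) * norm y" by (rule Re_cinner_le)
  finally show ?thesis by (simp add: norm_scaleC u)
qed

lemma bounded_bilinear_cinner: "bounded_bilinear (cinner :: 'a::complex_hilbert \<Rightarrow> _)"
  by unfold_locales (auto simp: cinner_add_left cinner_add_right cinner_scaleR_left cinner_scaleR_right
    scaleR_conv_of_real cmod_cinner_le intro!: exI[of _ 1])

lemma bounded_bilinear_scaleC: "bounded_bilinear (scaleC :: complex \<Rightarrow> 'a \<Rightarrow> 'a::complex_hilbert)"
  by unfold_locales (auto simp: scaleC_add_left scaleC_add_right scaleR_scaleC scaleC_scaleC mult.commute
    norm_scaleC scaleR_conv_of_real scaleC_complex_def intro!: exI[of _ 1])

interpretation cinner: bounded_bilinear "cinner :: 'a::complex_hilbert \<Rightarrow> _"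
  by (rule bounded_bilinear_cinner)

interpretation scaleC: bounded_bilinear "scaleC :: complex \<Rightarrow> 'a \<Rightarrow> 'a::complex_hilbert"
  by (rule bounded_bilinear_scaleC)

lemmas cinner_simps = cinner.add_left cinner.add_right cinner.diff_left cinner.diff_right
  cinner.minus_left cinner.minus_right cinner.zero_left cinner.zero_right
  cinner_scaleR_left cinner_scaleR_right cinner_scaleC_left cinner_scaleC_right

lemma norm_diff_sq:
  "(norm (x - y))\<^sup>2 = (norm x)\<^sup>2 + (norm y)\<^sup>2 - 2 * Re (cinner (x::'a::complex_hilbert) y)"
  using norm_add_sq[of x "- y"] by (simp add: cinner_simps)

lemma parallelogram:
  "(norm (x + y))\<^sup>2 + (norm (x - y))\<^sup>2 = 2 * (norm x)\<^sup>2 + 2 * (norm (y::'a::complex_hilbert))\<^sup>2"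
  by (simp add: norm_add_sq norm_diff_sq)

lemma cinner_eq_zero_all: "(\<And>y. Re (cinner x y) = 0) \<Longrightarrow> x = (0::'a::complex_hilbert)"
  using Re_cinner_self[of x] by simp

section \<open>Closest points, orthogonal decomposition and Riesz representation\<close>

lemma closest_to_origin:
  fixes C :: "'a::complex_hilbert set"
  assumes "closed C" "convex C" "C \<noteq> {}"
  obtains z where "z \<in> C" "\<And>y. y \<in> C \<Longrightarrow> norm z \<le> norm y"
proof -
  define d where "d = (INF y\<in>C. norm y)"
  have bdd: "bdd_below (norm ` C)" by (intro bdd_belowI[of _ 0]) auto
  have d_le: "d \<le> norm y" if "y \<in> C" for y
    unfolding d_def by (rule cINF_lower[OF bdd that])
  have d0: "0 \<le> d" unfolding d_def using assms(3) by (intro cINF_greatest) auto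
  have "\<exists>y\<in>C. norm y < d + inverse (real (Suc n))" for n
    using cINF_less_iff[OF assms(3) bdd, of "d + inverse (real (Suc n))"] unfolding d_def by simp
  then obtain Y where Y: "\<And>n. Y n \<in> C" "\<And>n. norm (Y n) < d + inverse (real (Suc n))" by metis
  have lim: "(\<lambda>n. norm (Y n)) \<longlonglongrightarrow> d"
  proof (rule tendsto_sandwich[of "\<lambda>_. d" _ _ "\<lambda>n. d + inverse (real (Suc n))"])
    show "(\<lambda>n. d + inverse (real (Suc n))) \<longlonglongrightarrow> d"
      using tendsto_add[OF tendsto_const LIMSEQ_inverse_real_of_nat] by simp
  qed (auto intro!: always_eventually d_le Y(1) less_imp_le[OF Y(2)] simp del: of_nat_Suc)
  \<comment> \<open>Midpoints stay in the convex set and so have norm at least \<open>d\<close>; the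
    parallelogram law then makes the minimising sequence Cauchy.\<close>
  have dist: "(norm (Y m - Y n))\<^sup>2 \<le> 2 * ((norm (Y m))\<^sup>2 - d\<^sup>2) + 2 * ((norm (Y n))\<^sup>2 - d\<^sup>2)" for m n
  proof -
    have "(1/2) *\<^sub>R Y m + (1/2) *\<^sub>R Y n \<in> C"
      by (intro convexD[OF assms(2)]) (auto simp: Y)
    then have "d \<le> norm ((1/2) *\<^sub>R (Y m + Y n))" using d_le by (simp add: scaleR_add_right)
    then have "2 * d \<le> norm (Y m + Y n)" by simp
    then have "(2 * d)\<^sup>2 \<le> (norm (Y m + Y n))\<^sup>2" using d0 by (intro power_mono) auto
    then show ?thesis using parallelogram[of "Y m" "Y n"] by (simp add: power_mult_distrib)
  qed
  have "Cauchy Y"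
  proof (rule metric_CauchyI)
    fix e :: real assume e: "0 < e"
    have "(\<lambda>n. (norm (Y n))\<^sup>2 - d\<^sup>2) \<longlonglongrightarrow> d\<^sup>2 - d\<^sup>2" by (intro tendsto_intros lim)
    then have "(\<lambda>n. (norm (Y n))\<^sup>2 - d\<^sup>2) \<longlonglongrightarrow> 0" by simp
    from order_tendstoD(2)[OF this, of "e\<^sup>2 / 4"] e obtain M
      where M: "\<And>n. n \<ge> M \<Longrightarrow> (norm (Y n))\<^sup>2 - d\<^sup>2 < e\<^sup>2 / 4"
      by (auto simp: eventually_sequentially)
    have "dist (Y m) (Y n) < e" if "m \<ge> M" "n \<ge> M" for m n
    proof -
      have "(norm (Y m - Y n))\<^sup>2 < e\<^sup>2" using dist[of m n] M[OF that(1)] M[OF that(2)] by simp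
      then show ?thesis using e by (simp add: dist_norm power_less_imp_less_base)
    qed
    then show "\<exists>M. \<forall>m\<ge>M. \<forall>n\<ge>M. dist (Y m) (Y n) < e" by blast
  qed
  then obtain z where z: "Y \<longlonglongrightarrow> z" using Cauchy_convergent_iff convergent_def by blast
  show ?thesis
  proof
    show "z \<in> C" using closed_sequentially[OF assms(1)] Y z by blast
    have "norm z = d" using LIMSEQ_unique[OF tendsto_norm[OF z] lim] .
    then show "norm z \<le> norm y" if "y \<in> C" for y using d_le[OF that] by simp
  qed
qed

lemma variational_orthogonal:
  assumes "\<And>t::real. norm z \<le> norm (z + t *\<^sub>R y)"
  shows "Re (cinner z (y::'a::complex_hilbert)) = 0"
proof (rule ccontr)
  assume ne: "Re (cinner z y) \<noteq> 0"
  then have y: "y \<noteq> 0" by (auto simp: cinner_simps)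
  define t where "t = - Re (cinner z y) / (norm y)\<^sup>2"
  have "(norm z)\<^sup>2 \<le> (norm (z + t *\<^sub>R y))\<^sup>2" using assms by (intro power_mono) auto
  also have "\<dots> = (norm z)\<^sup>2 - (Re (cinner z y))\<^sup>2 / (norm y)\<^sup>2"
    unfolding norm_add_sq t_def using y
    by (simp add: cinner_simps power_mult_distrib power2_eq_square field_simps)
  finally have "(Re (cinner z y))\<^sup>2 / (norm y)\<^sup>2 \<le> 0" by simp
  moreover have "0 < (Re (cinner z y))\<^sup>2 / (norm y)\<^sup>2" using ne y by simp
  ultimately show False by simp
qed

lemma orthogonal_decomposition:
  fixes K :: "'a::complex_hilbert set"
  assumes K: "cvec.subspace K" "closed K"
  obtains p where "p \<in> K" "\<And>k. k \<in> K \<Longrightarrow> cinner (x - p) k = 0"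
proof -
  have sc: "r *\<^sub>R k \<in> K" if "k \<in> K" for r k
    using cvec.subspace_scale[OF K(1) that] by (simp add: scaleR_scaleC)
  let ?C = "(\<lambda>k. x - k) ` K"
  have "closed ?C"
    using closed_translation[OF closed_negations[OF K(2)], of x] by (simp add: image_image)
  moreover have "convex ?C"
  proof (rule convexI)
    fix a b and u v :: real assume "a \<in> ?C" "b \<in> ?C" "0 \<le> u" "0 \<le> v" and uv: "u + v = 1"
    then obtain k l where kl: "k \<in> K" "l \<in> K" "a = x - k" "b = x - l" by auto
    have "u *\<^sub>R a + v *\<^sub>R b = (u + v) *\<^sub>R x - (u *\<^sub>R k + v *\<^sub>R l)"
      unfolding kl by (simp add: algebra_simps)
    then show "u *\<^sub>R a + v *\<^sub>R b \<in> ?C"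
      using uv kl sc cvec.subspace_add[OF K(1)] by auto
  qed
  moreover have "?C \<noteq> {}" using cvec.subspace_0[OF K(1)] by auto
  ultimately obtain z where z: "z \<in> ?C" "\<And>y. y \<in> ?C \<Longrightarrow> norm z \<le> norm y"
    by (rule closest_to_origin) blast
  then obtain p where p: "p \<in> K" "z = x - p" by auto
  have re: "Re (cinner z k) = 0" if "k \<in> K" for k
  proof (rule variational_orthogonal)
    fix t :: real
    have "z + t *\<^sub>R k = x - (p - t *\<^sub>R k)" by (simp add: p)
    moreover have "p - t *\<^sub>R k \<in> K" using p that sc cvec.subspace_diff[OF K(1)] by blast
    ultimately show "norm z \<le> norm (z + t *\<^sub>R k)" using z(2) by (metis imageI)
  qed
  \<comment> \<open>Testing with \<open>k\<close> and with \<open>\<i> *\<^sub>C k\<close> gives the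
    real and the imaginary part.\<close>
  have "cinner z k = 0" if "k \<in> K" for k
    using re[OF that] re[OF cvec.subspace_scale[OF K(1) that, of \<i>]]
    by (simp add: cinner_simps complex_eq_iff)
  then show ?thesis using that p by blast
qed

text \<open>The point \<open>z\<close> of the hyperplane \<open>f = 1\<close> closest to the origin
  is orthogonal to the kernel of \<open>f\<close>. The real version is stated because the
  functionals met later are only real linear; complex linearity is recovered afterwards.\<close>

lemma riesz_representation_real:
  fixes f :: "'a::complex_hilbert \<Rightarrow> real"
  assumes "bounded_linear f"
  obtains z where "\<And>y. f y = Re (cinner z y)"
proof (cases "\<forall>y. f y = 0")
  case True
  then show ?thesis using that[of 0] by (simp add: cinner_simps)
next
  case False
  interpret f: bounded_linear f by fact
  let ?C = "{y. f y = 1}"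
  have "closed ?C"
    by (intro closed_Collect_eq continuous_intros linear_continuous_on assms)
  moreover have "convex ?C" by (rule convexI) (simp add: f.add f.scaleR)
  moreover have "?C \<noteq> {}"
  proof -
    obtain y where "f y \<noteq> 0" using False by blast
    then have "f ((1 / f y) *\<^sub>R y) = 1" by (simp only: f.scaleR) simp
    then show ?thesis by blast
  qed
  ultimately obtain z where z: "z \<in> ?C" "\<And>y. y \<in> ?C \<Longrightarrow> norm z \<le> norm y"
    by (rule closest_to_origin) blast
  have z0: "z \<noteq> 0" using z(1) f.zero by auto
  have orth: "Re (cinner z y) = 0" if "f y = 0" for y
    by (rule variational_orthogonal, rule z(2)) (use z(1) that in \<open>simp add: f.add f.scaleR\<close>)
  have "f y = Re (cinner ((1 / (norm z)\<^sup>2) *\<^sub>R z) y)" for y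
  proof -
    have "f (y - f y *\<^sub>R z) = 0" using z(1) by (simp add: f.diff f.scaleR)
    then have "Re (cinner z (y - f y *\<^sub>R z)) = 0" by (rule orth)
    then have "Re (cinner z y) = f y * (norm z)\<^sup>2" by (simp add: cinner_simps Re_cinner_self)
    then show ?thesis using z0 by (simp add: cinner_simps)
  qed
  then show ?thesis by (rule that)
qed

section \<open>Finite orthonormal systems and their projections\<close>

definition orthonormal :: "'a::complex_hilbert set \<Rightarrow> bool"
  where "orthonormal E \<longleftrightarrow> finite E \<and> (\<forall>d\<in>E. \<forall>e\<in>E. cinner d e = (if d = e then 1 else 0))"

definition onproj :: "'a::complex_hilbert set \<Rightarrow> 'a \<Rightarrow> 'a"
  where "onproj E x = (\<Sum>e\<in>E. cinner x e *\<^sub>C e)"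

lemma orthonormalD:
  assumes "orthonormal E"
  shows "finite E" "e \<in> E \<Longrightarrow> norm e = 1" "d \<in> E \<Longrightarrow> e \<in> E \<Longrightarrow> d \<noteq> e \<Longrightarrow> cinner d e = 0"
    "e \<in> E \<Longrightarrow> cinner e e = 1"
proof -
  show 1: "cinner e e = 1" if "e \<in> E" for e
    using assms that by (auto simp: orthonormal_def)
  show "norm e = 1" if "e \<in> E"
  proof -
    have "complex_of_real ((norm e)\<^sup>2) = complex_of_real 1" using 1[OF that] by (simp add: cinner_self)
    then have "(norm e)\<^sup>2 = 1" by (simp only: of_real_eq_iff)
    then show ?thesis using real_sqrt_unique[of "norm e" 1] by simp
  qed
qed (use assms in \<open>auto simp: orthonormal_def\<close>)

lemma orthonormal_empty [simp]: "orthonormal {}" by (simp add: orthonormal_def)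

lemma cinner_onproj:
  assumes "orthonormal E" "e \<in> E"
  shows "cinner (onproj E x) e = cinner x e"
proof -
  have "cinner (onproj E x) e = (\<Sum>d\<in>E. cinner x d * (if d = e then 1 else 0))"
    unfolding onproj_def cinner.sum_left using assms
    by (intro sum.cong) (auto simp: cinner_simps orthonormal_def)
  then show ?thesis using assms orthonormalD(1)[OF assms(1)]
    by (simp add: if_distrib sum.delta cong: if_cong)
qed

lemma cinner_diff_onproj: "orthonormal E \<Longrightarrow> e \<in> E \<Longrightarrow> cinner (x - onproj E x) e = 0"
  by (simp add: cinner_simps cinner_onproj)

lemma cinner_onproj_onproj:
  assumes "orthonormal E"
  shows "cinner (onproj E x) y = (\<Sum>e\<in>E. cinner x e * cnj (cinner y e))"
  unfolding onproj_def cinner.sum_left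
  by (intro sum.cong refl) (simp add: cinner_scaleC_left cinner_commute[symmetric])

lemma norm_onproj:
  assumes "orthonormal E"
  shows "(norm (onproj E x))\<^sup>2 = (\<Sum>e\<in>E. (cmod (cinner x e))\<^sup>2)"
proof -
  have "cinner (onproj E x) (onproj E x) = (\<Sum>e\<in>E. cinner x e * cnj (cinner (onproj E x) e))"
    by (rule cinner_onproj_onproj[OF assms])
  also have "\<dots> = (\<Sum>e\<in>E. cinner x e * cnj (cinner x e))"
    by (intro sum.cong refl) (simp only: cinner_onproj[OF assms])
  finally have "Re (cinner (onproj E x) (onproj E x)) = (\<Sum>e\<in>E. Re (cinner x e * cnj (cinner x e)))"
    by simp
  then show ?thesis
    by (simp only: Re_cinner_self complex_norm_square[symmetric] Re_complex_of_real)
qed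

lemma cinner_orthonormal_span:
  assumes "x \<in> cvec.span E" "\<And>e. e \<in> E \<Longrightarrow> cinner y e = 0"
  shows "cinner y x = 0"
  using assms(1)
proof (induction rule: cvec.span_induct_alt)
  case (step c e z)
  then show ?case by (simp add: cinner_simps assms(2))
qed (simp add: cinner_simps)

lemma onproj_in_span: "onproj E x \<in> cvec.span E"
  unfolding onproj_def by (intro cvec.span_sum cvec.span_scale cvec.span_base)

lemma pythagoras_onproj:
  assumes "orthonormal E"
  shows "(norm x)\<^sup>2 = (norm (x - onproj E x))\<^sup>2 + (norm (onproj E x))\<^sup>2"
proof -
  have "cinner (x - onproj E x) (onproj E x) = 0"
    by (rule cinner_orthonormal_span[OF onproj_in_span]) (rule cinner_diff_onproj[OF assms])
  then show ?thesis
    using norm_add_sq[of "x - onproj E x" "onproj E x"] by simp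
qed

lemma bessel: "orthonormal E \<Longrightarrow> (\<Sum>e\<in>E. (cmod (cinner x e))\<^sup>2) \<le> (norm x)\<^sup>2"
  using pythagoras_onproj[of E x] norm_onproj[of E x] by simp

lemma onproj_span_id:
  assumes "orthonormal E" "x \<in> cvec.span E"
  shows "onproj E x = x"
proof -
  have "cinner (x - onproj E x) (x - onproj E x) = 0"
    by (rule cinner_orthonormal_span[of _ E])
      (auto intro: cvec.span_diff assms(2) onproj_in_span cinner_diff_onproj[OF assms(1)])
  then show ?thesis by (simp add: cinner_self)
qed

lemma orthonormal_insert:
  assumes "orthonormal E" "norm x = 1" "\<And>e. e \<in> E \<Longrightarrow> cinner x e = 0"
  shows "orthonormal (insert x E)" "x \<notin> E"
proof -
  show nin: "x \<notin> E" using assms(2) assms(3)[of x] by (auto simp: cinner_self)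
  have "cinner e x = 0" if "e \<in> E" for e 
    using assms(3)[OF that] by (simp add: cinner_commute[of e])
  then show "orthonormal (insert x E)" using nin assms orthonormalD(1)[OF assms(1)]
    by (auto simp: orthonormal_def cinner_self)
qed

lemma orthonormal_extend:
  fixes x :: "'a::complex_hilbert"
  assumes "orthonormal E" "x \<noteq> onproj E x"
  defines "u \<equiv> (1 / norm (x - onproj E x)) *\<^sub>R (x - onproj E x)"
  shows "orthonormal (insert u E)" "u \<notin> E" "norm u = 1"
    "x = onproj E x + norm (x - onproj E x) *\<^sub>R u"
proof -
  show n: "norm u = 1" using assms(2) by (simp add: u_def)
  have "cinner u e = 0" if "e \<in> E" for e
    using cinner_diff_onproj[OF assms(1) that, of x]
    unfolding u_def cinner_scaleR_left by simp
  from orthonormal_insert[OF assms(1) n this] show "orthonormal (insert u E)" "u \<notin> E" by auto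
  show "x = onproj E x + norm (x - onproj E x) *\<^sub>R u" using assms(2) by (simp add: u_def)
qed

lemma gram_schmidt:
  assumes "finite B"
  obtains E where "orthonormal E" "cvec.span E = cvec.span B"
proof -
  have "\<exists>E. orthonormal E \<and> cvec.span E = cvec.span B"
    using assms
  proof induction
    case empty
    then show ?case by (intro exI[of _ "{}"]) simp
  next
    case (insert b B)
    then obtain E where E: "orthonormal E" "cvec.span E = cvec.span B" by blast
    show ?case
    proof (cases "b = onproj E b")
      case True
      then have "b \<in> cvec.span B" using onproj_in_span[of E b] E by simp
      then have "cvec.span (insert b B) = cvec.span B" by (rule cvec.span_redundant)
      then show ?thesis using E by auto
    next
      case False
      define u where "u = (1 / norm (b - onproj E b)) *\<^sub>R (b - onproj E b)"
      note u = orthonormal_extend[OF E(1) False, folded u_def]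
      have pE: "onproj E b \<in> cvec.span E" by (rule onproj_in_span)
      have pE': "onproj E b \<in> cvec.span (insert b B)"
        using pE E(2) cvec.span_mono[of B "insert b B"] by auto
      have "cvec.span (insert u E) = cvec.span (insert b B)"
      proof (rule cvec.span_eq[THEN iffD2], intro conjI subsetI)
        fix y assume "y \<in> insert u E"
        moreover have "u \<in> cvec.span (insert b B)"
          unfolding u_def scaleR_scaleC
          by (intro cvec.span_scale cvec.span_diff pE' cvec.span_base insertI1)
        moreover have "E \<subseteq> cvec.span (insert b B)"
          using cvec.span_superset[of E] E(2) cvec.span_mono[of B "insert b B"] by auto
        ultimately show "y \<in> cvec.span (insert b B)" by auto
      next
        fix y assume y: "y \<in> insert b B"
        have "onproj E b + norm (b - onproj E b) *\<^sub>R u \<in> cvec.span (insert u E)"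
          unfolding scaleR_scaleC by (intro cvec.span_add cvec.span_scale cvec.span_base insertI1
            subsetD[OF cvec.span_mono[OF subset_insertI] pE])
        then have "b \<in> cvec.span (insert u E)" using u(4) by simp
        moreover have "B \<subseteq> cvec.span (insert u E)"
          using cvec.span_superset[of B] E(2) cvec.span_mono[of E "insert u E"] by auto
        ultimately show "y \<in> cvec.span (insert u E)" using y by auto
      qed
      then show ?thesis using u(1) by blast
    qed
  qed
  then show ?thesis using that by blast
qed

text \<open>By induction the set is a sum of continuous images of the closed unit disc. For
  orthonormal \<open>E\<close> it contains the unit ball of the span, which is the form of
  finite-dimensional compactness used later.\<close>

lemma compact_finite_combinations:
  fixes E :: "'a::complex_hilbert set"
  assumes "finite E"
  shows "compact {(\<Sum>e\<in>E. c e *\<^sub>C e) | c. \<forall>e\<in>E. cmod (c e) \<le> 1}"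
  using assms
proof induction
  case empty
  then show ?case by simp
next
  case (insert b E)
  let ?S = "{(\<Sum>e\<in>E. c e *\<^sub>C e) | c. \<forall>e\<in>E. cmod (c e) \<le> 1}"
  let ?R = "(\<lambda>c. c *\<^sub>C b) ` cball 0 1"
  have "compact ?R"
    by (intro compact_continuous_image scaleC.continuous_on continuous_intros) simp
  then have "compact {x + y | x y. x \<in> ?R \<and> y \<in> ?S}"
    using insert.IH by (rule compact_sums)
  moreover have "{x + y | x y. x \<in> ?R \<and> y \<in> ?S}
      = {(\<Sum>e\<in>insert b E. c e *\<^sub>C e) | c. \<forall>e\<in>insert b E. cmod (c e) \<le> 1}" (is "?L = ?M")
  proof (intro equalityI subsetI)
    fix z assume "z \<in> ?L"
    then obtain d c where dc: "cmod d \<le> 1" "\<forall>e\<in>E. cmod (c e) \<le> 1" "z = d *\<^sub>C b + (\<Sum>e\<in>E. c e *\<^sub>C e)"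
      by auto
    have "(\<Sum>e\<in>E. (c(b := d)) e *\<^sub>C e) = (\<Sum>e\<in>E. c e *\<^sub>C e)"
      using insert.hyps by (intro sum.cong) auto
    then show "z \<in> ?M" using dc insert.hyps by (intro CollectI exI[of _ "c(b := d)"]) auto
  next
    fix z assume "z \<in> ?M"
    then obtain c where c: "\<forall>e\<in>insert b E. cmod (c e) \<le> 1" "z = (\<Sum>e\<in>insert b E. c e *\<^sub>C e)" by blast
    then have "z = c b *\<^sub>C b + (\<Sum>e\<in>E. c e *\<^sub>C e)" using insert.hyps by simp
    moreover have "c b *\<^sub>C b \<in> ?R" "(\<Sum>e\<in>E. c e *\<^sub>C e) \<in> ?S" using c(1) by auto
    ultimately show "z \<in> ?L" by blast
  qed
  ultimately show ?case by simp
qed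

section \<open>Gaussian means\<close>

definition gauss :: "real measure"
  where "gauss = density lborel (\<lambda>x. ennreal (std_normal_density x))"

lemma prob_space_gauss: "prob_space gauss"
  unfolding gauss_def by (rule prob_space_normal_density) simp

interpretation gauss: prob_space gauss
  by (rule prob_space_gauss)

lemma sets_gauss [simp, measurable_cong]: "sets gauss = sets borel"
  by (simp add: gauss_def)

lemma space_gauss [simp]: "space gauss = UNIV"
  by (simp add: gauss_def)

lemma gauss_moment:
  "integrable gauss (\<lambda>t. \<bar>t\<bar> ^ k)"
  unfolding gauss_def
  by (subst integrable_density) (auto simp: integrable_std_normal_moment_abs)

lemma gauss_first_moment: "(\<integral>t. t \<partial>gauss) = 0"
  unfolding gauss_def using integral_std_normal_moment_odd[of 0]
  by (subst integral_density) auto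

lemma gauss_second_moment: "(\<integral>t. t\<^sup>2 \<partial>gauss) = 1"
  unfolding gauss_def using integral_std_normal_moment_even[of 1]
  by (subst integral_density) (auto simp: fact_numeral)

definition gabs :: real
  where "gabs = (\<integral>t. \<bar>t\<bar> \<partial>gauss)"

lemma gabs_pos: "0 < gabs"
proof -
  have "gabs = sqrt (2 / pi)"
    unfolding gabs_def gauss_def using integral_std_normal_moment_abs_odd[of 0]
    by (subst integral_density) auto
  moreover have "0 < sqrt (2 / pi)" by (intro real_sqrt_gt_zero divide_pos_pos) auto
  ultimately show ?thesis by metis
qed

section \<open>Lipschitz functions and their Gaussian integrals\<close>

lemma lipschitz_on_abs_diff: "L-lipschitz_on UNIV (f :: 'a::metric_space \<Rightarrow> real) \<Longrightarrow> \<bar>f x - f y\<bar> \<le> L * dist x y"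
  using lipschitz_onD[of L UNIV f x y] by (simp add: dist_real_def)

lemma lipschitz_on_realI:
  fixes f :: "'a::metric_space \<Rightarrow> real"
  assumes "0 \<le> L" "\<And>x y. f x - f y \<le> L * dist x y"
  shows "L-lipschitz_on UNIV f"
proof (rule lipschitz_onI)
  fix x y
  show "dist (f x) (f y) \<le> L * dist x y"
    using assms(2)[of x y] assms(2)[of y x] by (simp add: dist_real_def dist_commute)
qed fact

lemma integrable_gauss_lipschitz:
  fixes f :: "real \<Rightarrow> real"
  assumes "L-lipschitz_on UNIV f"
  shows "integrable gauss f"
proof (rule Bochner_Integration.integrable_bound)
  show "integrable gauss (\<lambda>t::real. \<bar>f 0\<bar> + L * \<bar>t\<bar>)"
    using gauss_moment[of 1] by simp
  have "f \<in> borel_measurable borel"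
    using lipschitz_on_continuous_on[OF assms] by (rule borel_measurable_continuous_onI)
  then show "f \<in> borel_measurable gauss" by simp
  show "AE t in gauss. norm (f t) \<le> norm (\<bar>f 0\<bar> + L * \<bar>t\<bar>)"
  proof (intro always_eventually allI)
    fix t
    have "\<bar>f t - f 0\<bar> \<le> L * \<bar>t\<bar>" using lipschitz_on_abs_diff[OF assms, of t 0] by simp
    moreover have "0 \<le> L" using assms by (rule lipschitz_on_nonneg)
    moreover have "0 \<le> L * \<bar>t\<bar>" using calculation by simp
    ultimately show "norm (f t) \<le> norm (\<bar>f 0\<bar> + L * \<bar>t\<bar>)" unfolding real_norm_def by linarith
  qed
qed

lemma lipschitz_on_line:
  fixes f :: "'a::real_normed_vector \<Rightarrow> real"
  assumes "L-lipschitz_on UNIV f"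
  shows "(L * norm v)-lipschitz_on UNIV (\<lambda>t. f (x + t *\<^sub>R v))"
proof (rule lipschitz_on_realI)
  show L: "0 \<le> L * norm v" using lipschitz_on_nonneg[OF assms] by simp
  fix s t :: real
  have d: "dist (x + s *\<^sub>R v) (x + t *\<^sub>R v) = norm v * dist s t"
    unfolding dist_norm[of "x + s *\<^sub>R v"] dist_real_def
    by (simp add: scaleR_left_diff_distrib[symmetric])
  have "f (x + s *\<^sub>R v) - f (x + t *\<^sub>R v) \<le> L * dist (x + s *\<^sub>R v) (x + t *\<^sub>R v)"
    using lipschitz_on_abs_diff[OF assms, of "x + s *\<^sub>R v" "x + t *\<^sub>R v"] by linarith
  then show "f (x + s *\<^sub>R v) - f (x + t *\<^sub>R v) \<le> L * norm v * dist s t"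
    by (simp only: d mult.assoc)
qed

lemma integrable_line:
  fixes f :: "'a::real_normed_vector \<Rightarrow> real"
  assumes "L-lipschitz_on UNIV f"
  shows "integrable gauss (\<lambda>t. f (x + t *\<^sub>R v))"
  by (rule integrable_gauss_lipschitz[OF lipschitz_on_line[OF assms]])

text \<open>Convolution of \<open>f\<close> with the law of \<open>t *\<^sub>R v\<close> for a
  standard Gaussian variable \<open>t\<close>.\<close>

definition gstep :: "'a::real_normed_vector \<Rightarrow> ('a \<Rightarrow> real) \<Rightarrow> 'a \<Rightarrow> real"
  where "gstep v f x = (\<integral>t. f (x + t *\<^sub>R v) \<partial>gauss)"

lemma gstep_lipschitz:
  assumes "L-lipschitz_on UNIV f"
  shows "L-lipschitz_on UNIV (gstep v f)"
proof (rule lipschitz_on_realI)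
  show "0 \<le> L" using assms by (rule lipschitz_on_nonneg)
  fix x y
  have "gstep v f x - gstep v f y = (\<integral>t. f (x + t *\<^sub>R v) - f (y + t *\<^sub>R v) \<partial>gauss)"
    unfolding gstep_def using integrable_line[OF assms] by simp
  also have "\<dots> \<le> (\<integral>t. L * dist x y \<partial>gauss)"
  proof (rule integral_mono)
    show "integrable gauss (\<lambda>t. f (x + t *\<^sub>R v) - f (y + t *\<^sub>R v))"
      using integrable_line[OF assms] by simp
    show "f (x + t *\<^sub>R v) - f (y + t *\<^sub>R v) \<le> L * dist x y" for t
      using lipschitz_on_abs_diff[OF assms, of "x + t *\<^sub>R v" "y + t *\<^sub>R v"] by simp
  qed simp
  finally show "gstep v f x - gstep v f y \<le> L * dist x y" using gauss.prob_space by simp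
qed

text \<open>A class of integrands that is closed under \<open>gstep\<close> and whose members are
  Gaussian integrable along every line.\<close>

definition lip :: "('a::metric_space \<Rightarrow> real) \<Rightarrow> bool"
  where "lip f \<longleftrightarrow> (\<exists>L. L-lipschitz_on UNIV f)"

lemma lipI: "L-lipschitz_on UNIV f \<Longrightarrow> lip f" by (auto simp: lip_def)

lemma lip_gstep: "lip f \<Longrightarrow> lip (gstep v f)"
  using gstep_lipschitz by (auto simp: lip_def)

lemma lip_integrable_line:
  "lip f \<Longrightarrow> integrable gauss (\<lambda>t. f ((x::'a::real_normed_vector) + t *\<^sub>R v))"
  unfolding lip_def by (elim exE) (rule integrable_line)

lemma lip_integrable: "lip f \<Longrightarrow> integrable gauss f"
  using integrable_gauss_lipschitz by (auto simp: lip_def)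

lemma lip_const [simp]: "lip (\<lambda>x. c)"
  by (intro lipI[of 0] lipschitz_on_realI) auto

lemma lip_add:
  assumes "lip f" "lip g" shows "lip (\<lambda>x. f x + g x)"
proof -
  obtain L M where LM: "L-lipschitz_on UNIV f" "M-lipschitz_on UNIV g" using assms by (auto simp: lip_def)
  show ?thesis by (rule lipI[OF lipschitz_on_add[OF LM]])
qed

lemma lip_cmult:
  assumes "lip f" shows "lip (\<lambda>x. c * f x)"
proof -
  obtain L where L: "L-lipschitz_on UNIV f" using assms by (auto simp: lip_def)
  show ?thesis using lipschitz_on_cmult_real[OF L, of c] by (rule lipI)
qed

lemma lip_diff: "lip f \<Longrightarrow> lip g \<Longrightarrow> lip (\<lambda>x. f x - g x)"
  using lip_add[of f "\<lambda>x. (-1) * g x"] lip_cmult[of g "-1"] by simp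

lemma lip_sum: "(\<And>i. i \<in> I \<Longrightarrow> lip (f i)) \<Longrightarrow> lip (\<lambda>x. \<Sum>i\<in>I. f i x)"
  by (induction I rule: infinite_finite_induct) (auto intro: lip_add)

lemma lip_compose:
  assumes "lip f" "L-lipschitz_on UNIV h" shows "lip (\<lambda>x. f (h x))"
proof -
  obtain M where M: "M-lipschitz_on UNIV f" using assms by (auto simp: lip_def)
  have "(M * L)-lipschitz_on UNIV (f \<circ> h)"
    by (rule lipschitz_on_compose[OF assms(2) lipschitz_on_subset[OF M]]) auto
  then show ?thesis unfolding comp_def by (rule lipI)
qed

lemma lip_compose_linear:
  assumes "lip f" "bounded_linear h" shows "lip (\<lambda>x. f (c + h x))"
proof -
  obtain B where B: "B-lipschitz_on UNIV h"
    using bounded_linear.lipschitz_boundE[OF assms(2)] .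
  have "B-lipschitz_on UNIV (\<lambda>x. c + h x)"
    using lipschitz_onD[OF B] lipschitz_on_nonneg[OF B] by (intro lipschitz_onI) auto
  then show ?thesis by (rule lip_compose[OF assms(1)])
qed

lemma lip_norm: "lip (\<lambda>x::'a::real_normed_vector. norm x)"
  by (intro lipI[of 1] lipschitz_on_realI) (auto simp: dist_norm norm_triangle_ineq2)

lemma lip_max:
  assumes "lip f" "lip g" shows "lip (\<lambda>x. max (f x) (g x))"
proof -
  obtain L M where LM: "L-lipschitz_on UNIV f" "M-lipschitz_on UNIV g" using assms by (auto simp: lip_def)
  have nn: "0 \<le> L" "0 \<le> M" using LM lipschitz_on_nonneg by auto
  have "(L + M)-lipschitz_on UNIV (\<lambda>x. max (f x) (g x))"
  proof (rule lipschitz_on_realI)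
    fix x y
    have "f x - f y \<le> L * dist x y" "g x - g y \<le> M * dist x y"
      using lipschitz_on_abs_diff[OF LM(1), of x y] lipschitz_on_abs_diff[OF LM(2), of x y] by auto
    moreover have "0 \<le> L * dist x y" "0 \<le> M * dist x y" using nn by auto
    ultimately show "max (f x) (g x) - max (f y) (g y) \<le> (L + M) * dist x y"
      unfolding distrib_right by (auto simp: max_def)
  qed (use nn in auto)
  then show ?thesis by (rule lipI)
qed

lemma lip_abs:
  assumes "lip f" shows "lip (\<lambda>x. \<bar>f x\<bar>)"
proof -
  have "(\<lambda>x. \<bar>f x\<bar>) = (\<lambda>x. max (f x) ((-1) * f x))" by (auto simp: max_def)
  then show ?thesis using lip_max[OF assms lip_cmult[OF assms, of "-1"]] by simp
qed

lemma gstep_add: "lip f \<Longrightarrow> lip g \<Longrightarrow> gstep v (\<lambda>x. f x + g x) = (\<lambda>x. gstep v f x + gstep v g x)"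
  by (rule ext) (simp add: gstep_def lip_integrable_line)

lemma gstep_cmult: "lip f \<Longrightarrow> gstep v (\<lambda>x. c * f x) = (\<lambda>x. c * gstep v f x)"
  by (rule ext) (simp add: gstep_def)

lemma gstep_mono: "lip f \<Longrightarrow> lip g \<Longrightarrow> (\<And>x. f x \<le> g x) \<Longrightarrow> gstep v f x \<le> gstep v g x"
  unfolding gstep_def by (intro integral_mono lip_integrable_line) auto

lemma gstep_const: "gstep v (\<lambda>x. c) = (\<lambda>x. c)"
  by (rule ext) (use gauss.prob_space in \<open>simp add: gstep_def\<close>)

text \<open>The expectation of \<open>f\<close> at the random combination of the list with
  independent standard Gaussian coefficients, as an iterated one-dimensional integral. The head of
  the list is integrated innermost.\<close>

primrec gmean :: "'a::real_normed_vector list \<Rightarrow> ('a \<Rightarrow> real) \<Rightarrow> real"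
  where
    "gmean [] f = f 0"
  | "gmean (v # vs) f = gmean vs (gstep v f)"

lemma gmean_add: "lip f \<Longrightarrow> lip g \<Longrightarrow> gmean vs (\<lambda>x. f x + g x) = gmean vs f + gmean vs g"
  by (induction vs arbitrary: f g) (simp_all add: gstep_add lip_gstep)

lemma gmean_cmult: "lip f \<Longrightarrow> gmean vs (\<lambda>x. c * f x) = c * gmean vs f"
  by (induction vs arbitrary: f) (simp_all add: gstep_cmult lip_gstep)

lemma gmean_diff: "lip f \<Longrightarrow> lip g \<Longrightarrow> gmean vs (\<lambda>x. f x - g x) = gmean vs f - gmean vs g"
  using gmean_add[of f "\<lambda>x. (-1) * g x" vs] lip_cmult[of g "-1"] gmean_cmult[of g vs "-1"] by simp

lemma gmean_mono: "lip f \<Longrightarrow> lip g \<Longrightarrow> (\<And>x. f x \<le> g x) \<Longrightarrow> gmean vs f \<le> gmean vs g"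
  by (induction vs arbitrary: f g) (simp_all add: gstep_mono lip_gstep)

lemma gmean_const: "gmean vs (\<lambda>x. c) = c"
  by (induction vs) (simp_all add: gstep_const)

lemma gmean_sum: "(\<And>i. i \<in> I \<Longrightarrow> lip (f i)) \<Longrightarrow> gmean vs (\<lambda>x. \<Sum>i\<in>I. f i x) = (\<Sum>i\<in>I. gmean vs (f i))"
  by (induction I rule: infinite_finite_induct) (auto simp: gmean_const gmean_add lip_sum)

lemma gmean_nonneg: "lip f \<Longrightarrow> (\<And>x. 0 \<le> f x) \<Longrightarrow> 0 \<le> gmean vs f"
  using gmean_mono[of "\<lambda>_. 0" f vs] by (simp add: gmean_const)

lemma gmean_abs_le:
  assumes "lip f" shows "\<bar>gmean vs f\<bar> \<le> gmean vs (\<lambda>x. \<bar>f x\<bar>)"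
proof -
  have "gmean vs f \<le> gmean vs (\<lambda>x. \<bar>f x\<bar>)"
    by (intro gmean_mono lip_abs assms) auto
  moreover have "gmean vs (\<lambda>x. (-1) * f x) \<le> gmean vs (\<lambda>x. \<bar>f x\<bar>)"
    by (intro gmean_mono lip_abs lip_cmult assms) auto
  ultimately show ?thesis using gmean_cmult[OF assms, of vs "-1"] by simp
qed

lemma gmean_le_exists:
  assumes "lip f" "gmean vs f \<le> c" "0 < e"
  shows "\<exists>x. f x \<le> c + e"
proof (rule ccontr)
  assume "\<not> ?thesis"
  then have "c + e \<le> f x" for x by (metis linear)
  then have "c + e \<le> gmean vs f" using gmean_mono[of "\<lambda>_. c + e" f vs] assms(1) by (simp add: gmean_const)
  then show False using assms(2,3) by simp
qed

lemma gmean_lipschitz: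
  assumes "L-lipschitz_on UNIV (\<lambda>x. f x)"
  shows "L-lipschitz_on UNIV (\<lambda>x. gmean vs (\<lambda>y. f (x + y)))"
  using assms
proof (induction vs arbitrary: f)
  case (Cons v vs)
  have "gstep v (\<lambda>y. f (x + y)) = (\<lambda>y. gstep v f (x + y))" for x
    by (rule ext) (simp add: gstep_def add.assoc)
  then show ?case using Cons.IH[OF gstep_lipschitz[OF Cons.prems]] by simp
qed simp

text \<open>Concatenation of lists is convolution of laws.\<close>

lemma gmean_append: "gmean (us @ ws) f = gmean ws (\<lambda>x. gmean us (\<lambda>y. f (x + y)))"
proof (induction us arbitrary: f)
  case (Cons u us)
  have "gstep u (\<lambda>y. f (x + y)) = (\<lambda>y. gstep u f (x + y))" for x
    by (rule ext) (simp add: gstep_def add.assoc)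
  then show ?case using Cons.IH[of "gstep u f"] by simp
qed simp

lemma gmean_linear_map:
  assumes "linear h"
  shows "gmean vs (\<lambda>x. f (h x)) = gmean (map h vs) f"
proof (induction vs arbitrary: f)
  case Nil
  then show ?case using linear_0[OF assms] by simp
next
  case (Cons v vs)
  have "gstep v (\<lambda>x. f (h x)) = (\<lambda>x. gstep (h v) f (h x))"
    by (rule ext) (simp add: gstep_def linear_add[OF assms] linear_scale[OF assms])
  then show ?case using Cons.IH[of "gstep (h v) f"] by simp
qed

section \<open>Rotation invariance of the planar Gaussian measure\<close>

lemma nn_integral_shear_fst:
  fixes h :: "real \<times> real \<Rightarrow> ennreal"
  assumes [measurable]: "h \<in> borel_measurable (lborel \<Otimes>\<^sub>M lborel)"
  shows "(\<integral>\<^sup>+z. h (fst z + a * snd z, snd z) \<partial>(lborel \<Otimes>\<^sub>M lborel)) = (\<integral>\<^sup>+z. h z \<partial>(lborel \<Otimes>\<^sub>M lborel))"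
proof -
  have "(\<integral>\<^sup>+z. h (fst z + a * snd z, snd z) \<partial>(lborel \<Otimes>\<^sub>M lborel))
      = (\<integral>\<^sup>+y. (\<integral>\<^sup>+x. h (x + a * y, y) \<partial>lborel) \<partial>lborel)"
    by (subst lborel_pair.nn_integral_snd[symmetric]) auto
  also have "\<dots> = (\<integral>\<^sup>+y. (\<integral>\<^sup>+x. h (x, y) \<partial>lborel) \<partial>lborel)"
  proof (rule nn_integral_cong)
    fix y :: real
    have [measurable]: "(\<lambda>x. h (x, y)) \<in> borel_measurable borel" by measurable
    show "(\<integral>\<^sup>+x. h (x + a * y, y) \<partial>lborel) = (\<integral>\<^sup>+x. h (x, y) \<partial>lborel)"
      by (subst nn_integral_real_affine[of "\<lambda>x. h (x, y)" 1 "a * y"]) (auto simp: add.commute)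
  qed
  also have "\<dots> = (\<integral>\<^sup>+z. h z \<partial>(lborel \<Otimes>\<^sub>M lborel))"
    by (subst lborel_pair.nn_integral_snd) auto
  finally show ?thesis .
qed

lemma nn_integral_shear_snd:
  fixes h :: "real \<times> real \<Rightarrow> ennreal"
  assumes [measurable]: "h \<in> borel_measurable (lborel \<Otimes>\<^sub>M lborel)"
  shows "(\<integral>\<^sup>+z. h (fst z, snd z + a * fst z) \<partial>(lborel \<Otimes>\<^sub>M lborel)) = (\<integral>\<^sup>+z. h z \<partial>(lborel \<Otimes>\<^sub>M lborel))"
proof -
  have "(\<integral>\<^sup>+z. h (fst z, snd z + a * fst z) \<partial>(lborel \<Otimes>\<^sub>M lborel))
      = (\<integral>\<^sup>+x. (\<integral>\<^sup>+y. h (x, y + a * x) \<partial>lborel) \<partial>lborel)"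
    by (subst lborel.nn_integral_fst[symmetric]) auto
  also have "\<dots> = (\<integral>\<^sup>+x. (\<integral>\<^sup>+y. h (x, y) \<partial>lborel) \<partial>lborel)"
  proof (rule nn_integral_cong)
    fix x :: real
    have [measurable]: "(\<lambda>y. h (x, y)) \<in> borel_measurable borel" by measurable
    show "(\<integral>\<^sup>+y. h (x, y + a * x) \<partial>lborel) = (\<integral>\<^sup>+y. h (x, y) \<partial>lborel)"
      by (subst nn_integral_real_affine[of "\<lambda>y. h (x, y)" 1 "a * x"]) (auto simp: add.commute)
  qed
  also have "\<dots> = (\<integral>\<^sup>+z. h z \<partial>(lborel \<Otimes>\<^sub>M lborel))"
    by (subst lborel.nn_integral_fst) auto
  finally show ?thesis .
qed

text \<open>A rotation by an angle that is not a multiple of \<open>\<pi>\<close> is a product of three shears.\<close>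

lemma nn_integral_rotate:
  fixes h :: "real \<times> real \<Rightarrow> ennreal"
  assumes h: "h \<in> borel_measurable (lborel \<Otimes>\<^sub>M lborel)" and cs: "c\<^sup>2 + s\<^sup>2 = 1"
  shows "(\<integral>\<^sup>+z. h (c * fst z - s * snd z, s * fst z + c * snd z) \<partial>(lborel \<Otimes>\<^sub>M lborel))
    = (\<integral>\<^sup>+z. h z \<partial>(lborel \<Otimes>\<^sub>M lborel))"
proof -
  have *: "(\<integral>\<^sup>+z. h (c * fst z - s * snd z, s * fst z + c * snd z) \<partial>(lborel \<Otimes>\<^sub>M lborel))
      = (\<integral>\<^sup>+z. h z \<partial>(lborel \<Otimes>\<^sub>M lborel))"
    if s: "s \<noteq> 0" and cs: "c\<^sup>2 + s\<^sup>2 = 1" and [measurable]: "h \<in> borel_measurable (lborel \<Otimes>\<^sub>M lborel)"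
    for c s and h :: "real \<times> real \<Rightarrow> ennreal"
  proof -
    \<comment> \<open>Minus the tangent of half the angle; by \<open>e1\<close> and
      \<open>e2\<close> the shears with parameters \<open>a\<close>, \<open>s\<close>,
      \<open>a\<close> compose to the rotation.\<close>
    define a where "a = (c - 1) / s"
    have as: "a * s = c - 1" using s by (simp add: a_def)
    have e1: "1 + a * s = c" using as by simp
    have "a * (1 + c) * s = (a * s) * (1 + c)" by simp
    also have "\<dots> = (c - 1) * (1 + c)" unfolding as ..
    also have "\<dots> = - s * s" using cs by (simp add: power2_eq_square algebra_simps)
    finally have e2: "a * (1 + c) = - s" using s by (simp only: mult_cancel_right) auto
    define h1 where "h1 z = h (fst z + a * snd z, snd z)" for z
    define h2 where "h2 z = h1 (fst z, snd z + s * fst z)" for z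
    have [measurable]: "h1 \<in> borel_measurable (lborel \<Otimes>\<^sub>M lborel)" unfolding h1_def by measurable
    have [measurable]: "h2 \<in> borel_measurable (lborel \<Otimes>\<^sub>M lborel)" unfolding h2_def by measurable
    have eq: "h (c * x - s * y, s * x + c * y) = h2 (x + a * y, y)" for x y
    proof -
      have "x + a * y + a * (y + s * (x + a * y)) = (1 + a * s) * x + a * (1 + (1 + a * s)) * y"
        by (simp add: algebra_simps)
      then have "x + a * y + a * (y + s * (x + a * y)) = c * x - s * y" unfolding e1 e2 by simp
      moreover have "y + s * (x + a * y) = s * x + (1 + a * s) * y" by (simp add: algebra_simps)
      ultimately show ?thesis by (simp add: h2_def h1_def e1)
    qed
    have "(\<integral>\<^sup>+z. h (c * fst z - s * snd z, s * fst z + c * snd z) \<partial>(lborel \<Otimes>\<^sub>M lborel))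
        = (\<integral>\<^sup>+z. h2 (fst z + a * snd z, snd z) \<partial>(lborel \<Otimes>\<^sub>M lborel))" by (simp add: eq)
    also have "\<dots> = (\<integral>\<^sup>+z. h2 z \<partial>(lborel \<Otimes>\<^sub>M lborel))" by (rule nn_integral_shear_fst) fact
    also have "\<dots> = (\<integral>\<^sup>+z. h1 z \<partial>(lborel \<Otimes>\<^sub>M lborel))"
      unfolding h2_def by (rule nn_integral_shear_snd) fact
    also have "\<dots> = (\<integral>\<^sup>+z. h z \<partial>(lborel \<Otimes>\<^sub>M lborel))"
      unfolding h1_def by (rule nn_integral_shear_fst) fact
    finally show ?thesis .
  qed
  show ?thesis
  proof (cases "s = 0")
    case True
    then have "c = 1 \<or> c = - 1" using cs by (simp add: power2_eq_1_iff)
    then show ?thesis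
    proof
      assume c: "c = - 1"
      \<comment> \<open>The half turn has \<open>s = 0\<close>, so it is split into two quarter
        turns.\<close>
      define h1 where "h1 z = h (0 * fst z - 1 * snd z, 1 * fst z + 0 * snd z)" for z
      have [measurable]: "h1 \<in> borel_measurable (lborel \<Otimes>\<^sub>M lborel)"
        unfolding h1_def using h by measurable
      have "(\<integral>\<^sup>+z. h1 (0 * fst z - 1 * snd z, 1 * fst z + 0 * snd z) \<partial>(lborel \<Otimes>\<^sub>M lborel))
          = (\<integral>\<^sup>+z. h1 z \<partial>(lborel \<Otimes>\<^sub>M lborel))" by (rule *) auto
      also have "\<dots> = (\<integral>\<^sup>+z. h z \<partial>(lborel \<Otimes>\<^sub>M lborel))" unfolding h1_def by (rule *) (auto simp: h)
      finally show ?thesis using True c by (simp add: h1_def)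
    qed (simp add: True)
  qed (rule *[OF _ cs h])
qed

lemma gauss_pair_density:
  "gauss \<Otimes>\<^sub>M gauss = density (lborel \<Otimes>\<^sub>M lborel)
    (\<lambda>z. ennreal (std_normal_density (fst z)) * ennreal (std_normal_density (snd z)))"
proof -
  have "sigma_finite_measure gauss" by unfold_locales
  then show ?thesis unfolding gauss_def
    by (subst pair_measure_density) (auto simp: lborel.sigma_finite_measure_axioms case_prod_unfold)
qed

lemma std_normal_density_rotate:
  fixes c s :: real
  assumes "c\<^sup>2 + s\<^sup>2 = 1"
  shows "std_normal_density (c * x - s * y) * std_normal_density (s * x + c * y)
    = std_normal_density x * std_normal_density y"
proof -
  have "(c * x - s * y)\<^sup>2 + (s * x + c * y)\<^sup>2 = (c\<^sup>2 + s\<^sup>2) * (x\<^sup>2 + y\<^sup>2)"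
    by (simp add: power2_eq_square algebra_simps)
  then have "- (c * x - s * y)\<^sup>2 / 2 + - (s * x + c * y)\<^sup>2 / 2 = - x\<^sup>2 / 2 + - y\<^sup>2 / 2"
    unfolding assms by (simp add: field_simps)
  then have "exp (- (c * x - s * y)\<^sup>2 / 2) * exp (- (s * x + c * y)\<^sup>2 / 2)
      = exp (- x\<^sup>2 / 2) * exp (- y\<^sup>2 / 2)"
    by (simp only: exp_add[symmetric])
  then show ?thesis unfolding std_normal_density_def by simp
qed

text \<open>Planar Lebesgue measure is rotation invariant, and the product density depends only on
  the sum of the squares.\<close>

lemma gauss_pair_rotate:
  assumes cs: "c\<^sup>2 + s\<^sup>2 = 1"
  shows "distr (gauss \<Otimes>\<^sub>M gauss) (gauss \<Otimes>\<^sub>M gauss)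
      (\<lambda>z. (c * fst z - s * snd z, s * fst z + c * snd z)) = gauss \<Otimes>\<^sub>M gauss" (is "distr _ _ ?R = _")
proof (rule measure_eqI)
  fix A assume "A \<in> sets (distr (gauss \<Otimes>\<^sub>M gauss) (gauss \<Otimes>\<^sub>M gauss) ?R)"
  then have A: "A \<in> sets (gauss \<Otimes>\<^sub>M gauss)" by simp
  have sets_eq: "sets (gauss \<Otimes>\<^sub>M gauss) = sets (lborel \<Otimes>\<^sub>M lborel)"
    by (intro sets_pair_measure_cong) auto
  have A' [measurable]: "A \<in> sets (lborel \<Otimes>\<^sub>M lborel)" using A sets_eq by simp
  let ?d = "\<lambda>z. ennreal (std_normal_density (fst z)) * ennreal (std_normal_density (snd z))"
  have R [measurable]: "?R \<in> measurable (gauss \<Otimes>\<^sub>M gauss) (gauss \<Otimes>\<^sub>M gauss)" by measurable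
  have R' [measurable]: "?R \<in> measurable (lborel \<Otimes>\<^sub>M lborel) (lborel \<Otimes>\<^sub>M lborel)" by measurable
  have d: "?d (?R z) = ?d z" for z
    using std_normal_density_rotate[OF cs, of "fst z" "snd z"] by (simp add: ennreal_mult'[symmetric])
  have "emeasure (distr (gauss \<Otimes>\<^sub>M gauss) (gauss \<Otimes>\<^sub>M gauss) ?R) A
      = emeasure (gauss \<Otimes>\<^sub>M gauss) (?R -` A \<inter> space (gauss \<Otimes>\<^sub>M gauss))"
    by (rule emeasure_distr[OF R A])
  also have "\<dots> = (\<integral>\<^sup>+z. ?d z * indicator (?R -` A \<inter> space (lborel \<Otimes>\<^sub>M lborel)) z \<partial>(lborel \<Otimes>\<^sub>M lborel))"
    unfolding gauss_pair_density 
    by (subst emeasure_density)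
      (use measurable_sets[OF R' A'] in \<open>auto simp: space_pair_measure\<close>)
  also have "\<dots> = (\<integral>\<^sup>+z. ?d (?R z) * indicator A (?R z) \<partial>(lborel \<Otimes>\<^sub>M lborel))"
    unfolding d by (intro nn_integral_cong) (auto simp: indicator_def)
  also have "\<dots> = (\<integral>\<^sup>+z. ?d z * indicator A z \<partial>(lborel \<Otimes>\<^sub>M lborel))"
    by (rule nn_integral_rotate[where h = "\<lambda>z. ?d z * indicator A z", OF _ cs]) measurable
  also have "\<dots> = emeasure (gauss \<Otimes>\<^sub>M gauss) A"
    unfolding gauss_pair_density by (subst emeasure_density) (use A' in auto)
  finally show "emeasure (distr (gauss \<Otimes>\<^sub>M gauss) (gauss \<Otimes>\<^sub>M gauss) ?R) A = emeasure (gauss \<Otimes>\<^sub>M gauss) A" .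
qed simp

interpretation gauss_pair: pair_sigma_finite gauss gauss by unfold_locales

lemma integrable_gauss_pair:
  fixes F :: "real \<times> real \<Rightarrow> real"
  assumes "lip F"
  shows "integrable (gauss \<Otimes>\<^sub>M gauss) F"
proof (rule gauss_pair.Fubini_integrable)
  obtain L where L: "L-lipschitz_on UNIV F" using assms by (auto simp: lip_def)
  have "F \<in> borel_measurable borel"
    using lipschitz_on_continuous_on[OF L] by (rule borel_measurable_continuous_onI)
  moreover have "sets (gauss \<Otimes>\<^sub>M gauss) = sets (borel :: (real \<times> real) measure)"
    unfolding borel_prod[symmetric] by (intro sets_pair_measure_cong) auto
  ultimately show "F \<in> borel_measurable (gauss \<Otimes>\<^sub>M gauss)"
    using measurable_cong_sets by blast
  have "L-lipschitz_on UNIV (\<lambda>z. \<bar>F z\<bar>)"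
    using lipschitz_on_abs_diff[OF L] lipschitz_on_nonneg[OF L] 
    by (intro lipschitz_on_realI) (auto intro: order_trans[OF abs_triangle_ineq2])
  from gstep_lipschitz[OF this, of "(0, 1)"] have lg: "lip (gstep (0, 1) (\<lambda>z. \<bar>F z\<bar>))" by (rule lipI)
  have "integrable gauss (\<lambda>x. gstep (0, 1) (\<lambda>z. \<bar>F z\<bar>) (0 + x *\<^sub>R (1, 0)))"
    by (rule lip_integrable_line[OF lg])
  then show "integrable gauss (\<lambda>x. \<integral>y. norm (F (x, y)) \<partial>gauss)" by (simp add: gstep_def)
  have "integrable gauss (\<lambda>y. F ((x, 0) + y *\<^sub>R (0, 1)))" for x
    by (rule lip_integrable_line[OF assms])
  then show "AE x in gauss. integrable gauss (\<lambda>y. F (x, y))" by simp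
qed

lemma gauss_double_integral_rotate:
  fixes F :: "real \<times> real \<Rightarrow> real"
  assumes F: "lip F" and cs: "c\<^sup>2 + s\<^sup>2 = 1"
  shows "(\<integral>x. (\<integral>y. F (x, y) \<partial>gauss) \<partial>gauss) = (\<integral>x. (\<integral>y. F (c * x - s * y, s * x + c * y) \<partial>gauss) \<partial>gauss)"
proof -
  let ?R = "\<lambda>z. (c * fst z - s * snd z, s * fst z + c * snd z)"
  note i = integrable_gauss_pair[OF F]
  have R: "?R \<in> measurable (gauss \<Otimes>\<^sub>M gauss) (gauss \<Otimes>\<^sub>M gauss)" by measurable
  have iR: "integrable (gauss \<Otimes>\<^sub>M gauss) (\<lambda>z. F (?R z))"
    using i gauss_pair_rotate[OF cs] integrable_distr[OF R, of F] by simp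
  have "(\<integral>x. (\<integral>y. F (x, y) \<partial>gauss) \<partial>gauss) = integral\<^sup>L (gauss \<Otimes>\<^sub>M gauss) F"
    by (rule gauss_pair.integral_fst'[OF i])
  also have "\<dots> = integral\<^sup>L (distr (gauss \<Otimes>\<^sub>M gauss) (gauss \<Otimes>\<^sub>M gauss) ?R) F"
    by (simp add: gauss_pair_rotate[OF cs])
  also have "\<dots> = (\<integral>z. F (?R z) \<partial>(gauss \<Otimes>\<^sub>M gauss))"
    by (rule integral_distr[OF R]) (use i in auto)
  also have "\<dots> = (\<integral>x. (\<integral>y. F (?R (x, y)) \<partial>gauss) \<partial>gauss)"
    by (rule gauss_pair.integral_fst'[OF iR, symmetric])
  finally show ?thesis by simp
qed

text \<open>Rotating the pair of independent coefficients of \<open>u\<close> and \<open>w\<close>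
  keeps their joint law and amounts to rotating the pair of vectors.\<close>

lemma gstep_rotate:
  fixes f :: "'a::real_normed_vector \<Rightarrow> real"
  assumes f: "lip f" and cs: "c\<^sup>2 + s\<^sup>2 = 1"
  shows "gstep w (gstep u f) = gstep (c *\<^sub>R w - s *\<^sub>R u) (gstep (c *\<^sub>R u + s *\<^sub>R w) f)"
proof
  fix x
  define F where "F z = f (x + (fst z *\<^sub>R w + snd z *\<^sub>R u))" for z :: "real \<times> real"
  have "lip F" unfolding F_def
    by (intro lip_compose_linear[OF f] bounded_linear_add bounded_linear_scaleR_const
        bounded_linear_fst bounded_linear_snd)
  note * = gauss_double_integral_rotate[OF this, of c "- s"]
  have "gstep w (gstep u f) x = (\<integral>r. (\<integral>t. F (r, t) \<partial>gauss) \<partial>gauss)"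
    by (simp add: gstep_def F_def add.assoc)
  also have "\<dots> = (\<integral>r. (\<integral>t. F (c * r + s * t, - s * r + c * t) \<partial>gauss) \<partial>gauss)"
    using * cs by simp
  also have "\<dots> = gstep (c *\<^sub>R w - s *\<^sub>R u) (gstep (c *\<^sub>R u + s *\<^sub>R w) f) x"
    unfolding gstep_def F_def by (simp add: algebra_simps)
  finally show "gstep w (gstep u f) x = gstep (c *\<^sub>R w - s *\<^sub>R u) (gstep (c *\<^sub>R u + s *\<^sub>R w) f) x" .
qed

lemma gmean_rotate:
  assumes "lip f" "c\<^sup>2 + s\<^sup>2 = 1"
  shows "gmean (u # w # vs) f = gmean ((c *\<^sub>R u + s *\<^sub>R w) # (c *\<^sub>R w - s *\<^sub>R u) # vs) f"
  by (simp add: gstep_rotate[OF assms, symmetric])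

lemma gstep_zero: "gstep 0 f = f"
  by (rule ext) (use gauss.prob_space in \<open>simp add: gstep_def\<close>)

text \<open>A half turn with the zero vector as partner; a quarter turn then gives
  \<open>gstep_commute\<close>.\<close>

lemma gstep_uminus: "lip f \<Longrightarrow> gstep (- v) f = gstep v f"
  using gstep_rotate[of f "-1" 0 0 v] by (simp add: gstep_zero)

lemma gstep_commute: "lip f \<Longrightarrow> gstep w (gstep u f) = gstep u (gstep w f)"
  using gstep_rotate[of f 0 1 w u] gstep_uminus[OF lip_gstep, of f u w] by simp

lemma gmean_move_front: "lip f \<Longrightarrow> gmean (us @ w # ws) f = gmean (w # us @ ws) f"
  by (induction us arbitrary: f) (simp_all add: lip_gstep gstep_commute)

lemma gmean_invariant:
  assumes "\<And>w x t. w \<in> set ws \<Longrightarrow> f (x + t *\<^sub>R w) = f x"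
  shows "gmean ws f = f 0"
  using assms
proof (induction ws arbitrary: f)
  case (Cons w ws)
  have "gstep w f = f"
    by (rule ext) (use gauss.prob_space Cons.prems in \<open>simp add: gstep_def\<close>)
  then show ?case using Cons by simp
qed simp

section \<open>Covariance operators, as maps from functionals to vectors, and the uniqueness of the
  Gaussian law with given covariance\<close>

definition cov :: "'a::real_normed_vector list \<Rightarrow> ('a \<Rightarrow> real) \<Rightarrow> 'a"
  where "cov vs k = (\<Sum>v\<leftarrow>vs. k v *\<^sub>R v)"

lemma cov_simps [simp]: "cov [] k = 0" "cov (v # vs) k = k v *\<^sub>R v + cov vs k"
  by (simp_all add: cov_def)

lemma linear_cov:
  fixes l :: "'a::real_normed_vector \<Rightarrow> real"
  assumes "linear l"
  shows "l (cov vs k) = (\<Sum>v\<leftarrow>vs. k v * l v)"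
  by (induction vs) (simp_all add: linear_0[OF assms] linear_add[OF assms] linear_scale[OF assms])

lemma cov_rotate:
  assumes "linear k" "c\<^sup>2 + s\<^sup>2 = 1"
  shows "cov (u # w # vs) k = cov ((c *\<^sub>R u + s *\<^sub>R w) # (c *\<^sub>R w - s *\<^sub>R u) # vs) k"
proof -
  have "k (c *\<^sub>R u + s *\<^sub>R w) *\<^sub>R (c *\<^sub>R u + s *\<^sub>R w) + k (c *\<^sub>R w - s *\<^sub>R u) *\<^sub>R (c *\<^sub>R w - s *\<^sub>R u)
      = (c\<^sup>2 + s\<^sup>2) *\<^sub>R (k u *\<^sub>R u + k w *\<^sub>R w)"
    by (simp add: linear_add[OF assms(1)] linear_diff[OF assms(1)] linear_scale[OF assms(1)]
        power2_eq_square algebra_simps)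
  then show ?thesis by (simp add: assms(2) add.assoc[symmetric])
qed

lemma rotation_annihilating:
  fixes p q :: real
  obtains c s where "c\<^sup>2 + s\<^sup>2 = 1" "c * q = s * p"
proof (cases "p\<^sup>2 + q\<^sup>2 = 0")
  case True
  then have "p = 0" "q = 0" by (simp_all add: sum_power2_eq_zero_iff)
  then show ?thesis using that[of 1 0] by simp
next
  case False
  define n where "n = sqrt (p\<^sup>2 + q\<^sup>2)"
  have n: "n\<^sup>2 = p\<^sup>2 + q\<^sup>2" "n \<noteq> 0" using False by (simp_all add: n_def)
  have "(p / n)\<^sup>2 + (q / n)\<^sup>2 = (p\<^sup>2 + q\<^sup>2) / n\<^sup>2" by (simp add: power_divide add_divide_distrib)
  also have "\<dots> = 1" using n by (metis False divide_self)
  finally show ?thesis using that[of "p / n" "q / n"] by simp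
qed

text \<open>Plane rotations of neighbouring vectors, from the end of the list to its head, gather
  the whole \<open>l\<close>-component in the first vector; they change neither means nor
  covariance.\<close>

lemma rotate_to_kernel:
  assumes "linear l"
  shows "\<exists>v' vs'. (\<forall>f. lip f \<longrightarrow> gmean (v # vs) f = gmean (v' # vs') f) \<and>
    (\<forall>k. linear k \<longrightarrow> cov (v # vs) k = cov (v' # vs') k) \<and> (\<forall>w\<in>set vs'. l w = (0::real)) \<and>
    length vs' = length vs"
proof (induction vs arbitrary: v)
  case Nil
  then show ?case by (intro exI[of _ v] exI[of _ "[]"]) simp
next
  case (Cons u us)
  obtain u' us' where IH: "\<forall>f. lip f \<longrightarrow> gmean (u # us) f = gmean (u' # us') f"
    "\<forall>k. linear k \<longrightarrow> cov (u # us) k = cov (u' # us') k" "\<forall>w\<in>set us'. l w = 0"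
    "length us' = length us"
    using Cons.IH[of u] by (elim exE conjE) (rule that)
  note u' = IH[rule_format]
  obtain c s where cs: "c\<^sup>2 + s\<^sup>2 = 1" "c * l u' = s * l v" by (rule rotation_annihilating)
  let ?v = "c *\<^sub>R v + s *\<^sub>R u'" and ?u = "c *\<^sub>R u' - s *\<^sub>R v"
  have "gmean (v # u # us) f = gmean (?v # ?u # us') f" if "lip f" for f
  proof -
    have "gmean (v # u # us) f = gmean (v # u' # us') f"
      using u'(1)[OF lip_gstep[OF that, of v]] by simp
    then show ?thesis by (rule trans[OF _ gmean_rotate[OF that cs(1)]])
  qed
  then have "\<forall>f. lip f \<longrightarrow> gmean (v # u # us) f = gmean (?v # ?u # us') f" by iprover
  moreover have "cov (v # u # us) k = cov (?v # ?u # us') k" if "linear k" for k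
  proof -
    have "cov (v # u # us) k = cov (v # u' # us') k"
      using u'(2)[OF that] by simp
    then show ?thesis by (rule trans[OF _ cov_rotate[OF that cs(1)]])
  qed
  then have "\<forall>k. linear k \<longrightarrow> cov (v # u # us) k = cov (?v # ?u # us') k" by iprover
  moreover have "l ?u = 0" using cs(2) by (simp add: linear_diff[OF assms] linear_scale[OF assms])
  then have "\<forall>w\<in>set (?u # us'). l w = 0" using IH(3) by simp
  moreover have "length (?u # us') = length (u # us)" using IH(4) by simp
  ultimately show ?case by (intro exI conjI)
qed

text \<open>Once all vectors but the first lie in the kernel of \<open>l\<close>, the value of
  \<open>l\<close> is a single Gaussian variable times \<open>l v'\<close>. Evaluating the
  covariance identity at \<open>l\<close> identifies the square of \<open>l v'\<close> with the sum
  of squares.\<close>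

lemma gmean_abs_functional:
  assumes "bounded_linear l"
  shows "gmean vs (\<lambda>x. \<bar>l x\<bar>) = gabs * sqrt (\<Sum>v\<leftarrow>vs. (l v)\<^sup>2)"
proof (cases vs)
  case Nil
  then show ?thesis using linear_0[OF bounded_linear.linear[OF assms]] by simp
next
  case (Cons v ws)
  note lin = bounded_linear.linear[OF assms]
  obtain v' ws' where "\<forall>f. lip f \<longrightarrow> gmean (v # ws) f = gmean (v' # ws') f"
    "\<forall>k. linear k \<longrightarrow> cov (v # ws) k = cov (v' # ws') k" "\<forall>w\<in>set ws'. l w = 0"
    using rotate_to_kernel[OF lin, where v = v and vs = ws]
    by (elim exE conjE) (rule that)
  note * = this[rule_format]
  have "(\<Sum>v\<leftarrow>vs. (l v)\<^sup>2) = (\<Sum>v\<leftarrow>v' # ws'. (l v)\<^sup>2)"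
    using arg_cong[OF *(2)[OF lin], of l] unfolding linear_cov[OF lin] Cons by (simp add: power2_eq_square)
  also have "\<dots> = (l v')\<^sup>2 + (\<Sum>v\<leftarrow>ws'. 0)" using *(3) by (simp cong: map_cong)
  finally have s: "sqrt (\<Sum>v\<leftarrow>vs. (l v)\<^sup>2) = \<bar>l v'\<bar>" by simp
  have "lip (\<lambda>x. l (0 + x))"
  proof -
    have "lip (\<lambda>x::real. x)" by (intro lipI[of 1] lipschitz_on_realI) (auto simp: dist_real_def)
    from lip_compose_linear[OF this assms, of 0] show ?thesis using lin by (simp add: linear_0)
  qed
  then have "gmean vs (\<lambda>x. \<bar>l x\<bar>) = gmean (v' # ws') (\<lambda>x. \<bar>l x\<bar>)"
    unfolding Cons by (intro *(1) lip_abs) simp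
  also have "\<dots> = gstep v' (\<lambda>x. \<bar>l x\<bar>) 0"
    unfolding gmean.simps
    by (rule gmean_invariant) (simp add: gstep_def linear_add[OF lin] linear_scale[OF lin] *(3))
  also have "\<dots> = gabs * \<bar>l v'\<bar>"
    by (simp add: gstep_def gabs_def linear_scale[OF lin] abs_mult)
  finally show ?thesis by (simp add: s)
qed

abbreviation rin :: "'a::complex_hilbert \<Rightarrow> 'a \<Rightarrow> real"
  where "rin x y \<equiv> Re (cinner x y)"

lemma bounded_linear_rin_left: "bounded_linear (\<lambda>x. rin x e)"
  by (rule bounded_linear_compose[OF bounded_linear_Re cinner.bounded_linear_left])

lemmas linear_rin = bounded_linear.linear[OF bounded_linear_rin_left]

lemma sum_list_squares_zero:
  "(\<Sum>v\<leftarrow>vs. (g v)\<^sup>2) = (0::real) \<Longrightarrow> v \<in> set vs \<Longrightarrow> g v = 0"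
  by (subst (asm) sum_list_nonneg_eq_0_iff) auto

text \<open>No characteristic functions are involved. For a nonzero head \<open>v\<close>, both
  lists are rotated until only their first vectors \<open>a\<close> and \<open>b\<close> fail to be
  orthogonal to \<open>v\<close>. The covariance at \<open>v\<close> is then a multiple of
  \<open>a\<close> and also of \<open>b\<close>, which forces them to agree up to sign. Both are
  removed, and the remaining lists still have equal covariance.\<close>

lemma gmean_cov_unique:
  fixes vs ws :: "'a::complex_hilbert list"
  assumes "\<And>e. cov vs (\<lambda>v. rin v e) = cov ws (\<lambda>v. rin v e)" "lip f"
  shows "gmean vs f = gmean ws f"
  using assms
proof (induction "length vs" arbitrary: vs ws f rule: less_induct)
  case less
  show ?case
  proof (cases vs)
    case Nil
    have "w = 0" if w: "w \<in> set ws" for w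
    proof (rule cinner_eq_zero_all)
      fix e
      have "(\<Sum>v\<leftarrow>ws. (rin v e)\<^sup>2) = rin (cov ws (\<lambda>v. rin v e)) e"
        by (simp add: linear_cov[OF linear_rin] power2_eq_square)
      also have "\<dots> = 0" using less(2)[of e] Nil by (simp add: cinner_simps)
      finally show "rin w e = 0" using sum_list_squares_zero[of "\<lambda>v. rin v e" ws w] w by blast
    qed
    then have "gmean ws f = f 0" by (intro gmean_invariant) (metis add.right_neutral scaleR_zero_right)
    then show ?thesis using Nil by simp
  next
    case (Cons v vs')
    show ?thesis
    proof (cases "v = 0")
      case True
      then have "gmean vs' f = gmean ws f"
        using less(2) Cons by (intro less(1)) (auto simp: less(3))
      then show ?thesis using True Cons by (simp add: gstep_zero)
    next
      case False
      let ?k = "\<lambda>x. rin x v"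
      note lin = linear_rin[of v]
      have q: "rin (cov vs ?k) v > 0"
      proof -
        have "0 \<le> (\<Sum>u\<leftarrow>vs'. rin u v * rin u v)" by (intro sum_list_nonneg) auto
        moreover have "0 < rin v v * rin v v" using False by (simp add: Re_cinner_self)
        ultimately show ?thesis using Cons by (simp add: linear_cov[OF lin] cinner_simps)
      qed
      have "ws \<noteq> []" using q less(2)[of v] by (auto simp: cinner_simps)
      then obtain w ws' where ws: "ws = w # ws'" by (cases ws) auto
      obtain a as where "\<forall>f. lip f \<longrightarrow> gmean vs f = gmean (a # as) f"
        "\<forall>k. linear k \<longrightarrow> cov vs k = cov (a # as) k" "\<forall>w\<in>set as. rin w v = 0"
        "length as = length vs'"
        using rotate_to_kernel[OF lin, where v = v and vs = vs', folded Cons]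
        by (elim exE conjE) (rule that)
      note a = this[rule_format]
      obtain b bs where "\<forall>f. lip f \<longrightarrow> gmean ws f = gmean (b # bs) f"
        "\<forall>k. linear k \<longrightarrow> cov ws k = cov (b # bs) k" "\<forall>w\<in>set bs. rin w v = 0"
        using rotate_to_kernel[OF lin, where v = w and vs = ws', folded ws]
        by (elim exE conjE) (rule that)
      note b = this[rule_format]
      have zero: "cov zs ?k = 0" if "\<And>w. w \<in> set zs \<Longrightarrow> rin w v = 0" for zs
        using that by (induction zs) auto
      have ca: "cov vs ?k = ?k a *\<^sub>R a" using a(2)[OF lin] zero[of as] a(3) by simp
      have cb: "cov ws ?k = ?k b *\<^sub>R b" using b(2)[OF lin] zero[of bs] b(3) by simp
      have ab: "?k a *\<^sub>R a = ?k b *\<^sub>R b" using ca cb less(2)[of v] by simp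
      have ka: "?k a \<noteq> 0" using q ca by (auto simp: cinner_simps)
      have "rin (?k a *\<^sub>R a) v = rin (?k b *\<^sub>R b) v" by (simp only: ab)
      then have "(?k a)\<^sup>2 = (?k b)\<^sup>2" by (simp add: cinner_simps power2_eq_square)
      then have "?k b = ?k a \<or> ?k b = - ?k a" using power2_eq_iff[of "?k b" "?k a"] by metis
      then have ba: "a = b \<or> a = - b"
      proof
        assume "?k b = ?k a"
        with ab have "?k a *\<^sub>R (a - b) = 0" by (simp add: scaleR_diff_right)
        then show ?thesis using ka by simp
      next
        assume "?k b = - ?k a"
        with ab have "?k a *\<^sub>R (a + b) = 0" by (simp add: scaleR_add_right)
        then show ?thesis using ka by (simp add: eq_neg_iff_add_eq_0)
      qed
      have "gmean as (gstep a f) = gmean bs (gstep a f)"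
      proof (rule less(1))
        show "length as < length vs" using a(4) Cons by simp
        fix e
        have "cov (a # as) (\<lambda>v. rin v e) = cov (b # bs) (\<lambda>v. rin v e)"
          using less(2)[of e] a(2)[OF linear_rin[of e]] b(2)[OF linear_rin[of e]] by simp
        moreover have "rin a e *\<^sub>R a = rin b e *\<^sub>R b" using ba by (auto simp: cinner_simps)
        ultimately show "cov as (\<lambda>v. rin v e) = cov bs (\<lambda>v. rin v e)" by simp
      qed (rule lip_gstep, fact)
      moreover have "gstep a f = gstep b f" using ba gstep_uminus[OF less(3)] by auto
      ultimately show ?thesis using a(1)[OF less(3)] b(1)[OF less(3)] by simp
    qed
  qed
qed

lemma gmean_quadratic_form_unique:
  fixes vs ws :: "'a::complex_hilbert list"
  assumes q: "\<And>e. (\<Sum>v\<leftarrow>vs. (rin v e)\<^sup>2) = (\<Sum>w\<leftarrow>ws. (rin w e)\<^sup>2)" and f: "lip f"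
  shows "gmean vs f = gmean ws f"
proof (rule gmean_cov_unique[OF _ f])
  fix e
  have pol: "4 * (\<Sum>v\<leftarrow>zs. rin v e * rin v d) = (\<Sum>v\<leftarrow>zs. (rin v (e + d))\<^sup>2) - (\<Sum>v\<leftarrow>zs. (rin v (e - d))\<^sup>2)"
    for zs and d :: 'a
    by (induction zs) (simp_all add: cinner_simps power2_eq_square algebra_simps)
  have "cov vs (\<lambda>v. rin v e) - cov ws (\<lambda>v. rin v e) = 0"
  proof (rule cinner_eq_zero_all)
    fix d
    show "rin (cov vs (\<lambda>v. rin v e) - cov ws (\<lambda>v. rin v e)) d = 0"
      using pol[where zs = vs and d = d] pol[where zs = ws and d = d] q[of "e + d"] q[of "e - d"]
      by (simp add: cinner_simps linear_cov[OF linear_rin])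
  qed
  then show "cov vs (\<lambda>v. rin v e) = cov ws (\<lambda>v. rin v e)" by simp
qed

section \<open>The mean of the norm compared with the trace of the covariance\<close>

lemma gmean_norm_le:
  fixes vs :: "'a::complex_hilbert list"
  shows "gmean vs norm \<le> sqrt (\<Sum>v\<leftarrow>vs. (norm v)\<^sup>2)"
proof -
  \<comment> \<open>The auxiliary coordinate \<open>t\<close> stores the variance already
    integrated: a step along \<open>v\<close> maps \<open>g t\<close> below a function of the same
    kind with \<open>t\<^sup>2\<close> increased by \<open>(norm v)\<^sup>2\<close>, so the bound
    passes through the induction.\<close>
  define g where "g t x = norm (x, t)" for t :: real and x :: 'a
  have g: "g t x = sqrt ((norm x)\<^sup>2 + t\<^sup>2)" for t x by (simp add: g_def norm_Pair)
  have lg: "lip (g t)" for t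
    unfolding g_def
    using lip_compose_linear[OF lip_norm, of "\<lambda>x. (x, 0)" "(0, t)"] by (simp add: bounded_linear_Pair)
  have step: "gstep v (g t) x \<le> g (sqrt (t\<^sup>2 + (norm v)\<^sup>2)) x" for v t x
  proof -
    define s where "s = sqrt ((norm x)\<^sup>2 + (norm v)\<^sup>2 + t\<^sup>2)"
    have s2: "s\<^sup>2 = (norm x)\<^sup>2 + (norm v)\<^sup>2 + t\<^sup>2" by (simp add: s_def)
    have s0: "0 \<le> s" by (simp add: s_def)
    have gs: "g (sqrt (t\<^sup>2 + (norm v)\<^sup>2)) x = s" by (simp add: g s_def add_ac)
    show ?thesis
    proof (cases "s = 0")
      case True
      then have "(norm x)\<^sup>2 + (norm v)\<^sup>2 + t\<^sup>2 = 0" using s2 by simp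
      then have "(norm x)\<^sup>2 = 0" "(norm v)\<^sup>2 = 0" "t\<^sup>2 = 0"
        using zero_le_power2[of "norm x"] zero_le_power2[of "norm v"] zero_le_power2[of t] by linarith+
      then have "x = 0" "v = 0" "t = 0" by simp_all
      then show ?thesis by (simp add: g gstep_zero)
    next
      case False
      then have s: "0 < s" using s0 by simp
      \<comment> \<open>The square root lies below its tangent at \<open>s\<^sup>2\<close>. This
        leaves a quadratic polynomial in \<open>\<tau>\<close> with these coefficients, for which
        the first two Gaussian moments suffice.\<close>
      define A where "A = ((norm x)\<^sup>2 + t\<^sup>2 + s\<^sup>2) / (2 * s)"
      define B where "B = rin x v / s"
      define C where "C = (norm v)\<^sup>2 / (2 * s)"
      have le: "g t (x + \<tau> *\<^sub>R v) \<le> A + B * \<tau> + C * \<tau>\<^sup>2" for \<tau>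
      proof -
        let ?y = "g t (x + \<tau> *\<^sub>R v)"
        have y2: "?y\<^sup>2 = (norm x)\<^sup>2 + 2 * \<tau> * rin x v + \<tau>\<^sup>2 * (norm v)\<^sup>2 + t\<^sup>2"
          unfolding g real_sqrt_pow2[OF add_nonneg_nonneg[OF zero_le_power2 zero_le_power2]]
          by (simp add: norm_add_sq cinner_simps power_mult_distrib)
        have "2 * s * ?y \<le> ?y\<^sup>2 + s\<^sup>2" using sum_squares_bound[of s ?y] by simp
        then have "?y \<le> (?y\<^sup>2 + s\<^sup>2) / (2 * s)" using s by (simp add: field_simps)
        also have "\<dots> = A + B * \<tau> + C * \<tau>\<^sup>2"
          unfolding y2 A_def B_def C_def using s by (simp add: field_simps)
        finally show ?thesis .
      qed
      have int: "integrable gauss (\<lambda>\<tau>::real. \<tau>)" "integrable gauss (\<lambda>\<tau>::real. \<tau>\<^sup>2)"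
        using gauss_moment[of 2] by (auto intro!: lip_integrable lipI[of 1] lipschitz_on_realI simp: dist_real_def)
      have "gstep v (g t) x \<le> (\<integral>\<tau>. A + B * \<tau> + C * \<tau>\<^sup>2 \<partial>gauss)"
        unfolding gstep_def
        by (rule integral_mono) (auto simp: le int intro!: lip_integrable_line[OF lg])
      also have "\<dots> = A + C"
        using int gauss_first_moment gauss_second_moment gauss.prob_space by simp
      also have "\<dots> = (s\<^sup>2 + s\<^sup>2) / (2 * s)" unfolding A_def C_def s2 by (simp add: add_divide_distrib[symmetric])
      also have "\<dots> = s" using s by (simp add: power2_eq_square)
      finally show ?thesis by (simp add: gs)
    qed
  qed
  have "gmean vs (g t) \<le> sqrt (t\<^sup>2 + (\<Sum>v\<leftarrow>vs. (norm v)\<^sup>2))" for t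
  proof (induction vs arbitrary: t)
    case (Cons v vs)
    have "gmean (v # vs) (g t) \<le> gmean vs (g (sqrt (t\<^sup>2 + (norm v)\<^sup>2)))"
      unfolding gmean.simps by (intro gmean_mono lip_gstep lg step)
    also have "\<dots> \<le> sqrt ((sqrt (t\<^sup>2 + (norm v)\<^sup>2))\<^sup>2 + (\<Sum>v\<leftarrow>vs. (norm v)\<^sup>2))" by (rule Cons)
    finally show ?case by (simp add: add.assoc)
  qed (simp add: g)
  moreover have "g 0 = norm" by (rule ext) (simp add: g)
  ultimately show ?thesis by (metis add_0 power_zero_numeral)
qed

lemma lip_rin: "lip (\<lambda>x. rin x e)"
proof -
  have "lip (\<lambda>x::real. x)" by (intro lipI[of 1] lipschitz_on_realI) (auto simp: dist_real_def)
  from lip_compose_linear[OF this bounded_linear_rin_left, of 0] show ?thesis by simp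
qed

text \<open>Each \<open>\<bar>rin x e\<bar>\<close> has mean \<open>gabs * \<sigma> e\<close>.
  Weighting it by \<open>\<sigma> e\<close> itself and using Cauchy--Schwarz and Bessel under the
  mean gives \<open>gabs * S\<^sup>2 \<le> S * gmean vs norm\<close>.\<close>

lemma gmean_norm_ge:
  fixes vs :: "'a::complex_hilbert list"
  assumes E: "orthonormal E"
  shows "gabs * sqrt (\<Sum>e\<in>E. \<Sum>v\<leftarrow>vs. (rin v e)\<^sup>2) \<le> gmean vs norm"
proof -
  define \<sigma> where "\<sigma> e = sqrt (\<Sum>v\<leftarrow>vs. (rin v e)\<^sup>2)" for e
  have q0: "0 \<le> (\<Sum>v\<leftarrow>vs. (rin v e)\<^sup>2)" for e by (intro sum_list_nonneg) auto
  then have \<sigma>2: "(\<sigma> e)\<^sup>2 = (\<Sum>v\<leftarrow>vs. (rin v e)\<^sup>2)" for e by (simp add: \<sigma>_def)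
  define S where "S = sqrt (\<Sum>e\<in>E. (\<sigma> e)\<^sup>2)"
  have S2: "S\<^sup>2 = (\<Sum>e\<in>E. (\<sigma> e)\<^sup>2)" by (simp add: S_def sum_nonneg)
  have S0: "0 \<le> S" by (simp add: S_def sum_nonneg)
  have "gabs * S\<^sup>2 = (\<Sum>e\<in>E. \<sigma> e * gmean vs (\<lambda>x. \<bar>rin x e\<bar>))"
    unfolding S2 sum_distrib_left
    by (intro sum.cong refl)
      (simp add: gmean_abs_functional[OF bounded_linear_rin_left] flip: \<sigma>_def, simp add: power2_eq_square)
  also have "\<dots> = gmean vs (\<lambda>x. \<Sum>e\<in>E. \<sigma> e * \<bar>rin x e\<bar>)"
    by (simp add: gmean_sum gmean_cmult lip_cmult lip_abs lip_rin)
  also have "\<dots> \<le> gmean vs (\<lambda>x. S * norm x)"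
  proof (intro gmean_mono lip_sum lip_cmult lip_abs lip_rin lip_norm)
    fix x
    have "(\<Sum>e\<in>E. \<sigma> e * \<bar>rin x e\<bar>) \<le> (\<Sum>e\<in>E. \<bar>\<sigma> e\<bar> * \<bar>\<bar>rin x e\<bar>\<bar>)"
      by (intro sum_mono) (simp add: mult_right_mono)
    also have "\<dots> \<le> L2_set \<sigma> E * L2_set (\<lambda>e. \<bar>rin x e\<bar>) E" by (rule L2_set_mult_ineq)
    also have "L2_set \<sigma> E = S" by (simp add: L2_set_def S_def)
    also have "L2_set (\<lambda>e. \<bar>rin x e\<bar>) E \<le> norm x"
    proof -
      have "(\<Sum>e\<in>E. (rin x e)\<^sup>2) \<le> (\<Sum>e\<in>E. (cmod (cinner x e))\<^sup>2)"
        by (intro sum_mono) (simp add: cmod_power2)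
      also have "\<dots> \<le> (norm x)\<^sup>2" by (rule bessel[OF E])
      finally show ?thesis unfolding L2_set_def by (intro real_le_lsqrt) auto
    qed
    finally show "(\<Sum>e\<in>E. \<sigma> e * \<bar>rin x e\<bar>) \<le> S * norm x" using S0 by (simp add: mult_left_mono)
  qed
  also have "\<dots> = S * gmean vs norm" by (simp add: gmean_cmult lip_norm)
  finally have *: "S * (gabs * S) \<le> S * gmean vs norm" by (simp add: power2_eq_square mult_ac)
  have "gabs * S \<le> gmean vs norm"
  proof (cases "S = 0")
    case True
    then show ?thesis using gmean_nonneg[OF lip_norm, of vs] by simp
  next
    case False
    then show ?thesis using * S0 by simp
  qed
  then show ?thesis by (simp add: S_def \<sigma>2)
qed

section \<open>Concentration of Gaussian measures\<close>

text \<open>A pair of independent copies on the product space. The vectors \<open>(0, v)\<close>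
  come first so that the second copy becomes the inner mean.\<close>

definition dup :: "'a::real_normed_vector list \<Rightarrow> ('a \<times> 'a) list"
  where "dup vs = map (\<lambda>v. (0, v)) vs @ map (\<lambda>v. (v, 0)) vs"

lemma gmean_dup: "gmean (dup vs) h = gmean vs (\<lambda>x. gmean vs (\<lambda>y. h (x, y)))"
proof -
  have l: "linear (\<lambda>v::'a. (0::'a, v))" "linear (\<lambda>v::'a. (v, 0::'a))"
    by (auto intro!: bounded_linear.linear bounded_linear_Pair bounded_linear_zero bounded_linear_ident)
  have "gmean (dup vs) h = gmean (map (\<lambda>v. (v, 0)) vs) (\<lambda>x. gmean vs (\<lambda>y. h (x + (0, y))))"
    unfolding dup_def gmean_append by (simp only: gmean_linear_map[OF l(1), symmetric])
  also have "\<dots> = gmean vs (\<lambda>x. gmean vs (\<lambda>y. h ((x, 0) + (0, y))))"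
    by (rule gmean_linear_map[OF l(2), symmetric])
  finally show ?thesis by simp
qed

lemma lip_gmean_pair:
  fixes h :: "'a::real_normed_vector \<times> 'b::real_normed_vector \<Rightarrow> real"
  assumes "lip h" shows "lip (\<lambda>x. gmean vs (\<lambda>y. h (x, y)))"
proof -
  obtain L where L: "L-lipschitz_on UNIV h" using assms by (auto simp: lip_def)
  have l: "linear (\<lambda>v::'b. (0::'a, v))"
    by (auto intro!: bounded_linear.linear bounded_linear_Pair bounded_linear_zero bounded_linear_ident)
  have eq: "gmean vs (\<lambda>y. h (x, y)) = gmean (map (\<lambda>v. (0, v)) vs) (\<lambda>z. h ((x, 0) + z))" for x
    by (subst gmean_linear_map[OF l, symmetric]) simp
  have "lip (\<lambda>z. gmean (map (\<lambda>v. (0, v)) vs) (\<lambda>y. h (z + y)))"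
    using gmean_lipschitz[OF L] by (rule lipI)
  from lip_compose_linear[OF this bounded_linear_Pair[OF bounded_linear_ident bounded_linear_zero], of 0]
  show ?thesis by (simp add: eq)
qed

lemma gmean_dup_rotate:
  assumes h: "lip h" and cs: "c\<^sup>2 + s\<^sup>2 = 1"
  shows "gmean (dup vs) (\<lambda>z. h (c *\<^sub>R fst z - s *\<^sub>R snd z, s *\<^sub>R fst z + c *\<^sub>R snd z)) = gmean (dup vs) h"
proof -
  define R where "R z = (c *\<^sub>R fst z - s *\<^sub>R snd z, s *\<^sub>R fst z + c *\<^sub>R snd z)" for z :: "'a \<times> 'a"
  have bR: "bounded_linear R" unfolding R_def
    by (intro bounded_linear_Pair bounded_linear_add bounded_linear_sub bounded_linear_scaleR_right[THEN bounded_linear_compose]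
        bounded_linear_fst bounded_linear_snd)
  \<comment> \<open>Interleaving makes \<open>(0, v)\<close> and \<open>(v, 0)\<close> neighbours;
    the rotation acts within each such pair, so \<open>gmean_rotate\<close> applies pair by
    pair.\<close>
  define I where "I us = concat (map (\<lambda>v. [(0, v), (v, 0)]) us)" for us :: "'a list"
  have I_simps: "I [] = []" "I (v # us) = (0, v) # (v, 0) # I us" for v us by (simp_all add: I_def)
  have dup_I: "gmean (dup us) f = gmean (I us) f" if "lip f" for us and f :: "'a \<times> 'a \<Rightarrow> real"
    using that
  proof (induction us arbitrary: f)
    case (Cons v us)
    have "gmean (dup (v # us)) f
        = gmean (map (\<lambda>v. (0, v)) us @ (v, 0) # map (\<lambda>v. (v, 0)) us) (gstep (0, v) f)"
      by (simp add: dup_def)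
    also have "\<dots> = gmean (dup us) (gstep (v, 0) (gstep (0, v) f))"
      by (subst gmean_move_front[OF lip_gstep[OF Cons.prems]]) (simp add: dup_def)
    also have "\<dots> = gmean (I (v # us)) f"
      unfolding I_simps by (simp add: Cons.IH lip_gstep Cons.prems)
    finally show ?case .
  qed (simp add: dup_def I_simps)
  have I_R: "gmean (map R (I us)) f = gmean (I us) f" if "lip f" for us and f :: "'a \<times> 'a \<Rightarrow> real"
    using that
  proof (induction us arbitrary: f)
    case (Cons v us)
    have cs': "c\<^sup>2 + (- s)\<^sup>2 = 1" using cs by simp
    have R: "R (0, v) = c *\<^sub>R (0, v) + (- s) *\<^sub>R (v, 0)" "R (v, 0) = c *\<^sub>R (v, 0) - (- s) *\<^sub>R (0, v)"
      by (simp_all add: R_def)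
    have "gmean (map R (I (v # us))) f = gmean (R (0, v) # R (v, 0) # map R (I us)) f"
      by (simp add: I_simps)
    also have "\<dots> = gmean ((0, v) # (v, 0) # map R (I us)) f"
      unfolding R by (rule gmean_rotate[OF Cons.prems cs', symmetric])
    also have "\<dots> = gmean (I (v # us)) f" unfolding I_simps
      by (simp add: Cons.IH lip_gstep Cons.prems)
    finally show ?case .
  qed (simp add: I_simps)
  have hR: "lip (\<lambda>z. h (R z))" using lip_compose_linear[OF h bR, of 0] by simp
  have "gmean (dup vs) (\<lambda>z. h (R z)) = gmean (I vs) (\<lambda>z. h (R z))" by (rule dup_I[OF hR])
  also have "\<dots> = gmean (map R (I vs)) h" by (rule gmean_linear_map[OF bounded_linear.linear[OF bR]])
  also have "\<dots> = gmean (dup vs) h" by (simp add: I_R[OF h] dup_I[OF h])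
  finally show ?thesis by (simp add: R_def)
qed

text \<open>A convex function that is Lipschitz with constant \<open>1\<close> has approximate subgradients of norm
  at most \<open>1\<close>; the converse is \<open>subgradable_lipschitz\<close>. Convexity replaces differentiability in
  the concentration argument.\<close>

definition subgradable :: "('a::complex_hilbert \<Rightarrow> real) \<Rightarrow> bool"
  where "subgradable f \<longleftrightarrow> (\<forall>x. \<forall>\<eta>>0. \<exists>a. norm a \<le> 1 \<and> (\<forall>y. f x - f y \<le> rin (x - y) a + \<eta>))"

lemma subgradable_lipschitz:
  assumes "subgradable f" shows "1-lipschitz_on UNIV f"
proof (rule lipschitz_on_realI)
  fix x y
  show "f x - f y \<le> 1 * dist x y"
  proof (rule field_le_epsilon)
    fix \<eta> :: real assume "0 < \<eta>"
    then obtain a where a: "norm a \<le> 1" "\<forall>y. f x - f y \<le> rin (x - y) a + \<eta>"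
      using assms unfolding subgradable_def by blast
    have "rin (x - y) a \<le> norm (x - y) * norm a" by (rule Re_cinner_le)
    also have "\<dots> \<le> norm (x - y) * 1" using a(1) by (intro mult_left_mono) auto
    finally show "f x - f y \<le> 1 * dist x y + \<eta>" using a(2)[rule_format, of y] by (simp add: dist_norm)
  qed
qed simp

lemma lip_subgradable: "subgradable f \<Longrightarrow> lip f"
  by (rule lipI[OF subgradable_lipschitz])

lemma lip_compose_linear0:
  assumes "lip f" "bounded_linear h" shows "lip (\<lambda>x. f (h x))"
  using lip_compose_linear[OF assms, of 0] by simp

lemma bounded_linear_comb:
  "bounded_linear (\<lambda>z::'a::real_normed_vector \<times> 'a. a *\<^sub>R fst z + b *\<^sub>R snd z)"
  by (intro bounded_linear_add bounded_linear_scaleR_right[THEN bounded_linear_compose]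
      bounded_linear_fst bounded_linear_snd)

text \<open>Up to the radial term \<open>\<bar>1 - c\<bar> * norm x\<close>, an approximate
  subgradient at \<open>x\<close> bounds the decrease of \<open>f\<close> by a linear function of
  the independent copy, whose absolute mean is at most \<open>gabs * sqrt r\<close>. Only the
  positive part is controlled, as the subgradient is taken at \<open>x\<close> alone.\<close>

lemma gmean_subgradable_increment:
  assumes f: "subgradable f" and r: "\<And>a. norm a \<le> 1 \<Longrightarrow> (\<Sum>v\<leftarrow>vs. (rin v a)\<^sup>2) \<le> r"
  shows "gmean (dup vs) (\<lambda>z. max 0 (f (fst z) - f (c *\<^sub>R fst z + s *\<^sub>R snd z)))
    \<le> \<bar>1 - c\<bar> * gmean vs norm + \<bar>s\<bar> * (gabs * sqrt r)"
proof -
  note lf = lip_subgradable[OF f]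
  define h where "h z = max 0 (f (fst z) - f (c *\<^sub>R fst z + s *\<^sub>R snd z))" for z :: "'a \<times> 'a"
  have lh: "lip h" unfolding h_def
    by (intro lip_max lip_const lip_diff lip_compose_linear0[OF lf] bounded_linear_fst bounded_linear_comb)
  have lh': "lip (\<lambda>y. h (x, y))" for x
    using lip_compose_linear[OF lh bounded_linear_Pair[OF bounded_linear_zero bounded_linear_ident], of "(x, 0)"]
    by simp
  have inner: "gmean vs (\<lambda>y. h (x, y)) \<le> \<bar>1 - c\<bar> * norm x + \<bar>s\<bar> * (gabs * sqrt r)" for x
  proof (rule field_le_epsilon)
    fix \<eta> :: real assume \<eta>: "0 < \<eta>"
    then obtain a where a: "norm a \<le> 1" "\<And>y. f x - f y \<le> rin (x - y) a + \<eta>"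
      using f unfolding subgradable_def by blast
    have le: "h (x, y) \<le> (\<bar>1 - c\<bar> * norm x + \<eta>) + \<bar>s\<bar> * \<bar>rin y a\<bar>" for y
    proof -
      have "f x - f (c *\<^sub>R x + s *\<^sub>R y) \<le> rin (x - (c *\<^sub>R x + s *\<^sub>R y)) a + \<eta>" by (rule a(2))
      also have "rin (x - (c *\<^sub>R x + s *\<^sub>R y)) a = (1 - c) * rin x a - s * rin y a"
        by (simp add: cinner_simps algebra_simps)
      also have "\<dots> \<le> \<bar>(1 - c) * rin x a\<bar> + \<bar>s * rin y a\<bar>" by linarith
      also have "\<bar>(1 - c) * rin x a\<bar> \<le> \<bar>1 - c\<bar> * norm x"
      proof -
        have "\<bar>rin x a\<bar> \<le> norm x * norm a"
          using Re_cinner_le[of x a] Re_cinner_le[of "- x" a] by (simp add: cinner_simps)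
        also have "\<dots> \<le> norm x * 1" using a(1) by (intro mult_left_mono) auto
        finally show ?thesis by (simp add: abs_mult mult_left_mono)
      qed
      finally have "f x - f (c *\<^sub>R x + s *\<^sub>R y) \<le> (\<bar>1 - c\<bar> * norm x + \<eta>) + \<bar>s\<bar> * \<bar>rin y a\<bar>"
        by (simp add: abs_mult)
      moreover have "0 \<le> (\<bar>1 - c\<bar> * norm x + \<eta>) + \<bar>s\<bar> * \<bar>rin y a\<bar>" using \<eta> by simp
      ultimately show ?thesis by (simp add: h_def)
    qed
    have "gmean vs (\<lambda>y. h (x, y)) \<le> gmean vs (\<lambda>y. (\<bar>1 - c\<bar> * norm x + \<eta>) + \<bar>s\<bar> * \<bar>rin y a\<bar>)"
      by (intro gmean_mono lh' le lip_add lip_const lip_cmult lip_abs lip_rin)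
    also have "\<dots> = (\<bar>1 - c\<bar> * norm x + \<eta>) + \<bar>s\<bar> * (gabs * sqrt (\<Sum>v\<leftarrow>vs. (rin v a)\<^sup>2))"
      by (simp only: gmean_add[OF lip_const lip_cmult[OF lip_abs[OF lip_rin]]] gmean_const
          gmean_cmult[OF lip_abs[OF lip_rin]] gmean_abs_functional[OF bounded_linear_rin_left])
    also have "\<dots> \<le> (\<bar>1 - c\<bar> * norm x + \<eta>) + \<bar>s\<bar> * (gabs * sqrt r)"
      using r[OF a(1)] gabs_pos by (intro add_left_mono mult_left_mono real_sqrt_le_mono) auto
    finally show "gmean vs (\<lambda>y. h (x, y)) \<le> \<bar>1 - c\<bar> * norm x + \<bar>s\<bar> * (gabs * sqrt r) + \<eta>" by simp
  qed
  have "gmean (dup vs) h \<le> gmean vs (\<lambda>x. \<bar>1 - c\<bar> * norm x + \<bar>s\<bar> * (gabs * sqrt r))"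
    unfolding gmean_dup
    by (intro gmean_mono inner lip_gmean_pair lh lip_add lip_cmult lip_norm lip_const)
  also have "\<dots> = \<bar>1 - c\<bar> * gmean vs norm + \<bar>s\<bar> * (gabs * sqrt r)"
    by (simp add: gmean_add gmean_const gmean_cmult lip_norm lip_cmult)
  finally show ?thesis unfolding h_def .
qed

text \<open>The absolute value is the sum of two one-sided parts. A rotation of the pair exchanges
  the two points and replaces \<open>s\<close> by \<open>- s\<close>, so both parts obey the
  one-sided bound.\<close>

lemma gmean_subgradable_rotation_step:
  assumes f: "subgradable f" and r: "\<And>a. norm a \<le> 1 \<Longrightarrow> (\<Sum>v\<leftarrow>vs. (rin v a)\<^sup>2) \<le> r"
    and cs: "c\<^sup>2 + s\<^sup>2 = 1"
  shows "gmean (dup vs) (\<lambda>z. \<bar>f (fst z) - f (c *\<^sub>R fst z + s *\<^sub>R snd z)\<bar>)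
    \<le> 2 * (\<bar>1 - c\<bar> * gmean vs norm + \<bar>s\<bar> * (gabs * sqrt r))"
proof -
  note lf = lip_subgradable[OF f]
  define p where "p z = max 0 (f (fst z) - f (c *\<^sub>R fst z + s *\<^sub>R snd z))" for z :: "'a \<times> 'a"
  define q where "q z = max 0 (f (c *\<^sub>R fst z + s *\<^sub>R snd z) - f (fst z))" for z :: "'a \<times> 'a"
  define q' where "q' z = max 0 (f (fst z) - f (c *\<^sub>R fst z + (- s) *\<^sub>R snd z))" for z :: "'a \<times> 'a"
  have lp: "lip p" "lip q" "lip q'" unfolding p_def q_def q'_def
    by (intro lip_max lip_const lip_diff lip_compose_linear0[OF lf] bounded_linear_fst bounded_linear_comb)+
  have "gmean (dup vs) q = gmean (dup vs) q'"
  proof -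
    have "q (c *\<^sub>R x - s *\<^sub>R y, s *\<^sub>R x + c *\<^sub>R y) = q' (x, y)" for x y
    proof -
      have "c *\<^sub>R (c *\<^sub>R x - s *\<^sub>R y) + s *\<^sub>R (s *\<^sub>R x + c *\<^sub>R y) = (c\<^sup>2 + s\<^sup>2) *\<^sub>R x"
        by (simp add: algebra_simps power2_eq_square)
      then show ?thesis by (simp add: q_def q'_def cs)
    qed
    then have "(\<lambda>z. q (c *\<^sub>R fst z - s *\<^sub>R snd z, s *\<^sub>R fst z + c *\<^sub>R snd z)) = q'" by (intro ext) simp
    then show ?thesis using gmean_dup_rotate[OF lp(2) cs, of vs] by simp
  qed
  moreover have "gmean (dup vs) p \<le> \<bar>1 - c\<bar> * gmean vs norm + \<bar>s\<bar> * (gabs * sqrt r)"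
    unfolding p_def by (rule gmean_subgradable_increment[OF f r])
  moreover have "gmean (dup vs) q' \<le> \<bar>1 - c\<bar> * gmean vs norm + \<bar>- s\<bar> * (gabs * sqrt r)"
    unfolding q'_def by (rule gmean_subgradable_increment[OF f r])
  moreover have "(\<lambda>z. \<bar>f (fst z) - f (c *\<^sub>R fst z + s *\<^sub>R snd z)\<bar>) = (\<lambda>z. p z + q z)"
    by (rule ext) (auto simp: p_def q_def)
  ultimately show ?thesis by (simp add: gmean_add lp)
qed

text \<open>Maurey--Pisier: join independent copies \<open>x\<close> and \<open>y\<close> by the quarter circle
  \<open>cos t x + sin t y\<close>; any two neighbouring points of a subdivision have the joint law of
  \<open>x\<close> and \<open>cos h x + sin h y\<close>.\<close>

lemma gmean_concentration:
  assumes f: "subgradable f" and r: "\<And>a. norm a \<le> 1 \<Longrightarrow> (\<Sum>v\<leftarrow>vs. (rin v a)\<^sup>2) \<le> r"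
  shows "gmean (dup vs) (\<lambda>z. \<bar>f (fst z) - f (snd z)\<bar>) \<le> pi * gabs * sqrt r"
proof -
  note lf = lip_subgradable[OF f]
  define X where "X t z = cos t *\<^sub>R fst z + sin t *\<^sub>R snd z" for t and z :: "'a \<times> 'a"
  have bX: "bounded_linear (X t)" for t unfolding X_def by (rule bounded_linear_comb)
  define G where "G s t z = \<bar>f (X s z) - f (X t z)\<bar>" for s t z
  have lG: "lip (G s t)" for s t
    unfolding G_def by (intro lip_abs lip_diff lip_compose_linear0[OF lf] bX)
  have shift: "gmean (dup vs) (G t (t + h)) = gmean (dup vs) (G 0 h)" for t h
  proof -
    have cs: "(cos t)\<^sup>2 + (- sin t)\<^sup>2 = 1" by simp
    have "G 0 h (cos t *\<^sub>R x - (- sin t) *\<^sub>R y, (- sin t) *\<^sub>R x + cos t *\<^sub>R y) = G t (t + h) (x, y)" for x y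
      by (simp add: G_def X_def cos_add sin_add algebra_simps)
    then have "(\<lambda>z. G 0 h (cos t *\<^sub>R fst z - (- sin t) *\<^sub>R snd z, (- sin t) *\<^sub>R fst z + cos t *\<^sub>R snd z))
        = G t (t + h)" by (intro ext) simp
    then show ?thesis using gmean_dup_rotate[OF lG cs, of vs 0 h] by simp
  qed
  have step: "gmean (dup vs) (G 0 h) \<le> h\<^sup>2 * gmean vs norm + 2 * \<bar>h\<bar> * (gabs * sqrt r)" for h
  proof -
    have "gmean (dup vs) (G 0 h) \<le> 2 * (\<bar>1 - cos h\<bar> * gmean vs norm + \<bar>sin h\<bar> * (gabs * sqrt r))"
      using gmean_subgradable_rotation_step[OF f r, of "cos h" "sin h"] unfolding G_def X_def by simp
    also have "\<dots> \<le> 2 * (h\<^sup>2 / 2 * gmean vs norm + \<bar>h\<bar> * (gabs * sqrt r))"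
    proof -
      have "1 - cos h = 2 * (sin (h / 2))\<^sup>2" using cos_double_sin[of "h / 2"] by simp
      also have "\<dots> \<le> 2 * (h / 2)\<^sup>2"
        using power_mono[OF abs_sin_x_le_abs_x abs_ge_zero, of "h / 2" 2] unfolding power2_abs by simp
      finally have 1: "\<bar>1 - cos h\<bar> \<le> h\<^sup>2 / 2" by (simp add: power_divide)
      have r0: "0 \<le> r" using r[of 0] by (simp add: cinner_simps)
      show ?thesis using 1 abs_sin_x_le_abs_x[of h] gabs_pos gmean_nonneg[OF lip_norm, of vs] r0
        by (intro mult_left_mono add_mono mult_right_mono) auto
    qed
    finally show ?thesis by (simp add: algebra_simps)
  qed
  have tele: "gmean (dup vs) (G 0 (real n * h)) \<le> real n * gmean (dup vs) (G 0 h)" for n h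
  proof (induction n)
    case 0
    then show ?case by (simp add: G_def gmean_const)
  next
    case (Suc n)
    have "gmean (dup vs) (G 0 (real (Suc n) * h))
        \<le> gmean (dup vs) (\<lambda>z. G 0 (real n * h) z + G (real n * h) (real n * h + h) z)"
      by (intro gmean_mono lip_add lG) (auto simp: G_def algebra_simps)
    also have "\<dots> \<le> real n * gmean (dup vs) (G 0 h) + gmean (dup vs) (G 0 h)"
      using Suc by (simp add: gmean_add lG shift)
    finally show ?case by (simp add: algebra_simps)
  qed
  define D where "D = gmean (dup vs) (G 0 (pi / 2))"
  \<comment> \<open>With \<open>Suc n\<close> equal arcs, the terms quadratic in the arc length add
    up to order \<open>1 / Suc n\<close>, while the linear ones add up to
    \<open>pi * gabs * sqrt r\<close> for every \<open>n\<close>.\<close>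
  have bound: "D \<le> (pi\<^sup>2 / 4 * gmean vs norm) * inverse (real (Suc n)) + pi * gabs * sqrt r" for n
  proof -
    let ?h = "pi / 2 / real (Suc n)"
    have "real (Suc n) * ?h = pi / 2" by (simp del: of_nat_Suc)
    then have "D \<le> real (Suc n) * gmean (dup vs) (G 0 ?h)"
      using tele[of "Suc n" ?h] unfolding D_def by metis
    also have "\<dots> \<le> real (Suc n) * (?h\<^sup>2 * gmean vs norm + 2 * \<bar>?h\<bar> * (gabs * sqrt r))"
      by (intro mult_left_mono step) simp
    also have "\<dots> = (pi\<^sup>2 / 4 * gmean vs norm) * inverse (real (Suc n)) + pi * gabs * sqrt r"
      by (simp add: field_simps power2_eq_square del: of_nat_Suc)
    finally show ?thesis .
  qed
  have "(\<lambda>n. (pi\<^sup>2 / 4 * gmean vs norm) * inverse (real (Suc n)) + pi * gabs * sqrt r)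
      \<longlonglongrightarrow> (pi\<^sup>2 / 4 * gmean vs norm) * 0 + pi * gabs * sqrt r"
    by (intro tendsto_intros LIMSEQ_inverse_real_of_nat)
  then have "D \<le> (pi\<^sup>2 / 4 * gmean vs norm) * 0 + pi * gabs * sqrt r"
    by (rule tendsto_lowerbound) (intro always_eventually allI bound, simp)
  then show ?thesis unfolding D_def G_def X_def by simp
qed

text \<open>Jensen's inequality replaces the second independent copy by its mean.\<close>

corollary gmean_deviation:
  assumes f: "subgradable f" and r: "\<And>a. norm a \<le> 1 \<Longrightarrow> (\<Sum>v\<leftarrow>vs. (rin v a)\<^sup>2) \<le> r"
  shows "gmean vs (\<lambda>x. \<bar>f x - gmean vs f\<bar>) \<le> pi * gabs * sqrt r"
proof -
  note lf = lip_subgradable[OF f]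
  let ?h = "\<lambda>z. \<bar>f (fst z) - f (snd z)\<bar>"
  have lh: "lip ?h" by (intro lip_abs lip_diff lip_compose_linear0[OF lf] bounded_linear_fst bounded_linear_snd)
  have "\<bar>f x - gmean vs f\<bar> \<le> gmean vs (\<lambda>y. \<bar>f x - f y\<bar>)" for x
  proof -
    have "f x - gmean vs f = gmean vs (\<lambda>y. f x - f y)" by (simp add: gmean_diff lf gmean_const)
    then show ?thesis using gmean_abs_le[of "\<lambda>y. f x - f y" vs] by (simp add: lip_diff lf)
  qed
  then have "gmean vs (\<lambda>x. \<bar>f x - gmean vs f\<bar>) \<le> gmean vs (\<lambda>x. gmean vs (\<lambda>y. ?h (x, y)))"
    by (intro gmean_mono lip_abs lip_diff lip_const lf lip_gmean_pair[OF lh]) simp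
  also have "\<dots> \<le> pi * gabs * sqrt r" 
    using gmean_concentration[OF f r] unfolding gmean_dup .
  finally show ?thesis .
qed

section \<open>The Hahn--Banach theorem\<close>

definition sublinear_on :: "'x::real_vector set \<Rightarrow> ('x \<Rightarrow> real) \<Rightarrow> bool"
  where "sublinear_on V p \<longleftrightarrow> (\<forall>x\<in>V. \<forall>y\<in>V. p (x + y) \<le> p x + p y) \<and> (\<forall>x\<in>V. \<forall>c\<ge>0. p (c *\<^sub>R x) = c * p x)"

definition linear_functional_on :: "'x::real_vector set \<Rightarrow> ('x \<Rightarrow> real) \<Rightarrow> bool"
  where "linear_functional_on V f \<longleftrightarrow> (\<forall>x\<in>V. \<forall>y\<in>V. f (x + y) = f x + f y) \<and> (\<forall>x\<in>V. \<forall>c. f (c *\<^sub>R x) = c * f x)"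

lemma sublinear_onI:
  assumes V: "subspace V"
    and add: "\<And>x y. x \<in> V \<Longrightarrow> y \<in> V \<Longrightarrow> p (x + y) \<le> p x + p y"
    and zero: "p 0 = 0"
    and scale: "\<And>x c. x \<in> V \<Longrightarrow> 0 < c \<Longrightarrow> p (c *\<^sub>R x) \<le> c * p x"
  shows "sublinear_on V p"
  unfolding sublinear_on_def
proof (intro conjI ballI allI impI)
  fix x :: 'a and c :: real assume x: "x \<in> V" and c: "0 \<le> c"
  show "p (c *\<^sub>R x) = c * p x"
  proof (cases "c = 0")
    case False
    then have c: "0 < c" using c by simp
    have "p ((1 / c) *\<^sub>R c *\<^sub>R x) \<le> (1 / c) * p (c *\<^sub>R x)"
      using c x V by (intro scale) (auto simp: subspace_scale)
    then have "c * p x \<le> p (c *\<^sub>R x)" using c by (simp add: field_simps)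
    then show ?thesis using scale[OF x c] by simp
  qed (simp add: zero)
qed (rule add)

lemma sublinear_onD:
  assumes "sublinear_on V p"
  shows "x \<in> V \<Longrightarrow> y \<in> V \<Longrightarrow> p (x + y) \<le> p x + p y" "x \<in> V \<Longrightarrow> 0 \<le> c \<Longrightarrow> p (c *\<^sub>R x) = c * p x"
  using assms by (auto simp: sublinear_on_def)

lemma sublinear_on_zero: "subspace V \<Longrightarrow> sublinear_on V p \<Longrightarrow> p 0 = 0"
  using sublinear_onD(2)[of V p 0 0] subspace_0 by auto

lemma sublinear_on_lower:
  assumes "subspace V" "sublinear_on V p" "x \<in> V" "y \<in> V"
  shows "p y - p (- x) \<le> p (x + y)"
  using sublinear_onD(1)[OF assms(2), of "x + y" "- x"] assms subspace_add[of V x y] subspace_neg[of V x]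
  by simp

text \<open>\<open>q\<close> is the infimum of \<open>p (x + t *\<^sub>R y) - t * \<delta>\<close>
  over \<open>t \<ge> 0\<close> and \<open>y \<in> C\<close>. A linear functional below
  \<open>q\<close> is at least \<open>\<delta>\<close> on \<open>C\<close>, as seen at
  \<open>x = - y\<close>. With a single point for \<open>C\<close> the same construction shows that
  minimal sublinear functionals are additive.\<close>

lemma sublinear_shift:
  assumes V: "subspace V" and p: "sublinear_on V p" and C: "C \<subseteq> V" "C \<noteq> {}" "convex C"
    and \<delta>: "\<And>y. y \<in> C \<Longrightarrow> \<delta> \<le> p y"
  shows "\<exists>q. sublinear_on V q \<and> (\<forall>x\<in>V. q x \<le> p x) \<and> (\<forall>x\<in>V. \<forall>y\<in>C. q x \<le> p (x + y) - \<delta>)"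
proof -
  define I where "I = {0::real..} \<times> C"
  define h where "h x i = p (x + fst i *\<^sub>R snd i) - fst i * \<delta>" for x i
  define q where "q x = (INF i\<in>I. h x i)" for x
  have I: "I \<noteq> {}" using C(2) by (auto simp: I_def)
  have ty: "t *\<^sub>R y \<in> V" if "y \<in> C" for t y using V C(1) that by (auto simp: subspace_scale)
  have low: "- p (- x) \<le> h x i" if x: "x \<in> V" and i: "i \<in> I" for x i
  proof -
    obtain t y where ty': "i = (t, y)" "0 \<le> t" "y \<in> C" using i by (auto simp: I_def)
    have "t * \<delta> \<le> t * p y" using \<delta>[OF ty'(3)] ty'(2) by (rule mult_left_mono)
    also have "\<dots> = p (t *\<^sub>R y)" using sublinear_onD(2)[OF p] ty' C(1) by auto
    finally show ?thesis using sublinear_on_lower[OF V p x ty[OF ty'(3)], of t] by (simp add: h_def ty'(1))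
  qed
  have ql: "q x \<le> h x i" if "x \<in> V" "i \<in> I" for x i
    unfolding q_def using that low by (intro cINF_lower bdd_belowI[of _ "- p (- x)"]) auto
  have qg: "c \<le> q x" if "\<And>i. i \<in> I \<Longrightarrow> c \<le> h x i" for c x
    unfolding q_def by (rule cINF_greatest[OF I that])
  have sub: "sublinear_on V q"
  proof (rule sublinear_onI[OF V])
    fix x z assume xz: "x \<in> V" "z \<in> V"
    have *: "q (x + z) \<le> h x i + h z j" if i: "i \<in> I" and j: "j \<in> I" for i j
    proof -
      obtain s y t w where ij: "i = (s, y)" "0 \<le> s" "y \<in> C" "j = (t, w)" "0 \<le> t" "w \<in> C"
        using i j by (auto simp: I_def)
      obtain v where v: "v \<in> C" "(s + t) *\<^sub>R v = s *\<^sub>R y + t *\<^sub>R w"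
      proof (cases "s + t = 0")
        case True
        then have "s = 0" "t = 0" using ij by auto
        then show ?thesis using that[of y] ij by simp
      next
        case False
        have "(s / (s + t)) *\<^sub>R y + (t / (s + t)) *\<^sub>R w \<in> C"
          using ij False by (intro convexD[OF C(3)]) (auto simp: add_divide_distrib[symmetric])
        then show ?thesis using that False by (simp add: scaleR_add_right)
      qed
      have "q (x + z) \<le> h (x + z) (s + t, v)"
        using xz v ij V by (intro ql) (auto simp: I_def subspace_add)
      also have "\<dots> = p ((x + s *\<^sub>R y) + (z + t *\<^sub>R w)) - (s + t) * \<delta>"
        by (simp add: h_def v(2) add_ac)
      also have "p ((x + s *\<^sub>R y) + (z + t *\<^sub>R w)) \<le> p (x + s *\<^sub>R y) + p (z + t *\<^sub>R w)"
        using xz ij by (intro sublinear_onD(1)[OF p] subspace_add[OF V] ty) auto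
      finally show ?thesis by (simp add: h_def ij algebra_simps)
    qed
    have "q (x + z) - h z j \<le> q x" if "j \<in> I" for j
      using *[OF _ that] by (intro qg) (simp add: algebra_simps)
    then have "q (x + z) - q x \<le> q z" by (intro qg) (simp add: algebra_simps)
    then show "q (x + z) \<le> q x + q z" by simp
  next
    obtain y where y: "y \<in> C" using C(2) by blast
    have 0: "0 \<in> V" by (rule subspace_0[OF V])
    have "q 0 \<le> h 0 (0, y)" using y by (intro ql 0) (simp add: I_def)
    then have "q 0 \<le> 0" using sublinear_on_zero[OF V p] by (simp add: h_def)
    moreover have "0 \<le> q 0"
      using low[OF 0] sublinear_on_zero[OF V p] by (intro qg) force
    ultimately show "q 0 = 0" by simp
  next
    fix x and c :: real assume xc: "x \<in> V" "0 < c"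
    have "q (c *\<^sub>R x) / c \<le> q x"
    proof (rule qg)
      fix i assume i: "i \<in> I"
      then obtain t y where ty': "i = (t, y)" "0 \<le> t" "y \<in> C" by (auto simp: I_def)
      have "q (c *\<^sub>R x) \<le> h (c *\<^sub>R x) (c * t, y)"
        using xc ty' V by (intro ql) (auto simp: I_def subspace_scale)
      also have "\<dots> = p (c *\<^sub>R (x + t *\<^sub>R y)) - c * t * \<delta>" by (simp add: h_def algebra_simps)
      also have "p (c *\<^sub>R (x + t *\<^sub>R y)) = c * p (x + t *\<^sub>R y)"
        using xc ty' by (intro sublinear_onD(2)[OF p] subspace_add[OF V] ty) auto
      finally show "q (c *\<^sub>R x) / c \<le> h x i" using xc by (simp add: h_def ty' field_simps)
    qed
    then show "q (c *\<^sub>R x) \<le> c * q x" using xc by (simp add: field_simps)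
  qed
  obtain y where y: "y \<in> C" using C(2) by blast
  show ?thesis
  proof (intro exI conjI ballI)
    show "sublinear_on V q" by (rule sub)
    show "q x \<le> p x" if "x \<in> V" for x
      using ql[OF that, of "(0, y)"] y by (simp add: I_def h_def)
    show "q x \<le> p (x + y) - \<delta>" if "x \<in> V" "y \<in> C" for x y
      using ql[OF that(1), of "(1, y)"] that(2) by (simp add: I_def h_def)
  qed
qed

text \<open>Hahn--Banach: a minimal sublinear functional is linear.\<close>

theorem sublinear_dominates_linear:
  assumes V: "subspace V" and p: "sublinear_on V p"
  obtains f where "linear_functional_on V f" "\<And>x. x \<in> V \<Longrightarrow> f x \<le> p x"
proof -
  \<comment> \<open>The order compares functions on the whole type; the value \<open>0\<close>
    outside \<open>V\<close> is prescribed because free values there would leave nothing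
    minimal.\<close>
  define A where "A = {q. sublinear_on V q \<and> (\<forall>x\<in>V. q x \<le> p x) \<and> (\<forall>x. x \<notin> V \<longrightarrow> q x = 0)}"
  have lower: "- p (- x) \<le> q x" if "q \<in> A" "x \<in> V" for q x
  proof -
    have q: "sublinear_on V q" "\<forall>x\<in>V. q x \<le> p x" using that by (auto simp: A_def)
    have "- x \<in> V" using that V by (simp add: subspace_neg)
    then show ?thesis
      using sublinear_on_lower[OF V q(1) that(2) subspace_0[OF V]] sublinear_on_zero[OF V q(1)] q(2)
      by force
  qed
  have "\<exists>m\<in>A. \<forall>q\<in>A. (\<forall>x. q x \<le> m x) \<longrightarrow> q = m"
  proof (rule predicate_Zorn)
    show "partial_order_on A (relation_of (\<lambda>m q. \<forall>x. q x \<le> m x) A)"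
      by (rule partial_order_on_relation_ofI) (auto intro: order_trans intro!: ext order_antisym)
  next
    fix C assume C: "C \<in> Chains (relation_of (\<lambda>m q. \<forall>x. q x \<le> m x) A)"
    then have CA: "C \<subseteq> A" and tot: "\<And>q r. q \<in> C \<Longrightarrow> r \<in> C \<Longrightarrow> (\<forall>x. q x \<le> r x) \<or> (\<forall>x. r x \<le> q x)"
      unfolding Chains_def relation_of_def by blast+
    show "\<exists>u\<in>A. \<forall>q\<in>C. \<forall>x. u x \<le> q x"
    proof (cases "C = {}")
      case True
      have "(\<lambda>x. if x \<in> V then p x else 0) \<in> A"
        using p V unfolding A_def sublinear_on_def by (auto simp: subspace_add subspace_scale)
      then show ?thesis using True by blast
    next
      case False
      define u where "u x = (INF q\<in>C. q x)" for x
      have out: "q x = 0" if "q \<in> C" "x \<notin> V" for q x using CA that by (auto simp: A_def)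
      have bdd: "bdd_below ((\<lambda>q. q x) ` C)" for x
      proof (cases "x \<in> V")
        case True
        then show ?thesis using lower CA by (intro bdd_belowI[of _ "- p (- x)"]) auto
      next
        case False
        then show ?thesis by (intro bdd_belowI[of _ 0]) (auto simp: out)
      qed
      have ul: "u x \<le> q x" if "q \<in> C" for q x unfolding u_def by (rule cINF_lower[OF bdd that])
      have ug: "c \<le> u x" if "\<And>q. q \<in> C \<Longrightarrow> c \<le> q x" for c x
        unfolding u_def by (rule cINF_greatest[OF False that])
      have sub: "sublinear_on V q" if "q \<in> C" for q using CA that by (auto simp: A_def)
      have "sublinear_on V u"
      proof (rule sublinear_onI[OF V])
        fix x y assume xy: "x \<in> V" "y \<in> V"
        have *: "u (x + y) \<le> q x + r y" if "q \<in> C" "r \<in> C" for q r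
          using tot[OF that]
        proof
          assume "\<forall>x. q x \<le> r x"
          then show ?thesis using ul[OF that(1), of "x + y"] sublinear_onD(1)[OF sub[OF that(1)] xy]
            by (smt (verit))
        next
          assume "\<forall>x. r x \<le> q x"
          then show ?thesis using ul[OF that(2), of "x + y"] sublinear_onD(1)[OF sub[OF that(2)] xy]
            by (smt (verit))
        qed
        have "u (x + y) - r y \<le> u x" if "r \<in> C" for r
          using *[OF _ that] by (intro ug) (simp add: algebra_simps)
        then have "u (x + y) - u x \<le> u y" by (intro ug) (simp add: algebra_simps)
        then show "u (x + y) \<le> u x + u y" by simp
      next
        obtain q where q: "q \<in> C" using False by blast
        then have "u 0 \<le> 0" using ul[OF q, of 0] sublinear_on_zero[OF V sub[OF q]] by simp
        moreover have "0 \<le> u 0" using sublinear_on_zero[OF V sub] by (intro ug) (metis order_refl)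
        ultimately show "u 0 = 0" by simp
      next
        fix x and c :: real assume xc: "x \<in> V" "0 < c"
        have "u (c *\<^sub>R x) / c \<le> u x"
        proof (rule ug)
          fix q assume q: "q \<in> C"
          then have "u (c *\<^sub>R x) \<le> c * q x" using ul[OF q, of "c *\<^sub>R x"] sublinear_onD(2)[OF sub[OF q] xc(1)] xc by simp
          then show "u (c *\<^sub>R x) / c \<le> q x" using xc by (simp add: field_simps)
        qed
        then show "u (c *\<^sub>R x) \<le> c * u x" using xc by (simp add: field_simps)
      qed
      moreover have "u x \<le> p x" if "x \<in> V" for x
      proof -
        obtain q where q: "q \<in> C" using False by blast
        then have "q x \<le> p x" using CA that by (auto simp: A_def)
        then show ?thesis using ul[OF q, of x] by simp
      qed
      moreover have "u x = 0" if "x \<notin> V" for x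
      proof -
        obtain q where q: "q \<in> C" using False by blast
        have "u x \<le> 0" using ul[OF q, of x] out[OF q that] by simp
        moreover have "0 \<le> u x" using out[OF _ that] by (intro ug) (metis order_refl)
        ultimately show ?thesis by simp
      qed
      ultimately have "u \<in> A" by (simp add: A_def)
      then show ?thesis using ul by blast
    qed
  qed
  then obtain m where m: "m \<in> A" and min: "\<And>q. q \<in> A \<Longrightarrow> (\<forall>x. q x \<le> m x) \<Longrightarrow> q = m" by blast
  have ms: "sublinear_on V m" and mp: "\<And>x. x \<in> V \<Longrightarrow> m x \<le> p x" and mo: "\<And>x. x \<notin> V \<Longrightarrow> m x = 0"
    using m by (auto simp: A_def)
  \<comment> \<open>The shift at the single point \<open>y\<close> with
    \<open>\<delta> = m y\<close> lies below \<open>m\<close>, hence equals \<open>m\<close> by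
    minimality.\<close>
  have super: "m x + m y \<le> m (x + y)" if x: "x \<in> V" and y: "y \<in> V" for x y
  proof -
    have "\<exists>q. sublinear_on V q \<and> (\<forall>z\<in>V. q z \<le> m z) \<and> (\<forall>z\<in>V. \<forall>w\<in>{y}. q z \<le> m (z + w) - m y)"
      using y by (intro sublinear_shift V ms) auto
    then obtain q where q: "sublinear_on V q" "\<forall>z\<in>V. q z \<le> m z" "\<forall>z\<in>V. q z \<le> m (z + y) - m y"
      by auto
    define q' where "q' z = (if z \<in> V then q z else 0)" for z
    have q'm: "q' z \<le> m z" for z using q(2) mo by (simp add: q'_def)
    have "sublinear_on V q'" using q(1) V unfolding sublinear_on_def q'_def by (auto simp: subspace_add subspace_scale)
    moreover have "q' z \<le> p z" if "z \<in> V" for z using order_trans[OF q'm mp[OF that]] .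
    ultimately have "q' \<in> A" unfolding A_def by (simp add: q'_def)
    then have "q' = m" using q'm by (intro min) auto
    then have "m x = q x" using x by (simp add: q'_def flip: \<open>q' = m\<close>)
    then show ?thesis using q(3) x by force
  qed
  have add: "m (x + y) = m x + m y" if "x \<in> V" "y \<in> V" for x y
    using super[OF that] sublinear_onD(1)[OF ms that] by simp
  have neg: "m (- x) = - m x" if "x \<in> V" for x
    using add[OF that subspace_neg[OF V that]] sublinear_on_zero[OF V ms] by simp
  have "m (c *\<^sub>R x) = c * m x" if "x \<in> V" for x c
  proof (cases "0 \<le> c")
    case True
    then show ?thesis by (rule sublinear_onD(2)[OF ms that])
  next
    case False
    then show ?thesis
      using sublinear_onD(2)[OF ms subspace_neg[OF V that], of "- c"] neg[OF that] by simp
  qed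
  then have "linear_functional_on V m" using add by (simp add: linear_functional_on_def)
  then show ?thesis using mp that by blast
qed

corollary sublinear_separation:
  assumes V: "subspace V" and p: "sublinear_on V p" and C: "C \<subseteq> V" "C \<noteq> {}" "convex C"
    and \<delta>: "\<And>y. y \<in> C \<Longrightarrow> \<delta> \<le> p y"
  obtains f where "linear_functional_on V f" "\<And>x. x \<in> V \<Longrightarrow> f x \<le> p x" "\<And>y. y \<in> C \<Longrightarrow> \<delta> \<le> f y"
proof -
  have "\<exists>q. sublinear_on V q \<and> (\<forall>x\<in>V. q x \<le> p x) \<and> (\<forall>x\<in>V. \<forall>y\<in>C. q x \<le> p (x + y) - \<delta>)"
    by (rule sublinear_shift[OF V p C]) (rule \<delta>)
  then obtain q where q: "sublinear_on V q" "\<forall>x\<in>V. q x \<le> p x"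
    "\<forall>x\<in>V. \<forall>y\<in>C. q x \<le> p (x + y) - \<delta>" by (elim exE conjE)
  obtain f where f: "linear_functional_on V f" "\<And>x. x \<in> V \<Longrightarrow> f x \<le> q x"
    using sublinear_dominates_linear[OF V q(1)] by blast
  show ?thesis
  proof (rule that[OF f(1)])
    show "f x \<le> p x" if "x \<in> V" for x using f(2)[OF that] q(2)[rule_format, OF that] by simp
    show "\<delta> \<le> f y" if y: "y \<in> C" for y
    proof -
      have yV: "y \<in> V" using y C(1) by auto
      have "f (- y) \<le> p (- y + y) - \<delta>"
        using f(2)[OF subspace_neg[OF V yV]] q(3)[rule_format, OF subspace_neg[OF V yV] y] by linarith
      moreover have "f (- y) = - f y"
        using f(1) yV unfolding linear_functional_on_def by (metis mult_minus1 scaleR_minus1_left)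
      ultimately show ?thesis using sublinear_on_zero[OF V p] by simp
    qed
  qed
qed

section \<open>Finite rank operators and the trace norm\<close>

text \<open>Quadratic forms, and families of them indexed by group elements, thereby become vectors
  to which the separation theorem applies.\<close>

instantiation "fun" :: (type, real_vector) real_vector
begin

definition "scaleR_fun r f = (\<lambda>x. r *\<^sub>R f x)"

instance
  by standard (auto simp: scaleR_fun_def fun_eq_iff algebra_simps)

end

lemma scaleR_fun_apply [simp]: "(r *\<^sub>R f) x = r *\<^sub>R f x"
  by (simp add: scaleR_fun_def)

text \<open>The quadratic form of the positive finite rank operator \<open>\<Sum>v\<leftarrow>vs. \<langle>\<cdot>, v\<rangle> v\<close>, and its trace.\<close>

definition qf :: "'h::complex_hilbert list \<Rightarrow> 'h \<Rightarrow> real"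
  where "qf vs e = (\<Sum>v\<leftarrow>vs. (cmod (cinner v e))\<^sup>2)"

definition nsq :: "'h::complex_hilbert list \<Rightarrow> real"
  where "nsq vs = (\<Sum>v\<leftarrow>vs. (norm v)\<^sup>2)"

lemma qf_simps [simp]: "qf [] e = 0" "qf (v # vs) e = (cmod (cinner v e))\<^sup>2 + qf vs e"
    "qf (us @ vs) e = qf us e + qf vs e" "qf (map ((*\<^sub>R) c) vs) e = c\<^sup>2 * qf vs e"
  by (simp_all add: qf_def)
    (induction vs, simp_all add: cinner_simps norm_mult power_mult_distrib algebra_simps)

lemma nsq_simps [simp]: "nsq [] = 0" "nsq (v # vs) = (norm v)\<^sup>2 + nsq vs"
    "nsq (us @ vs) = nsq us + nsq vs" "nsq (map ((*\<^sub>R) c) vs) = c\<^sup>2 * nsq vs"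
  by (simp_all add: nsq_def)
    (induction vs, simp_all add: power_mult_distrib algebra_simps)

lemma nsq_nonneg [simp]: "0 \<le> nsq vs" by (induction vs) auto

lemma qf_nonneg [simp]: "0 \<le> qf vs e" by (induction vs) auto

text \<open>The self-adjoint finite rank operators, represented by their quadratic forms so that the
  linear structure is pointwise.\<close>

definition qf_differences :: "('h::complex_hilbert \<Rightarrow> real) set"
  where "qf_differences = {D. \<exists>\<alpha> \<beta>. D = qf \<alpha> - qf \<beta>}"

text \<open>On such forms the infimum is the usual trace norm, attained at the positive and negative
  parts of the operator.\<close>

definition trace_norm :: "('h::complex_hilbert \<Rightarrow> real) \<Rightarrow> real"
  where "trace_norm D = Inf {nsq \<alpha> + nsq \<beta> | \<alpha> \<beta>. D = qf \<alpha> - qf \<beta>}"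

lemma trace_norm_le: "D = qf \<alpha> - qf \<beta> \<Longrightarrow> trace_norm D \<le> nsq \<alpha> + nsq \<beta>"
  unfolding trace_norm_def by (rule cInf_lower) (auto intro!: bdd_belowI[of _ 0])

lemma trace_norm_ge:
  assumes "D \<in> qf_differences" "\<And>\<alpha> \<beta>. D = qf \<alpha> - qf \<beta> \<Longrightarrow> c \<le> nsq \<alpha> + nsq \<beta>"
  shows "c \<le> trace_norm D"
  unfolding trace_norm_def using assms by (intro cInf_greatest) (auto simp: qf_differences_def)

lemma trace_norm_less:
  assumes "D \<in> qf_differences" "trace_norm D < c"
  obtains \<alpha> \<beta> where "D = qf \<alpha> - qf \<beta>" "nsq \<alpha> + nsq \<beta> < c"
  using trace_norm_ge[OF assms(1), of c] assms(2) by force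

lemma qf_diff_add:
  "D = qf \<alpha> - qf \<beta> \<Longrightarrow> D' = qf \<alpha>' - qf \<beta>' \<Longrightarrow> D + D' = qf (\<alpha> @ \<alpha>') - qf (\<beta> @ \<beta>')"
  by (auto simp: fun_eq_iff)

lemma qf_diff_scale:
  "0 \<le> c \<Longrightarrow> D = qf \<alpha> - qf \<beta> \<Longrightarrow>
    c *\<^sub>R D = qf (map ((*\<^sub>R) (sqrt c)) \<alpha>) - qf (map ((*\<^sub>R) (sqrt c)) \<beta>)"
  by (rule ext) (simp add: right_diff_distrib)

lemma qf_diff_uminus: "D = qf \<alpha> - qf \<beta> \<Longrightarrow> - D = qf \<beta> - qf \<alpha>"
  by simp

lemma subspace_qf_differences: "subspace qf_differences"
proof (rule subspaceI)
  show "0 \<in> qf_differences" unfolding qf_differences_def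
    by (intro CollectI exI[of _ "[]"]) (simp add: fun_eq_iff)
  show "D + D' \<in> qf_differences" if "D \<in> qf_differences" "D' \<in> qf_differences" for D D' :: "'a \<Rightarrow> real"
    using that qf_diff_add unfolding qf_differences_def by blast
  show "c *\<^sub>R D \<in> qf_differences" if D: "D \<in> qf_differences" for c and D :: "'a \<Rightarrow> real"
  proof -
    obtain \<alpha> \<beta> where D: "D = qf \<alpha> - qf \<beta>" using D by (auto simp: qf_differences_def)
    show ?thesis
    proof (cases "0 \<le> c")
      case True
      from qf_diff_scale[OF True D] show ?thesis unfolding qf_differences_def by blast
    next
      case False
      then have "0 \<le> - c" by simp
      from qf_diff_scale[OF this qf_diff_uminus[OF D]] show ?thesis
        unfolding qf_differences_def scaleR_minus_left scaleR_minus_right minus_minus by blast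
    qed
  qed
qed

lemma sublinear_trace_norm: "sublinear_on qf_differences trace_norm"
proof (rule sublinear_onI[OF subspace_qf_differences])
  fix D D' :: "'a \<Rightarrow> real" assume D: "D \<in> qf_differences" "D' \<in> qf_differences"
  have *: "trace_norm (D + D') \<le> (nsq \<alpha> + nsq \<beta>) + (nsq \<alpha>' + nsq \<beta>')"
    if "D = qf \<alpha> - qf \<beta>" "D' = qf \<alpha>' - qf \<beta>'" for \<alpha> \<beta> \<alpha>' \<beta>'
    using trace_norm_le[OF qf_diff_add[OF that]] by simp
  have "trace_norm (D + D') - (nsq \<alpha>' + nsq \<beta>') \<le> trace_norm D" if "D' = qf \<alpha>' - qf \<beta>'" for \<alpha>' \<beta>'
  proof (rule trace_norm_ge[OF D(1)])
    fix \<alpha> \<beta> assume "D = qf \<alpha> - qf \<beta>"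
    from *[OF this that] show "trace_norm (D + D') - (nsq \<alpha>' + nsq \<beta>') \<le> nsq \<alpha> + nsq \<beta>" by simp
  qed
  note ** = this
  have "trace_norm (D + D') - trace_norm D \<le> trace_norm D'"
  proof (rule trace_norm_ge[OF D(2)])
    fix \<alpha> \<beta> assume "D' = qf \<alpha> - qf \<beta>"
    from **[OF this] show "trace_norm (D + D') - trace_norm D \<le> nsq \<alpha> + nsq \<beta>" by simp
  qed
  then show "trace_norm (D + D') \<le> trace_norm D + trace_norm D'" by simp
next
  have "(0 :: 'a \<Rightarrow> real) = qf [] - qf []" by (simp add: fun_eq_iff)
  from trace_norm_le[OF this] have "trace_norm (0 :: 'a \<Rightarrow> real) \<le> 0" by simp
  moreover have "0 \<le> trace_norm (0 :: 'a \<Rightarrow> real)"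
    by (intro trace_norm_ge subspace_0[OF subspace_qf_differences]) simp
  ultimately show "trace_norm (0 :: 'a \<Rightarrow> real) = 0" by simp
next
  fix D :: "'a \<Rightarrow> real" and c :: real assume D: "D \<in> qf_differences" and c: "0 < c"
  have "trace_norm (c *\<^sub>R D) / c \<le> trace_norm D"
  proof (rule trace_norm_ge[OF D])
    fix \<alpha> \<beta> assume "D = qf \<alpha> - qf \<beta>"
    from trace_norm_le[OF qf_diff_scale[OF _ this, of c]] c
    show "trace_norm (c *\<^sub>R D) / c \<le> nsq \<alpha> + nsq \<beta>" by (simp add: field_simps)
  qed
  then show "trace_norm (c *\<^sub>R D) \<le> c * trace_norm D" using c by (simp add: field_simps)
qed

text \<open>The real polarisation of \<open>x \<mapsto> qf [x]\<close>: the form of the self-adjoint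
  part of a rank one operator.\<close>

definition herm :: "'h::complex_hilbert \<Rightarrow> 'h \<Rightarrow> 'h \<Rightarrow> real"
  where "herm x y e = Re (cinner x e * cnj (cinner y e))"

lemma herm_simps:
  "herm (x + x') y = herm x y + herm x' y" "herm (c *\<^sub>R x) y = c *\<^sub>R herm x y"
  "herm x (y + y') = herm x y + herm x y'" "herm x (c *\<^sub>R y) = c *\<^sub>R herm x y"
  "herm (\<i> *\<^sub>C x) y = (-1) *\<^sub>R herm x (\<i> *\<^sub>C y)"
  by (auto simp: herm_def fun_eq_iff cinner_simps algebra_simps)

lemma herm_commute: "herm x y = herm y x"
  by (auto simp: herm_def fun_eq_iff)

lemma herm_self: "herm x x = qf [x]"
  by (auto simp: herm_def fun_eq_iff complex_norm_square[symmetric] simp flip: of_real_power)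

lemma herm_polarization:
  "herm x y = qf [(1/2) *\<^sub>R (x + y)] - qf [(1/2) *\<^sub>R (x - y)]"
  unfolding herm_self[symmetric]
  by (auto simp: herm_def fun_eq_iff cinner_simps algebra_simps)

lemma herm_in_qf_differences: "herm x y \<in> qf_differences"
  using herm_polarization unfolding qf_differences_def by blast

lemma trace_norm_herm: "trace_norm (herm x y) \<le> ((norm x)\<^sup>2 + (norm y)\<^sup>2) / 2"
  using trace_norm_le[OF herm_polarization, of x y] parallelogram[of x y]
  by (simp add: power_mult_distrib power_divide)

definition hermitian_contraction :: "('h::complex_hilbert \<Rightarrow> 'h) \<Rightarrow> bool"
  where "hermitian_contraction T \<longleftrightarrow> (\<forall>x y. T (x + y) = T x + T y) \<and> (\<forall>c x. T (c *\<^sub>C x) = c *\<^sub>C T x) \<and>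
    (\<forall>x. norm (T x) \<le> norm x) \<and> (\<forall>x y. cinner (T x) y = cinner x (T y))"

lemma rin_eqI: "(\<And>y. rin a y = rin b y) \<Longrightarrow> a = (b :: 'h::complex_hilbert)"
  using cinner_eq_zero_all[of "a - b"] by (simp add: cinner_simps)

lemma rin_i_left: "rin (\<i> *\<^sub>C x) y = - rin x (\<i> *\<^sub>C (y :: 'h::complex_hilbert))"
  by (simp add: cinner_simps)

lemma Im_cinner: "Im (cinner x y) = rin x (\<i> *\<^sub>C (y :: 'h::complex_hilbert))"
  by (simp add: cinner_simps)

text \<open>The dual of the trace norm is the operator norm.\<close>

lemma trace_norm_functional:
  fixes f :: "('h::complex_hilbert \<Rightarrow> real) \<Rightarrow> real"
  assumes lin: "linear_functional_on qf_differences f"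
    and le: "\<And>D. D \<in> qf_differences \<Longrightarrow> f D \<le> trace_norm D"
  obtains T where "hermitian_contraction T" "\<And>x. f (qf [x]) = rin (T x) x"
proof -
  \<comment> \<open>Pulling \<open>f\<close> back along \<open>herm\<close> gives a bounded
    symmetric real bilinear form, which Riesz turns into an operator.\<close>
  define b where "b x y = f (herm x y)" for x y
  note H = herm_in_qf_differences
  have fadd: "f (D + D') = f D + f D'" if "D \<in> qf_differences" "D' \<in> qf_differences" for D D'
    using lin that by (auto simp: linear_functional_on_def)
  have fsc: "f (c *\<^sub>R D) = c * f D" if "D \<in> qf_differences" for c D
    using lin that by (auto simp: linear_functional_on_def)
  have b: "b (x + x') y = b x y + b x' y" "b (c *\<^sub>R x) y = c * b x y"
    "b x (y + y') = b x y + b x y'" "b x (c *\<^sub>R y) = c * b x y" "b (\<i> *\<^sub>C x) y = - b x (\<i> *\<^sub>C y)"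
    for x x' y y' c
    unfolding b_def herm_simps by (simp_all only: fadd fsc H)
  have bc: "b x y = b y x" for x y by (simp only: b_def herm_commute)
  have ble: "b x y \<le> ((norm x)\<^sup>2 + (norm y)\<^sup>2) / 2" for x y
    using le[OF H, of x y] trace_norm_herm[of x y] by (simp add: b_def)
  have "\<exists>z. \<forall>y. b x y = rin z y" for x
  proof -
    let ?M = "((norm x)\<^sup>2 + 1) / 2"
    have bnd: "b x y \<le> norm y * ?M" for y
    proof (cases "y = 0")
      case True
      then show ?thesis using b(4)[of x 0 0] by simp
    next
      case False
      have "b x y = b x (norm y *\<^sub>R ((1 / norm y) *\<^sub>R y))" using False by simp
      also have "\<dots> = norm y * b x ((1 / norm y) *\<^sub>R y)" by (rule b(4))
      also have "\<dots> \<le> norm y * ?M" using ble[of x "(1 / norm y) *\<^sub>R y"] False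
        by (intro mult_left_mono) auto
      finally show ?thesis .
    qed
    have "bounded_linear (b x)"
    proof (rule bounded_linear_intro[where K = ?M])
      fix y
      have "- b x y \<le> norm y * ?M" using bnd[of "(-1) *\<^sub>R y"] b(4)[of x "-1" y] by simp
      then show "norm (b x y) \<le> norm y * ?M" using bnd[of y] by simp
    qed (simp_all add: b)
    then show ?thesis using riesz_representation_real by metis
  qed
  then obtain T where T: "\<And>x y. b x y = rin (T x) y" by metis
  have Tadd: "T (x + y) = T x + T y" for x y
    by (rule rin_eqI) (simp add: cinner_simps T[symmetric] b)
  have TR: "T (c *\<^sub>R x) = c *\<^sub>R T x" for c x
    by (rule rin_eqI) (simp add: cinner_simps T[symmetric] b)
  \<comment> \<open>\<open>herm\<close> and \<open>rin\<close> change in the same way when a factor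
    \<open>\<i>\<close> is moved from one argument to the other.\<close>
  have Ti: "T (\<i> *\<^sub>C x) = \<i> *\<^sub>C T x" for x
    by (rule rin_eqI) (simp only: rin_i_left T[symmetric] b)
  have TC: "T (c *\<^sub>C x) = c *\<^sub>C T x" for c x
  proof -
    have c: "c *\<^sub>C z = Re c *\<^sub>R z + Im c *\<^sub>R (\<i> *\<^sub>C z)" for z :: 'h
    proof -
      have "c = of_real (Re c) + of_real (Im c) * \<i>" by (simp add: complex_eq_iff)
      then have "c *\<^sub>C z = (of_real (Re c) + of_real (Im c) * \<i>) *\<^sub>C z" by (rule arg_cong)
      then show ?thesis by (simp only: scaleC_add_left scaleR_scaleC scaleC_scaleC)
    qed
    show ?thesis unfolding c by (simp only: Tadd TR Ti)
  qed
  \<comment> \<open>The quadratic bound \<open>ble\<close> is tested at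
    \<open>y = T x\<close>.\<close>
  have Tn: "norm (T x) \<le> norm x" for x
  proof -
    have "(norm (T x))\<^sup>2 = b x (T x)" by (simp add: T Re_cinner_self)
    also have "\<dots> \<le> ((norm x)\<^sup>2 + (norm (T x))\<^sup>2) / 2" by (rule ble)
    finally have "(norm (T x))\<^sup>2 \<le> (norm x)\<^sup>2" by simp
    then show ?thesis by (rule power2_le_imp_le) simp
  qed
  have Ts: "rin (T x) y = rin x (T y)" for x y
    using bc[of x y] Re_cinner_commute[of x "T y"] by (simp add: T)
  have "cinner (T x) y = cinner x (T y)" for x y
  proof (rule complex_eqI)
    show "rin (T x) y = rin x (T y)" by (rule Ts)
    show "Im (cinner (T x) y) = Im (cinner x (T y))"
      unfolding Im_cinner Ti[symmetric] by (rule Ts)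
  qed
  then have "hermitian_contraction T" using Tadd TC Tn by (simp add: hermitian_contraction_def)
  moreover have "f (qf [x]) = rin (T x) x" for x
    by (simp only: T[symmetric] b_def herm_self)
  ultimately show ?thesis by (rule that)
qed

text \<open>Density operators with range in \<open>K\<close>, trace \<open>1\<close> and operator
  norm at most \<open>r\<close>, each given by a list of vectors.\<close>

definition flat_states :: "'h::complex_hilbert set \<Rightarrow> real \<Rightarrow> 'h list set"
  where "flat_states K r = {vs. set vs \<subseteq> K \<and> nsq vs = 1 \<and> (\<forall>e. qf vs e \<le> r * (norm e)\<^sup>2)}"

text \<open>Displacement less than \<open>\<delta>\<close> in trace norm, with the decomposition
  spelled out because the perturbation estimate for Gaussian means works with the lists
  themselves.\<close>

definition almost_invariant :: "('g \<Rightarrow> 'h::complex_hilbert \<Rightarrow> 'h) \<Rightarrow> 'g set \<Rightarrow> real \<Rightarrow> 'h list \<Rightarrow> bool"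
  where "almost_invariant \<pi> F \<delta> vs \<longleftrightarrow> (\<forall>g\<in>F. \<exists>\<alpha> \<beta>. qf (map (\<pi> g) vs) - qf vs = qf \<alpha> - qf \<beta> \<and> nsq \<alpha> + nsq \<beta> < \<delta>)"

lemma flat_states_mix:
  assumes K: "cvec.subspace K" and vs: "vs \<in> flat_states K r" "ws \<in> flat_states K r"
    and st: "0 \<le> s" "0 \<le> t" "s + t = 1"
  shows "map ((*\<^sub>R) (sqrt s)) vs @ map ((*\<^sub>R) (sqrt t)) ws \<in> flat_states K r"
proof -
  have "c *\<^sub>R k \<in> K" if "k \<in> K" for c k
    using cvec.subspace_scale[OF K that] by (simp add: scaleR_scaleC)
  moreover have "s * qf vs e + t * qf ws e \<le> r * (norm e)\<^sup>2" for e
  proof -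
    have "s * qf vs e + t * qf ws e \<le> s * (r * (norm e)\<^sup>2) + t * (r * (norm e)\<^sup>2)"
      using vs st by (intro add_mono mult_left_mono) (auto simp: flat_states_def)
    also have "\<dots> = (s + t) * (r * (norm e)\<^sup>2)" by (rule distrib_right[symmetric])
    finally show ?thesis by (simp add: st(3))
  qed
  ultimately show ?thesis using vs st by (auto simp: flat_states_def)
qed

text \<open>The Day--Namioka argument: the displacements of flat states form a convex set in the
  product over \<open>F\<close> of the spaces of forms. If it stays at distance
  \<open>\<delta>\<close> from zero in the summed trace norm, the components of a separating
  functional are given by hermitian contractions.\<close>

theorem almost_invariant_or_operators:
  fixes \<pi> :: "'g \<Rightarrow> 'h::complex_hilbert \<Rightarrow> 'h"
  assumes F: "finite F" and lin: "\<And>g. g \<in> F \<Longrightarrow> linear (\<pi> g)"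
    and K: "cvec.subspace K" and ne: "flat_states K r \<noteq> {}"
    and not: "\<And>vs. vs \<in> flat_states K r \<Longrightarrow> \<not> almost_invariant \<pi> F \<delta> vs"
  shows "\<exists>T. (\<forall>g\<in>F. hermitian_contraction (T g)) \<and> (\<forall>vs\<in>flat_states K r.
    \<delta> \<le> (\<Sum>v\<leftarrow>vs. \<Sum>g\<in>F. rin (T g (\<pi> g v)) (\<pi> g v) - rin (T g v) v))"
proof -
  define V where "V = {D :: 'g \<Rightarrow> 'h \<Rightarrow> real. \<forall>g. D g \<in> qf_differences}"
  define p where "p D = (\<Sum>g\<in>F. trace_norm (D g))" for D :: "'g \<Rightarrow> 'h \<Rightarrow> real"
  define \<Delta> where "\<Delta> vs = (\<lambda>g. if g \<in> F then qf (map (\<pi> g) vs) - qf vs else 0)" for vs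
  define C where "C = \<Delta> ` flat_states K r"
  note sub = subspace_qf_differences and tn = sublinear_trace_norm
  have V: "subspace V"
    by (rule subspaceI) (auto simp: V_def subspace_0[OF sub] subspace_add[OF sub] subspace_scale[OF sub])
  have p: "sublinear_on V p"
  proof (rule sublinear_onI[OF V])
    show "p (D + D') \<le> p D + p D'" if "D \<in> V" "D' \<in> V" for D D'
      using that unfolding p_def sum.distrib[symmetric]
      by (intro sum_mono) (auto simp: V_def intro: sublinear_onD(1)[OF tn])
    show "p 0 = 0" by (simp add: p_def sublinear_on_zero[OF sub tn])
    show "p (c *\<^sub>R D) \<le> c * p D" if "D \<in> V" "0 < c" for c D
      using that by (simp add: p_def V_def sum_distrib_left sublinear_onD(2)[OF tn])
  qed
  have \<Delta>V: "\<Delta> vs \<in> V" for vs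
    using subspace_0[OF sub] by (auto simp: V_def \<Delta>_def qf_differences_def)
  have CV: "C \<subseteq> V" using \<Delta>V by (auto simp: C_def)
  have C0: "C \<noteq> {}" using ne by (simp add: C_def)
  have cvx: "convex C"
  proof (rule convexI)
    fix D D' and s t :: real assume D: "D \<in> C" "D' \<in> C" and st: "0 \<le> s" "0 \<le> t" "s + t = 1"
    then obtain vs ws where vs: "vs \<in> flat_states K r" "D = \<Delta> vs" and ws: "ws \<in> flat_states K r" "D' = \<Delta> ws"
      by (auto simp: C_def)
    let ?us = "map ((*\<^sub>R) (sqrt s)) vs @ map ((*\<^sub>R) (sqrt t)) ws"
    have m: "map (\<pi> g) (map ((*\<^sub>R) c) zs) = map ((*\<^sub>R) c) (map (\<pi> g) zs)" if "g \<in> F" for g c zs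
      by (simp add: linear_scale[OF lin[OF that]])
    have "s *\<^sub>R D + t *\<^sub>R D' = \<Delta> ?us"
    proof (intro ext)
      fix g e
      show "(s *\<^sub>R D + t *\<^sub>R D') g e = \<Delta> ?us g e"
      proof (cases "g \<in> F")
        case True
        then show ?thesis using st
          unfolding vs(2) ws(2) \<Delta>_def map_append m[OF True]
          by (simp add: algebra_simps del: map_map)
      qed (simp add: vs ws \<Delta>_def)
    qed
    then show "s *\<^sub>R D + t *\<^sub>R D' \<in> C"
      unfolding C_def using flat_states_mix[OF K vs(1) ws(1) st] by blast
  qed
  \<comment> \<open>Each trace norm is at most their sum, so a sum below \<open>\<delta>\<close>
    would make the state almost invariant.\<close>
  have \<delta>: "\<delta> \<le> p D" if DC: "D \<in> C" for D
  proof (rule ccontr)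
    assume less: "\<not> \<delta> \<le> p D"
    obtain vs where vs: "vs \<in> flat_states K r" "D = \<Delta> vs" using DC by (auto simp: C_def)
    have nn: "0 \<le> trace_norm (D g)" for g
      using \<Delta>V[of vs] vs by (intro trace_norm_ge) (auto simp: V_def)
    have "\<exists>\<alpha> \<beta>. qf (map (\<pi> g) vs) - qf vs = qf \<alpha> - qf \<beta> \<and> nsq \<alpha> + nsq \<beta> < \<delta>" if g: "g \<in> F" for g
    proof -
      have "trace_norm (D g) \<le> p D" unfolding p_def
        using F g nn by (intro member_le_sum) auto
      then have "trace_norm (D g) < \<delta>" using less by simp
      moreover have "D g \<in> qf_differences" using \<Delta>V[of vs] vs by (auto simp: V_def)
      ultimately obtain \<alpha> \<beta> where "D g = qf \<alpha> - qf \<beta>" "nsq \<alpha> + nsq \<beta> < \<delta>"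
        using trace_norm_less by metis
      moreover have "D g = qf (map (\<pi> g) vs) - qf vs" using g by (simp add: vs \<Delta>_def)
      ultimately show ?thesis by metis
    qed
    then show False using not[OF vs(1)] by (simp add: almost_invariant_def)
  qed
  obtain f where f: "linear_functional_on V f" "\<And>D. D \<in> V \<Longrightarrow> f D \<le> p D" "\<And>D. D \<in> C \<Longrightarrow> \<delta> \<le> f D"
    using sublinear_separation[OF V p CV C0 cvx \<delta>] by blast
  \<comment> \<open>The inclusion of one coordinate; along it \<open>f\<close> restricts to a
    functional dominated by the trace norm, to which duality applies.\<close>
  define single where "single g D = (\<lambda>h. if h = g then D else 0)" for g :: 'g and D :: "'h \<Rightarrow> real"
  have sV: "single g D \<in> V" if "D \<in> qf_differences" for g D
    using that subspace_0[OF sub] by (auto simp: V_def single_def)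
  have s_add: "single g (D + D') = single g D + single g D'" for g D D'
    by (rule ext) (simp add: single_def)
  have s_sc: "single g (c *\<^sub>R D) = c *\<^sub>R single g D" for g c D
    by (rule ext) (simp add: single_def)
  have fadd: "f (D + D') = f D + f D'" if "D \<in> V" "D' \<in> V" for D D'
    using f(1) that by (auto simp: linear_functional_on_def)
  have fsc: "f (c *\<^sub>R D) = c * f D" if "D \<in> V" for c D
    using f(1) that by (auto simp: linear_functional_on_def)
  have "\<exists>T. hermitian_contraction T \<and> (\<forall>x. f (single g (qf [x])) = rin (T x) x)" if g: "g \<in> F" for g
  proof -
    have "linear_functional_on qf_differences (\<lambda>D. f (single g D))"
      by (simp add: linear_functional_on_def s_add s_sc fadd fsc sV)
    moreover have "f (single g D) \<le> trace_norm D" if D: "D \<in> qf_differences" for D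
    proof -
      have "p (single g D) = (\<Sum>h\<in>F. if h = g then trace_norm D else 0)"
        unfolding p_def by (intro sum.cong) (auto simp: single_def sublinear_on_zero[OF sub tn])
      then have "p (single g D) = trace_norm D" using F g by simp
      then show ?thesis using f(2)[OF sV[OF D], of g] by simp
    qed
    ultimately show ?thesis using trace_norm_functional[of "\<lambda>D. f (single g D)"] by metis
  qed
  then obtain T where T: "\<And>g. g \<in> F \<Longrightarrow> hermitian_contraction (T g)"
    "\<And>g x. g \<in> F \<Longrightarrow> f (single g (qf [x])) = rin (T g x) x" by metis
  have qV: "qf vs \<in> qf_differences" for vs :: "'h list"
    unfolding qf_differences_def by (intro CollectI exI[of _ vs] exI[of _ "[]"]) (simp add: fun_eq_iff)
  have fq: "f (single g (qf vs)) = (\<Sum>v\<leftarrow>vs. rin (T g v) v)" if g: "g \<in> F" for g vs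
  proof (induction vs)
    case Nil
    have "single g (qf []) = 0 *\<^sub>R single g (qf [])" by (intro ext) (simp add: single_def)
    then have "f (single g (qf [])) = 0 * f (single g (qf []))" using fsc[OF sV[OF qV]] by metis
    then have "f (single g (qf [])) = 0" by (simp only: mult_zero_left)
    then show ?case by (simp only: list.map sum_list.Nil)
  next
    case (Cons v vs)
    have "qf (v # vs) = qf [v] + qf vs" by (simp add: fun_eq_iff)
    then have "f (single g (qf (v # vs))) = f (single g (qf [v])) + f (single g (qf vs))"
      by (simp only: s_add fadd[OF sV[OF qV] sV[OF qV]])
    then show ?case by (simp only: T(2)[OF g] Cons.IH list.map sum_list.Cons)
  qed
  have fd: "f (single g (qf us - qf vs)) = (\<Sum>v\<leftarrow>us. rin (T g v) v) - (\<Sum>v\<leftarrow>vs. rin (T g v) v)"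
    if g: "g \<in> F" for g us vs
  proof -
    have "single g (qf us - qf vs) = single g (qf us) + (-1) *\<^sub>R single g (qf vs)"
      by (intro ext) (simp add: single_def)
    then show ?thesis
      using fadd[OF sV[OF qV] subspace_scale[OF V sV[OF qV]], of g us "-1" g vs] fsc[OF sV[OF qV], of "-1" g vs]
      by (simp add: fq[OF g])
  qed
  have fsum: "f (\<Sum>g\<in>J. single g (D g)) = (\<Sum>g\<in>J. f (single g (D g)))"
    if "finite J" "\<And>g. D g \<in> qf_differences" for J D
    using that(1)
  proof induction
    case empty
    have "f (0 *\<^sub>R 0) = 0 * f 0" by (rule fsc) (rule subspace_0[OF V])
    then have "f 0 = 0" by (simp only: scaleR_zero_left mult_zero_left)
    then show ?case by (simp only: sum.empty)
  next
    case (insert g J)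
    have JV: "(\<Sum>g\<in>J. single g (D g)) \<in> V" by (intro subspace_sum[OF V] sV that)
    show ?case by (simp only: sum.insert[OF insert.hyps] fadd[OF sV[OF that(2)] JV] insert.IH)
  qed
  show ?thesis
  proof (intro exI conjI ballI)
    show "hermitian_contraction (T g)" if "g \<in> F" for g using T(1)[OF that] .
    fix vs assume vs: "vs \<in> flat_states K r"
    have dV: "\<Delta> vs g \<in> qf_differences" for g using \<Delta>V[of vs] by (auto simp: V_def)
    have sum_apply: "(\<Sum>g\<in>J. single g (\<Delta> vs g)) h = (\<Sum>g\<in>J. single g (\<Delta> vs g) h)" for J h
      by (induction J rule: infinite_finite_induct) auto
    have "\<Delta> vs = (\<Sum>g\<in>F. single g (\<Delta> vs g))"
    proof
      fix h
      have "(\<Sum>g\<in>F. single g (\<Delta> vs g) h) = (\<Sum>g\<in>F. if h = g then \<Delta> vs h else 0)"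
        by (intro sum.cong) (auto simp: single_def)
      also have "\<dots> = \<Delta> vs h" using F by (auto simp: \<Delta>_def)
      finally show "\<Delta> vs h = (\<Sum>g\<in>F. single g (\<Delta> vs g)) h" by (simp only: sum_apply)
    qed
    then have "f (\<Delta> vs) = f (\<Sum>g\<in>F. single g (\<Delta> vs g))" by (rule arg_cong)
    also have "\<dots> = (\<Sum>g\<in>F. f (single g (\<Delta> vs g)))" by (rule fsum[OF F dV])
    also have "\<dots> = (\<Sum>g\<in>F. (\<Sum>v\<leftarrow>map (\<pi> g) vs. rin (T g v) v) - (\<Sum>v\<leftarrow>vs. rin (T g v) v))"
      by (intro sum.cong refl) (simp add: \<Delta>_def fd)
    also have "\<dots> = (\<Sum>v\<leftarrow>vs. \<Sum>g\<in>F. rin (T g (\<pi> g v)) (\<pi> g v) - rin (T g v) v)"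
      by (induction vs) (simp_all add: sum.distrib sum_subtractf)
    finally show "\<delta> \<le> (\<Sum>v\<leftarrow>vs. \<Sum>g\<in>F. rin (T g (\<pi> g v)) (\<pi> g v) - rin (T g v) v)"
      using f(3)[of "\<Delta> vs"] vs by (simp add: C_def)
  qed
qed

section \<open>Invariant states\<close>

lemma bounded_opsI:
  assumes "\<And>x. x \<in> K \<Longrightarrow> T x \<in> K" "\<And>x. x \<notin> K \<Longrightarrow> T x = 0"
    "\<And>x y. x \<in> K \<Longrightarrow> y \<in> K \<Longrightarrow> T (x + y) = T x + T y"
    "\<And>c x. x \<in> K \<Longrightarrow> T (c *\<^sub>C x) = c *\<^sub>C T x"
    "\<And>x. x \<in> K \<Longrightarrow> norm (T x) \<le> B * norm x"
  shows "T \<in> bounded_ops K"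
  unfolding bounded_ops_def using assms by (intro CollectI conjI exI[of _ B]) auto

lemma restrict_op_bounded:
  assumes K: "cvec.subspace K"
    and T: "\<And>x. x \<in> K \<Longrightarrow> T x \<in> K" "\<And>x y. T (x + y) = T x + T y" "\<And>c x. T (c *\<^sub>C x) = c *\<^sub>C T x"
    "\<And>x. norm (T x) \<le> B * norm x"
  shows "restrict_op K T \<in> bounded_ops K"
  by (rule bounded_opsI[where B = B])
    (use T cvec.subspace_add[OF K] cvec.subspace_scale[OF K] in \<open>auto simp: restrict_op_def\<close>)

lemma bounded_ops_plus:
  assumes K: "cvec.subspace K" and S: "S \<in> bounded_ops K" and T: "T \<in> bounded_ops K"
  shows "(\<lambda>x. S x + T x) \<in> bounded_ops K"
proof -
  obtain B C where BC: "\<forall>x\<in>K. norm (S x) \<le> B * norm x" "\<forall>x\<in>K. norm (T x) \<le> C * norm x"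
    using S T by (auto simp: bounded_ops_def)
  have le: "norm (S x + T x) \<le> (B + C) * norm x" if "x \<in> K" for x
  proof -
    have "norm (S x) + norm (T x) \<le> B * norm x + C * norm x" using BC that by (intro add_mono) auto
    then show ?thesis
      using norm_triangle_ineq[of "S x" "T x"] by (simp add: distrib_right)
  qed
  show ?thesis
    by (rule bounded_opsI[OF _ _ _ _ le])
      (use S T cvec.subspace_add[OF K] in \<open>auto simp: bounded_ops_def scaleC_add_right algebra_simps\<close>)
qed

lemma bounded_ops_scaleC:
  assumes K: "cvec.subspace K" and T: "T \<in> bounded_ops K"
  shows "(\<lambda>x. c *\<^sub>C T x) \<in> bounded_ops K"
proof -
  obtain B where B: "\<forall>x\<in>K. norm (T x) \<le> B * norm x"
    using T by (auto simp: bounded_ops_def)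
  have le: "norm (c *\<^sub>C T x) \<le> (cmod c * B) * norm x" if "x \<in> K" for x
    using B that by (auto simp: norm_scaleC mult.assoc mult_left_mono)
  show ?thesis
    by (rule bounded_opsI[OF _ _ _ _ le])
      (use T cvec.subspace_scale[OF K] in \<open>auto simp: bounded_ops_def scaleC_add_right scaleC_scaleC mult.commute\<close>)
qed

section \<open>Unitary representations and finite-dimensional invariant subspaces\<close>

locale unitary_representation =
  fixes G :: "('g, 'm) monoid_scheme" (structure)
    and \<pi> :: "'g \<Rightarrow> 'h::complex_hilbert \<Rightarrow> 'h"
  assumes rep: "unitary_rep G \<pi>"
begin

lemma group_G: "group G" using rep by (simp add: unitary_rep_def)

lemma inv_closed [simp]: "g \<in> carrier G \<Longrightarrow> inv g \<in> carrier G"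
  by (rule group.inv_closed[OF group_G])

lemma inv_inv [simp]: "g \<in> carrier G \<Longrightarrow> inv (inv g) = g"
  by (rule group.inv_inv[OF group_G])

lemma unitary: "g \<in> carrier G \<Longrightarrow> unitary_op (\<pi> g)"
  using rep by (auto simp: unitary_rep_def hom_def unitary_group_def)

lemma pi_mult: "g \<in> carrier G \<Longrightarrow> h \<in> carrier G \<Longrightarrow> \<pi> (g \<otimes> h) = \<pi> g \<circ> \<pi> h"
  using rep by (auto simp: unitary_rep_def hom_def unitary_group_def)

lemma
  assumes "g \<in> carrier G"
  shows pi_add: "\<pi> g (x + y) = \<pi> g x + \<pi> g y"
    and pi_scaleC: "\<pi> g (c *\<^sub>C x) = c *\<^sub>C \<pi> g x"
    and pi_cinner: "cinner (\<pi> g x) (\<pi> g y) = cinner x y"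
proof -
  interpret Vector_Spaces.linear scaleC scaleC "\<pi> g"
    using unitary[OF assms] by (simp add: unitary_op_def)
  show "\<pi> g (x + y) = \<pi> g x + \<pi> g y" "\<pi> g (c *\<^sub>C x) = c *\<^sub>C \<pi> g x" by (rule add, rule scale)
  show "cinner (\<pi> g x) (\<pi> g y) = cinner x y" using unitary[OF assms] by (simp add: unitary_op_def)
qed

lemma pi_linear: "g \<in> carrier G \<Longrightarrow> linear (\<pi> g)"
  by (rule linearI) (simp_all add: pi_add pi_scaleC scaleR_scaleC)

lemma pi_diff: "g \<in> carrier G \<Longrightarrow> \<pi> g (x - y) = \<pi> g x - \<pi> g y"
  by (rule linear_diff[OF pi_linear])

lemma pi_zero [simp]: "g \<in> carrier G \<Longrightarrow> \<pi> g 0 = 0"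
  by (rule linear_0[OF pi_linear])

lemma pi_norm [simp]: "g \<in> carrier G \<Longrightarrow> norm (\<pi> g x) = norm x"
  using pi_cinner[of g x x] Re_cinner_self[of "\<pi> g x"] Re_cinner_self[of x]
  by (simp add: power2_eq_iff_nonneg)

text \<open>Membership in \<open>hom\<close> asks only for multiplicativity; an idempotent linear
  isometry is the identity.\<close>

lemma pi_one: "\<pi> \<one> x = x"
proof -
  have 1: "\<one> \<in> carrier G" using group.is_monoid[OF group_G] by (rule monoid.one_closed)
  have "\<pi> \<one> (\<pi> \<one> x) = \<pi> \<one> x"
    using pi_mult[OF 1 1] group.is_monoid[OF group_G] by (simp add: monoid.l_one[OF _ 1] fun_eq_iff)
  then have "\<pi> \<one> (\<pi> \<one> x - x) = 0" by (simp add: pi_diff[OF 1])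
  then have "norm (\<pi> \<one> x - x) = 0" using pi_norm[OF 1, of "\<pi> \<one> x - x"] by simp
  then show ?thesis by simp
qed

lemma pi_inv [simp]:
  assumes "g \<in> carrier G"
  shows "\<pi> (inv g) (\<pi> g x) = x" "\<pi> g (\<pi> (inv g) x) = x"
proof -
  show "\<pi> (inv g) (\<pi> g x) = x"
    using pi_mult[OF inv_closed[OF assms] assms] pi_one[of x] group.l_inv[OF group_G assms]
    by (metis comp_apply)
  show "\<pi> g (\<pi> (inv g) x) = x"
    using pi_mult[OF assms inv_closed[OF assms]] pi_one[of x] group.r_inv[OF group_G assms]
    by (metis comp_apply)
qed

lemma pi_cinner_left: "g \<in> carrier G \<Longrightarrow> cinner (\<pi> g x) y = cinner x (\<pi> (inv g) y)"
  using pi_cinner[of g x "\<pi> (inv g) y"] by simp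

text \<open>A finite-dimensional invariant subspace, carried by an orthonormal basis. The empty
  frame is the zero subspace, whose complement is the whole space.\<close>

definition invariant_frame :: "'h set \<Rightarrow> bool"
  where "invariant_frame E \<longleftrightarrow> orthonormal E \<and> (\<forall>g\<in>carrier G. \<forall>e\<in>E. \<pi> g e \<in> cvec.span E)"

lemma invariant_frame_span:
  assumes "invariant_frame E" "g \<in> carrier G" "x \<in> cvec.span E"
  shows "\<pi> g x \<in> cvec.span E"
  using assms(3)
proof (induction rule: cvec.span_induct_alt)
  case base
  then show ?case using assms(2) by (simp add: cvec.span_zero)
next
  case (step c e y)
  then show ?case using assms
    by (simp add: pi_add pi_scaleC cvec.span_add cvec.span_scale invariant_frame_def)
qed

lemma cinner_zero_commute: "cinner x y = 0 \<longleftrightarrow> cinner y (x::'h) = 0"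
  using cinner_commute[of x y] by auto

lemma invariant_frame_orthogonal:
  assumes E: "invariant_frame E" and g: "g \<in> carrier G" and x: "\<And>e. e \<in> E \<Longrightarrow> cinner x e = 0" and e: "e \<in> E"
  shows "cinner (\<pi> g x) e = 0"
proof -
  have "\<pi> (inv g) e \<in> cvec.span E"
    by (rule invariant_frame_span[OF E inv_closed[OF g]]) (rule cvec.span_base[OF e])
  then have "cinner x (\<pi> (inv g) e) = 0" by (rule cinner_orthonormal_span) (rule x)
  then show ?thesis by (simp add: pi_cinner_left[OF g])
qed

lemma onproj_add: "onproj E (x + y) = onproj E x + onproj E y"
  by (simp add: onproj_def cinner_simps scaleC_add_left sum.distrib)

lemma onproj_scaleC: "onproj E (c *\<^sub>C x) = c *\<^sub>C onproj E x"
  by (simp add: onproj_def cinner_simps cvec.scale_sum_right scaleC_scaleC)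

lemma onproj_diff: "onproj E (x - y) = onproj E x - onproj E y"
  by (simp add: onproj_def cinner_simps scaleC.diff_left sum_subtractf)

lemma onproj_orthogonal: "(\<And>e. e \<in> E \<Longrightarrow> cinner x e = 0) \<Longrightarrow> onproj E x = 0"
  by (simp add: onproj_def)

text \<open>Both the span and, by unitarity, its orthogonal complement are invariant.\<close>

lemma invariant_frame_onproj:
  assumes E: "invariant_frame E" and g: "g \<in> carrier G"
  shows "onproj E (\<pi> g x) = \<pi> g (onproj E x)"
proof -
  have on: "orthonormal E" using E by (simp add: invariant_frame_def)
  have "onproj E (\<pi> g (x - onproj E x)) = 0"
    by (rule onproj_orthogonal) (rule invariant_frame_orthogonal[OF E g cinner_diff_onproj[OF on]])
  moreover have "onproj E (\<pi> g (onproj E x)) = \<pi> g (onproj E x)"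
    by (intro onproj_span_id[OF on] invariant_frame_span[OF E g] onproj_in_span)
  ultimately show ?thesis by (simp add: pi_diff[OF g] onproj_diff)
qed

definition ortho :: "'h set \<Rightarrow> 'h set"
  where "ortho E = {x. \<forall>e\<in>E. cinner x e = 0}"

lemma subspace_ortho: "cvec.subspace (ortho E)"
  by (rule cvec.subspaceI) (auto simp: ortho_def cinner_simps)

lemma closed_ortho: "closed (ortho E)"
proof -
  have "ortho E = (\<Inter>e\<in>E. {x. cinner x e = 0})" by (auto simp: ortho_def)
  moreover have "closed {x. cinner x e = 0}" for e
    by (intro closed_Collect_eq continuous_intros linear_continuous_on cinner.bounded_linear_left)
  ultimately show ?thesis by auto
qed

lemma diff_onproj_in_ortho: "orthonormal E \<Longrightarrow> x - onproj E x \<in> ortho E"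
  by (simp add: ortho_def cinner_diff_onproj)

lemma ortho_frame:
  assumes E: "invariant_frame E"
  shows "closed_invariant_subspace G \<pi> (ortho E)" "finite_codim (ortho E)"
proof -
  have on: "orthonormal E" using E by (simp add: invariant_frame_def)
  show "closed_invariant_subspace G \<pi> (ortho E)"
    unfolding closed_invariant_subspace_def
    using subspace_ortho closed_ortho invariant_frame_orthogonal[OF E] by (fastforce simp: ortho_def)
  have "x \<in> cvec.span (ortho E \<union> E)" for x
  proof -
    have "x - onproj E x \<in> cvec.span (ortho E \<union> E)"
      by (rule cvec.span_base) (simp add: diff_onproj_in_ortho[OF on])
    moreover have "onproj E x \<in> cvec.span (ortho E \<union> E)"
      using onproj_in_span[of E x] cvec.span_mono[of E "ortho E \<union> E"] by auto
    ultimately show ?thesis using cvec.span_add[of "x - onproj E x" _ "onproj E x"] by simp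
  qed
  then show "finite_codim (ortho E)"
    unfolding finite_codim_def using orthonormalD(1)[OF on] by (intro exI[of _ E]) auto
qed

end

section \<open>The form induced by an invariant state on rank one operators\<close>

locale invariant_state = unitary_representation G \<pi>
  for G :: "('g, 'm) monoid_scheme" (structure) and \<pi> :: "'g \<Rightarrow> 'h::complex_hilbert \<Rightarrow> 'h" +
  fixes K :: "'h set" and \<phi> :: "('h \<Rightarrow> 'h) \<Rightarrow> complex"
  assumes K: "closed_invariant_subspace G \<pi> K"
    and state: "state_on K \<phi>"
    and inv_state: "\<And>g T. g \<in> carrier G \<Longrightarrow> T \<in> bounded_ops K \<Longrightarrow>
      \<phi> (subrep \<pi> K g \<circ> T \<circ> subrep \<pi> K (inv g)) = \<phi> T"
begin

lemma subspace_K: "cvec.subspace K" and closed_K: "closed K"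
  and K_inv: "g \<in> carrier G \<Longrightarrow> x \<in> K \<Longrightarrow> \<pi> g x \<in> K"
  using K by (auto simp: closed_invariant_subspace_def)

lemmas K_closed = cvec.subspace_0[OF subspace_K] cvec.subspace_add[OF subspace_K]
  cvec.subspace_diff[OF subspace_K] cvec.subspace_scale[OF subspace_K] cvec.subspace_sum[OF subspace_K]

lemma K_scaleR: "x \<in> K \<Longrightarrow> r *\<^sub>R x \<in> K"
  by (simp add: scaleR_scaleC K_closed)

lemma phi_add: "S \<in> bounded_ops K \<Longrightarrow> T \<in> bounded_ops K \<Longrightarrow> \<phi> (\<lambda>x. S x + T x) = \<phi> S + \<phi> T"
  using state by (auto simp: state_on_def)

lemma phi_scale: "T \<in> bounded_ops K \<Longrightarrow> \<phi> (\<lambda>x. c *\<^sub>C T x) = c * \<phi> T"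
  using state by (auto simp: state_on_def)

lemma phi_one: "\<phi> (restrict_op K id) = 1"
  using state by (auto simp: state_on_def)

lemma phi_pos: "positive_op K T \<Longrightarrow> 0 \<le> Re (\<phi> T)"
  using state by (auto simp: state_on_def complex_nonneg_Reals_iff)

lemmas restrict_in_bounded_ops = restrict_op_bounded[OF subspace_K]
  and bounded_ops_add = bounded_ops_plus[OF subspace_K]
  and bounded_ops_scale = bounded_ops_scaleC[OF subspace_K]

lemma bounded_ops_zero: "(\<lambda>x. 0) \<in> bounded_ops K"
  using K_closed by (auto simp: bounded_ops_def intro: exI[of _ 0])

lemma phi_zero: "\<phi> (\<lambda>x. 0) = 0"
  using phi_scale[OF bounded_ops_zero, of 0] by simp

lemma phi_sum:
  assumes "\<And>i. i \<in> I \<Longrightarrow> T i \<in> bounded_ops K"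
  shows "(\<lambda>x. \<Sum>i\<in>I. T i x) \<in> bounded_ops K" "\<phi> (\<lambda>x. \<Sum>i\<in>I. T i x) = (\<Sum>i\<in>I. \<phi> (T i))"
  using assms
proof (induction I rule: infinite_finite_induct)
  case (insert i I)
  { case 1 then show ?case using insert by (simp add: bounded_ops_add) }
  { case 2 then show ?case using insert by (simp add: phi_add) }
qed (simp_all add: bounded_ops_zero phi_zero)

definition rank1 :: "'h \<Rightarrow> 'h \<Rightarrow> 'h \<Rightarrow> 'h"
  where "rank1 x y = restrict_op K (\<lambda>z. cinner z y *\<^sub>C x)"

lemma rank1_bounded: "x \<in> K \<Longrightarrow> rank1 x y \<in> bounded_ops K"
  unfolding rank1_def
proof (rule restrict_in_bounded_ops)
  show "norm (cinner z y *\<^sub>C x) \<le> (norm y * norm x) * norm z" for z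
    using mult_right_mono[OF cmod_cinner_le[of z y], of "norm x"]
    by (simp add: norm_scaleC mult_ac)
qed (simp_all add: K_closed cinner_simps scaleC_add_left scaleC_scaleC)

text \<open>The quadratic form of the normal part of \<open>\<phi>\<close>: it vanishes on
  \<open>K\<close> exactly when \<open>\<phi>\<close> kills all finite rank operators on
  \<open>K\<close>.\<close>

definition B :: "'h \<Rightarrow> real"
  where "B x = Re (\<phi> (rank1 x x))"

definition C :: "'h \<Rightarrow> 'h \<Rightarrow> real"
  where "C x y = Re (\<phi> (rank1 x y)) + Re (\<phi> (rank1 y x))"

lemma B_nonneg: "x \<in> K \<Longrightarrow> 0 \<le> B x"
  unfolding B_def
proof (rule phi_pos, unfold positive_op_def, intro conjI rank1_bounded ballI)
  fix z assume "x \<in> K" "z \<in> K"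
  have "cinner (rank1 x x z) z = of_real ((cmod (cinner z x))\<^sup>2)"
    using \<open>z \<in> K\<close> unfolding complex_norm_square
    by (simp add: rank1_def restrict_op_def cinner_simps cinner_commute[of x z])
  then show "cinner (rank1 x x z) z \<in> \<real>\<^sub>\<ge>\<^sub>0" by (simp only: nonneg_Reals_of_real_iff) simp
qed

lemma rank1_add_left: "x \<in> K \<Longrightarrow> x' \<in> K \<Longrightarrow> \<phi> (rank1 (x + x') y) = \<phi> (rank1 x y) + \<phi> (rank1 x' y)"
  unfolding phi_add[OF rank1_bounded rank1_bounded, symmetric]
  by (rule arg_cong[of _ _ \<phi>]) (auto simp: rank1_def restrict_op_def scaleC_add_right)

lemma rank1_add_right: "x \<in> K \<Longrightarrow> \<phi> (rank1 x (y + y')) = \<phi> (rank1 x y) + \<phi> (rank1 x y')"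
  unfolding phi_add[OF rank1_bounded rank1_bounded, symmetric]
  by (rule arg_cong[of _ _ \<phi>]) (auto simp: rank1_def restrict_op_def cinner_simps scaleC_add_left)

lemma rank1_scale_left: "x \<in> K \<Longrightarrow> \<phi> (rank1 (c *\<^sub>C x) y) = c * \<phi> (rank1 x y)"
  unfolding phi_scale[OF rank1_bounded, symmetric]
  by (rule arg_cong[of _ _ \<phi>]) (auto simp: rank1_def restrict_op_def scaleC_scaleC mult.commute)

lemma rank1_scale_right: "x \<in> K \<Longrightarrow> \<phi> (rank1 x (c *\<^sub>C y)) = cnj c * \<phi> (rank1 x y)"
  unfolding phi_scale[OF rank1_bounded, symmetric]
  by (rule arg_cong[of _ _ \<phi>]) (auto simp: rank1_def restrict_op_def cinner_simps scaleC_scaleC)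

lemma B_add: "x \<in> K \<Longrightarrow> y \<in> K \<Longrightarrow> B (x + y) = B x + B y + C x y"
  by (simp add: B_def C_def rank1_add_left rank1_add_right K_closed)

lemma C_scaleR: "x \<in> K \<Longrightarrow> y \<in> K \<Longrightarrow> C x (r *\<^sub>R y) = r * C x y"
  by (simp add: C_def scaleR_scaleC rank1_scale_left rank1_scale_right distrib_left)

lemma B_scaleC: "x \<in> K \<Longrightarrow> B (c *\<^sub>C x) = (cmod c)\<^sup>2 * B x"
proof -
  assume "x \<in> K"
  then have "\<phi> (rank1 (c *\<^sub>C x) (c *\<^sub>C x)) = (c * cnj c) * \<phi> (rank1 x x)"
    by (simp add: rank1_scale_left rank1_scale_right)
  also have "\<dots> = of_real ((cmod c)\<^sup>2) * \<phi> (rank1 x x)" by (simp only: complex_norm_square)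
  finally show ?thesis unfolding B_def by (simp only: Re_complex_of_real times_complex.sel Im_complex_of_real)
qed

lemma B_scaleR: "x \<in> K \<Longrightarrow> B (r *\<^sub>R x) = r\<^sup>2 * B x"
  by (simp add: scaleR_scaleC B_scaleC)

lemma B_diff: "x \<in> K \<Longrightarrow> y \<in> K \<Longrightarrow> B (x - y) = B x + B y - C x y"
  using B_add[of x "(-1) *\<^sub>R y"] C_scaleR[of x y "-1"] B_scaleR[of y "-1"] K_scaleR[of y "-1"] by simp

lemma B_parallelogram: "x \<in> K \<Longrightarrow> y \<in> K \<Longrightarrow> B (x + y) + B (x - y) = 2 * B x + 2 * B y"
  by (simp add: B_add B_diff)

text \<open>Nonnegativity of \<open>B (3 *\<^sub>R x - y)\<close>. The weight \<open>3\<close>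
  brings the factor of \<open>B y\<close> down to \<open>4 / 3\<close>, which leaves room below the
  supremum in \<open>sup_eigenspace\<close>.\<close>

lemma B_add_le: "x \<in> K \<Longrightarrow> y \<in> K \<Longrightarrow> B (x + y) \<le> 4 * B x + 4 / 3 * B y"
proof -
  assume xy: "x \<in> K" "y \<in> K"
  have "0 \<le> B (3 *\<^sub>R x - y)" by (intro B_nonneg K_closed K_scaleR xy)
  also have "\<dots> = 9 * B x + B y - 3 * C x y"
  proof -
    have "C (3 *\<^sub>R x) y = 3 * C x y" using C_scaleR[of y x 3] xy by (simp add: C_def)
    then show ?thesis by (simp add: B_diff K_scaleR xy B_scaleR)
  qed
  finally show ?thesis by (simp add: B_add xy)
qed

text \<open>The identity minus the projection onto the span of \<open>E\<close> is positive, so the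
  trace of \<open>B\<close> is at most \<open>\<phi>\<close> of the identity.\<close>

lemma B_orthonormal:
  assumes E: "orthonormal E" "E \<subseteq> K"
  shows "(\<Sum>e\<in>E. B e) \<le> 1"
proof -
  let ?T = "\<lambda>z. restrict_op K id z + (-1) *\<^sub>C (\<Sum>e\<in>E. rank1 e e z)"
  have r: "rank1 e e \<in> bounded_ops K" if "e \<in> E" for e using E(2) that by (auto intro: rank1_bounded)
  have s: "(\<lambda>z. \<Sum>e\<in>E. rank1 e e z) \<in> bounded_ops K" by (rule phi_sum(1)[OF r])
  have i: "restrict_op K id \<in> bounded_ops K"
    by (rule restrict_in_bounded_ops[where B = 1]) auto
  have T: "?T \<in> bounded_ops K" by (intro bounded_ops_add bounded_ops_scale i s)
  have m: "(-1) *\<^sub>C x = - x" for x :: 'h by (metis cvec.scale_minus_left cvec.scale_one)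
  have "positive_op K ?T"
    unfolding positive_op_def
  proof (intro conjI T ballI)
    fix z assume z: "z \<in> K"
    have "?T z = z - onproj E z"
      using z by (simp add: rank1_def restrict_op_def onproj_def m)
    moreover have "cinner (z - onproj E z) z = cinner (z - onproj E z) (z - onproj E z)"
    proof -
      have "cinner (z - onproj E z) (onproj E z) = 0"
        by (rule cinner_orthonormal_span[OF onproj_in_span]) (rule cinner_diff_onproj[OF E(1)])
      then show ?thesis by (simp add: cinner_simps)
    qed
    ultimately have "cinner (?T z) z = of_real ((norm (z - onproj E z))\<^sup>2)"
      by (simp only: cinner_self)
    then show "cinner (?T z) z \<in> \<real>\<^sub>\<ge>\<^sub>0" by (simp only: nonneg_Reals_of_real_iff) simp
  qed
  have ps: "\<phi> (\<lambda>z. \<Sum>e\<in>E. rank1 e e z) = (\<Sum>e\<in>E. \<phi> (rank1 e e))" by (rule phi_sum(2)[OF r])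
  from phi_pos[OF \<open>positive_op K ?T\<close>] show ?thesis
    unfolding phi_add[OF i bounded_ops_scale[OF s]] phi_scale[OF s] ps phi_one
    by (simp add: B_def)
qed

lemma B_le: "x \<in> K \<Longrightarrow> B x \<le> (norm x)\<^sup>2"
proof (cases "x = 0")
  case True
  then show ?thesis using B_scaleR[of 0 0] K_closed(1) by simp
next
  case False
  assume x: "x \<in> K"
  let ?u = "(1 / norm x) *\<^sub>R x"
  have "orthonormal {?u}" using False orthonormal_insert(1)[of "{}" ?u] by simp
  then have "B ?u \<le> 1" using B_orthonormal[of "{?u}"] K_scaleR[OF x] by simp
  then show ?thesis using False by (simp add: B_scaleR x power_divide field_simps)
qed

lemma B_pi: "g \<in> carrier G \<Longrightarrow> x \<in> K \<Longrightarrow> B (\<pi> g x) = B x"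
proof -
  assume g: "g \<in> carrier G" and x: "x \<in> K"
  have "subrep \<pi> K g \<circ> rank1 x x \<circ> subrep \<pi> K (inv g) = rank1 (\<pi> g x) (\<pi> g x)"
  proof
    fix z
    show "(subrep \<pi> K g \<circ> rank1 x x \<circ> subrep \<pi> K (inv g)) z = rank1 (\<pi> g x) (\<pi> g x) z"
    proof (cases "z \<in> K")
      case True
      have "cinner (\<pi> (inv g) z) x = cinner z (\<pi> g x)"
        using pi_cinner_left[OF inv_closed[OF g], of z x] g by simp
      then show ?thesis using True x g
        by (simp add: subrep_def restrict_op_def rank1_def K_inv K_closed pi_scaleC)
    next
      case False
      then show ?thesis using K_closed(1) g x
        by (simp add: subrep_def restrict_op_def rank1_def cinner_simps)
    qed
  qed
  then show ?thesis using inv_state[OF g rank1_bounded[OF x], of x] by (simp add: B_def)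
qed

section \<open>The top eigenspace of the form \<open>B\<close>\<close>

lemma maximal_orthonormal:
  assumes P: "P {}" and bound: "\<And>E. P E \<Longrightarrow> real (card (E :: 'h set)) \<le> c"
  shows "\<exists>E. P E \<and> (\<forall>E'. P E' \<longrightarrow> card E' \<le> card E)"
proof (rule ex_has_greatest_nat[where b = "Suc (nat \<lceil>c\<rceil>)"])
  show "\<forall>E. P E \<longrightarrow> card E < Suc (nat \<lceil>c\<rceil>)"
  proof (intro allI impI)
    fix E assume "P E"
    from bound[OF this] show "card E < Suc (nat \<lceil>c\<rceil>)" by linarith
  qed
qed (rule P)

text \<open>Having trace at most \<open>1\<close>, the form behaves like a compact operator, so its
  supremum over the unit sphere of \<open>K\<close> is attained. A maximising sequence has a
  convergent subsequence: compactness handles the span of the finitely many large directions, the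
  defect form \<open>Q\<close> the rest.\<close>

lemma sup_eigenspace:
  assumes x0: "x0 \<in> K" "B x0 \<noteq> 0"
  shows "\<exists>s x. 0 < s \<and> (\<forall>y\<in>K. B y \<le> s * (norm y)\<^sup>2) \<and> x \<in> K \<and> norm x = 1 \<and> B x = s"
proof -
  define U where "U = {x \<in> K. norm x = 1}"
  define s where "s = (SUP x\<in>U. B x)"
  have x00: "x0 \<noteq> 0" using x0 B_scaleR[OF x0(1), of 0] by auto
  have nU: "(1 / norm x) *\<^sub>R x \<in> U" if "x \<in> K" "x \<noteq> 0" for x
    using that by (simp add: U_def K_scaleR)
  have "B x \<le> 1" if "x \<in> U" for x using B_le[of x] that by (simp add: U_def)
  then have bdd: "bdd_above (B ` U)" by (intro bdd_aboveI[of _ 1]) auto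
  have Bs: "B u \<le> s" if "u \<in> U" for u unfolding s_def by (rule cSUP_upper[OF that bdd])
  have le: "B y \<le> s * (norm y)\<^sup>2" if y: "y \<in> K" for y
  proof (cases "y = 0")
    case True
    then show ?thesis using B_scaleR[OF y, of 0] by simp
  next
    case False
    then show ?thesis using Bs[OF nU[OF y False]] by (simp add: B_scaleR[OF y] power_divide field_simps)
  qed
  have s: "0 < s"
  proof -
    have "0 < B x0" using B_nonneg[OF x0(1)] x0(2) by simp
    then have "0 < s * (norm x0)\<^sup>2" using le[OF x0(1)] by linarith
    then show ?thesis using x00 by (simp add: zero_less_mult_iff)
  qed
  have Une: "U \<noteq> {}" using nU[OF x0(1) x00] by auto
  have "\<exists>u\<in>U. s - inverse (real (Suc n)) < B u" for n
    using less_cSUP_iff[OF Une bdd, of "s - inverse (real (Suc n))"] unfolding s_def by simp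
  then obtain X where X: "\<And>n. X n \<in> U" "\<And>n. s - inverse (real (Suc n)) < B (X n)" by metis
  have XK: "X n \<in> K" and Xn: "norm (X n) = 1" for n using X(1)[of n] by (auto simp: U_def)
  \<comment> \<open>Nonnegative and subject to the parallelogram law, hence small at differences of
    nearly maximising vectors.\<close>
  define Q where "Q x = s * (norm x)\<^sup>2 - B x" for x
  have Q0: "0 \<le> Q x" if "x \<in> K" for x using le[OF that] by (simp add: Q_def)
  have Qpar: "Q (x + y) + Q (x - y) = 2 * Q x + 2 * Q y" if "x \<in> K" "y \<in> K" for x y
  proof -
    have "s * ((norm (x + y))\<^sup>2 + (norm (x - y))\<^sup>2) = s * (2 * (norm x)\<^sup>2 + 2 * (norm y)\<^sup>2)"
      by (simp only: parallelogram)
    then show ?thesis using B_parallelogram[OF that] by (simp add: Q_def algebra_simps)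
  qed
  have QX: "Q (X n) < inverse (real (Suc n))" for n using X(2)[of n] Xn[of n] by (simp add: Q_def)
  \<comment> \<open>The trace bound allows at most \<open>2 / s\<close> orthonormal vectors with
    \<open>B e \<ge> s / 2\<close>; orthogonally to a maximal family the form is at most half its
    supremum.\<close>
  define P where "P E \<longleftrightarrow> orthonormal E \<and> E \<subseteq> K \<and> (\<forall>e\<in>E. s / 2 \<le> B e)" for E
  have card: "real (card E) \<le> 2 / s" if "P E" for E
  proof -
    have "real (card E) * (s / 2) \<le> (\<Sum>e\<in>E. B e)" using that by (intro sum_bounded_below) (auto simp: P_def)
    also have "\<dots> \<le> 1" using that by (intro B_orthonormal) (auto simp: P_def)
    finally show ?thesis using s by (simp add: field_simps)
  qed
  have "\<exists>E. P E \<and> (\<forall>E'. P E' \<longrightarrow> card E' \<le> card E)"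
    by (rule maximal_orthonormal[OF _ card]) (simp_all add: P_def)
  then obtain E where "P E" "\<forall>E'. P E' \<longrightarrow> card E' \<le> card E"
    by (elim exE conjE)
  note E = this[rule_format]
  have on: "orthonormal E" and EK: "E \<subseteq> K" using E(1) by (auto simp: P_def)
  have pK: "onproj E x \<in> K" for x
    unfolding onproj_def using EK by (intro K_closed) auto
  have orth: "B u \<le> s / 2 * (norm u)\<^sup>2" if u: "u \<in> K" "\<And>e. e \<in> E \<Longrightarrow> cinner u e = 0" for u
  proof (rule ccontr)
    assume not: "\<not> ?thesis"
    then have u0: "u \<noteq> 0" using B_scaleR[OF u(1), of 0] by auto
    let ?u = "(1 / norm u) *\<^sub>R u"
    have "norm ?u = 1" "\<And>e. e \<in> E \<Longrightarrow> cinner ?u e = 0" using u0 u by (simp_all add: cinner_simps)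
    note ins = orthonormal_insert[OF on this]
    have "s / 2 \<le> B ?u" using not u0 by (simp add: B_scaleR[OF u(1)] power_divide field_simps)
    then have "P (insert ?u E)" using ins E(1) K_scaleR[OF u(1)] by (simp add: P_def)
    from E(2)[OF this] ins(2) orthonormalD(1)[OF on] show False by simp
  qed
  \<comment> \<open>\<open>B_add_le\<close> bounds \<open>B d\<close> by \<open>4 * s * (norm
    (onproj E d))\<^sup>2 + 2 / 3 * s * (norm d)\<^sup>2\<close>; the factor below \<open>1\<close>
    lets the last term be absorbed into \<open>s * (norm d)\<^sup>2 = Q d + B d\<close>.\<close>
  have key: "s * (norm d)\<^sup>2 \<le> 3 * Q d + 12 * s * (norm (onproj E d))\<^sup>2" if d: "d \<in> K" for d
  proof -
    let ?w = "onproj E d" let ?u = "d - ?w"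
    have uK: "?u \<in> K" using d pK K_closed by blast
    have "B d = B (?w + ?u)" by simp
    also have "\<dots> \<le> 4 * B ?w + 4 / 3 * B ?u" by (rule B_add_le[OF pK uK])
    also have "\<dots> \<le> 4 * (s * (norm ?w)\<^sup>2) + 4 / 3 * (s / 2 * (norm ?u)\<^sup>2)"
      by (intro add_mono mult_left_mono le pK orth uK cinner_diff_onproj[OF on]) auto
    also have "\<dots> \<le> 4 * (s * (norm ?w)\<^sup>2) + 4 / 3 * (s / 2 * (norm d)\<^sup>2)"
      using pythagoras_onproj[OF on, of d] s by (intro add_mono mult_left_mono) auto
    finally show ?thesis by (simp add: Q_def)
  qed
  have cpt: "compact {(\<Sum>e\<in>E. c e *\<^sub>C e) | c. \<forall>e\<in>E. cmod (c e) \<le> 1}"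
    by (rule compact_finite_combinations[OF orthonormalD(1)[OF on]])
  have "cmod (cinner (X n) e) \<le> 1" if "e \<in> E" for n e
    using cmod_cinner_le[of "X n" e] orthonormalD(2)[OF on that] Xn[of n] by simp
  then have c1: "\<forall>e\<in>E. cmod ((\<lambda>e. cinner (X n) e) e) \<le> 1" for n by simp
  have "onproj E (X n) \<in> {(\<Sum>e\<in>E. c e *\<^sub>C e) | c. \<forall>e\<in>E. cmod (c e) \<le> 1}" for n
    unfolding onproj_def by (rule CollectI) (rule exI, rule conjI, rule refl, rule c1)
  then have "\<forall>n. onproj E (X n) \<in> {(\<Sum>e\<in>E. c e *\<^sub>C e) | c. \<forall>e\<in>E. cmod (c e) \<le> 1}" by (rule allI)
  note sc = seq_compactE[where f = "\<lambda>n. onproj E (X n)", OF compact_imp_seq_compact[OF cpt] this]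
  obtain l r where "l \<in> {(\<Sum>e\<in>E. c e *\<^sub>C e) | c. \<forall>e\<in>E. cmod (c e) \<le> 1}"
    and r: "strict_mono r" "((\<lambda>n. onproj E (X n)) \<circ> r) \<longlonglongrightarrow> l"
    by (rule sc)
  have Cp: "Cauchy ((\<lambda>n. onproj E (X n)) \<circ> r)" by (rule LIMSEQ_imp_Cauchy[OF r(2)])
  have "Cauchy (X \<circ> r)"
  proof (rule metric_CauchyI)
    fix e :: real assume e: "0 < e"
    \<comment> \<open>With this bound on \<open>Q\<close> and projections within
      \<open>e / 5\<close>, each of the two terms of \<open>key\<close> is at most half of
      \<open>s * e\<^sup>2\<close>.\<close>
    have e2: "0 < s * e\<^sup>2 / 24" using e s by simp
    have "(\<lambda>n. inverse (real (Suc n))) \<longlonglongrightarrow> 0" by (rule LIMSEQ_inverse_real_of_nat)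
    from order_tendstoD(2)[OF this e2] obtain M1
      where M1: "\<And>n. n \<ge> M1 \<Longrightarrow> inverse (real (Suc n)) < s * e\<^sup>2 / 24" by (auto simp: eventually_sequentially)
    obtain M2 where M2: "\<And>m n. m \<ge> M2 \<Longrightarrow> n \<ge> M2 \<Longrightarrow> dist (onproj E (X (r m))) (onproj E (X (r n))) < e / 5"
      using metric_CauchyD[OF Cp, of "e / 5"] e by auto
    have "dist ((X \<circ> r) m) ((X \<circ> r) n) < e" if mn: "m \<ge> max M1 M2" "n \<ge> max M1 M2" for m n
    proof -
      let ?d = "X (r m) - X (r n)"
      have rm: "r m \<ge> M1" "r n \<ge> M1" 
        using mn seq_suble[OF r(1), of m] seq_suble[OF r(1), of n] by simp_all
      have "Q ?d \<le> 2 * Q (X (r m)) + 2 * Q (X (r n))"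
        using Qpar[OF XK XK, of "r m" "r n"] Q0[OF K_closed(2)[OF XK XK], of "r m" "r n"] by linarith
      also have "\<dots> < 4 * (s * e\<^sup>2 / 24)"
        using QX[of "r m"] QX[of "r n"] M1[OF rm(1)] M1[OF rm(2)] by linarith
      finally have q: "3 * Q ?d < s * e\<^sup>2 / 2" by simp
      have "norm (onproj E ?d) < e / 5" using M2[of m n] mn by (simp add: onproj_diff dist_norm)
      then have "(norm (onproj E ?d))\<^sup>2 \<le> (e / 5)\<^sup>2" by (intro power_mono) auto
      then have "12 * s * (norm (onproj E ?d))\<^sup>2 \<le> 12 * s * (e / 5)\<^sup>2" using s by (intro mult_left_mono) auto
      also have "\<dots> \<le> s * e\<^sup>2 / 2" using s by (simp add: power_divide)
      finally have "s * (norm ?d)\<^sup>2 < s * e\<^sup>2"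
        using key[OF K_closed(3)[OF XK XK], of "r m" "r n"] q by linarith
      then have "(norm ?d)\<^sup>2 < e\<^sup>2" using s by simp
      then show ?thesis using e by (simp add: dist_norm power_less_imp_less_base)
    qed
    then show "\<exists>M. \<forall>m\<ge>M. \<forall>n\<ge>M. dist ((X \<circ> r) m) ((X \<circ> r) n) < e" by blast
  qed
  then obtain x where x: "(X \<circ> r) \<longlonglongrightarrow> x" using Cauchy_convergent_iff convergent_def by blast
  have xK: "x \<in> K" using closed_sequentially[OF closed_K _ x] XK by simp
  have "(\<lambda>n. norm ((X \<circ> r) n)) \<longlonglongrightarrow> norm x" by (rule tendsto_norm[OF x])
  then have xn: "norm x = 1" using Xn by (simp add: LIMSEQ_const_iff)
  \<comment> \<open>The parallelogram law replaces continuity of \<open>Q\<close>; the right side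
    tends to \<open>0\<close>.\<close>
  have Qle: "Q x \<le> 2 * inverse (real (Suc (r n))) + 2 * s * (norm ((X \<circ> r) n - x))\<^sup>2" for n
  proof -
    let ?y = "X (r n)"
    have dK: "x - ?y \<in> K" using K_closed(3)[OF xK XK] .
    have "Q x = Q (?y + (x - ?y))" by simp
    also have "\<dots> \<le> 2 * Q ?y + 2 * Q (x - ?y)"
      using Qpar[OF XK dK, of "r n"] Q0[OF K_closed(3)[OF XK dK], of "r n"] by linarith
    also have "Q (x - ?y) \<le> s * (norm (x - ?y))\<^sup>2" using B_nonneg[OF dK] by (simp add: Q_def)
    finally show ?thesis using QX[of "r n"] by (simp add: norm_minus_commute)
  qed
  have lim: "(\<lambda>n. 2 * inverse (real (Suc (r n))) + 2 * s * (norm ((X \<circ> r) n - x))\<^sup>2) \<longlonglongrightarrow> 2 * 0 + 2 * s * (norm (x - x))\<^sup>2"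
    using LIMSEQ_subseq_LIMSEQ[OF LIMSEQ_inverse_real_of_nat r(1)]
    by (intro tendsto_intros x) (simp add: comp_def)
  have "Q x \<le> 2 * 0 + 2 * s * (norm (x - x))\<^sup>2"
    by (rule LIMSEQ_le_const[OF lim]) (intro exI allI impI, rule Qle)
  then have "B x = s" using Q0[OF xK] xn by (simp add: Q_def)
  then show ?thesis using s le xK xn by (intro exI[of _ s] exI[of _ x]) simp
qed

text \<open>The vectors where \<open>B\<close> attains its supremum form a subspace, as the
  parallelogram laws for \<open>B\<close> and for the norm force equality at \<open>y + z\<close>
  and \<open>y - z\<close>. It is invariant because \<open>B\<close> is, and finite-dimensional
  because each orthonormal vector in it contributes \<open>s\<close> to a trace of at most
  \<open>1\<close>.\<close>

theorem invariant_frame_of_nonvanishing: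
  assumes x0: "x0 \<in> K" "B x0 \<noteq> 0"
  obtains E where "invariant_frame E" "E \<subseteq> K" "E \<noteq> {}"
proof -
  obtain s x where s0: "0 < s" "\<forall>y\<in>K. B y \<le> s * (norm y)\<^sup>2" and x: "x \<in> K" "norm x = 1" "B x = s"
    using sup_eigenspace[OF x0] by (elim exE conjE)
  note s = s0[rule_format]
  define N where "N = {y \<in> K. B y = s * (norm y)\<^sup>2}"
  have NK: "N \<subseteq> K" by (auto simp: N_def)
  have sub: "cvec.subspace N"
  proof (rule cvec.subspaceI)
    show "0 \<in> N" using B_scaleR[of 0 0] K_closed(1) by (simp add: N_def)
    show "c *\<^sub>C y \<in> N" if "y \<in> N" for c y
      using that by (auto simp: N_def B_scaleC K_closed norm_scaleC power_mult_distrib)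
    show "y + z \<in> N" if yz: "y \<in> N" "z \<in> N" for y z
    proof -
      have yzK: "y \<in> K" "z \<in> K" using yz NK by auto
      note K = yzK K_closed(2)[OF yzK] K_closed(3)[OF yzK]
      have "s * ((norm (y + z))\<^sup>2 + (norm (y - z))\<^sup>2) = s * (2 * (norm y)\<^sup>2 + 2 * (norm z)\<^sup>2)"
        by (simp only: parallelogram)
      then have "B (y + z) + B (y - z) = s * (norm (y + z))\<^sup>2 + s * (norm (y - z))\<^sup>2"
        using B_parallelogram[OF K(1,2)] yz by (simp add: N_def algebra_simps)
      then have "B (y + z) = s * (norm (y + z))\<^sup>2" using s(2)[OF K(3)] s(2)[OF K(4)] by linarith
      then show ?thesis using K(3) by (simp add: N_def)
    qed
  qed
  define P where "P E \<longleftrightarrow> orthonormal E \<and> E \<subseteq> N" for E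
  have card: "real (card E) \<le> 1 / s" if "P E" for E
  proof -
    have "real (card E) * s = (\<Sum>e\<in>E. B e)"
      using that orthonormalD(2)[of E] by (simp add: P_def N_def subset_iff)
    also have "\<dots> \<le> 1" using that NK by (intro B_orthonormal) (auto simp: P_def)
    finally show ?thesis using s(1) by (simp add: field_simps)
  qed
  have "\<exists>E. P E \<and> (\<forall>E'. P E' \<longrightarrow> card E' \<le> card E)"
    by (rule maximal_orthonormal[OF _ card]) (simp_all add: P_def)
  then obtain E where "P E" "\<forall>E'. P E' \<longrightarrow> card E' \<le> card E"
    by (elim exE conjE)
  note E = this[rule_format]
  have on: "orthonormal E" and EN: "E \<subseteq> N" using E(1) by (auto simp: P_def)
  have span: "y \<in> cvec.span E" if y: "y \<in> N" for y
  proof (rule ccontr)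
    assume "y \<notin> cvec.span E"
    then have ne: "y \<noteq> onproj E y" using onproj_in_span[of E y] by auto
    let ?u = "(1 / norm (y - onproj E y)) *\<^sub>R (y - onproj E y)"
    have "onproj E y \<in> N" using onproj_in_span[of E y] cvec.span_minimal[OF EN sub] by blast
    then have "?u \<in> N" unfolding scaleR_scaleC using sub y by (intro cvec.subspace_scale cvec.subspace_diff)
    then have "P (insert ?u E)" using orthonormal_extend(1)[OF on ne] EN by (simp add: P_def)
    from E(2)[OF this] orthonormal_extend(2)[OF on ne] orthonormalD(1)[OF on] show False by simp
  qed
  have "x \<in> N" using x by (simp add: N_def)
  then have "x \<in> cvec.span E" by (rule span)
  then have "E \<noteq> {}" using x(2) by auto
  moreover have "\<pi> g e \<in> N" if "g \<in> carrier G" "e \<in> N" for g e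
    using that by (simp add: N_def B_pi K_inv)
  then have "invariant_frame E" using on EN span by (auto simp: invariant_frame_def)
  ultimately show ?thesis using that EN NK by blast
qed

end

section \<open>Almost invariant states from a state that vanishes on finite rank operators\<close>

lemma flat_states_orthonormal:
  fixes D :: "'h::complex_hilbert set"
  assumes D: "orthonormal D" "D \<subseteq> K" and K: "cvec.subspace K"
    and r: "0 < r" "1 / r \<le> real (card D)"
  obtains ds where "distinct ds" "set ds = D"
    "map ((*\<^sub>R) (1 / sqrt (real (card D)))) ds \<in> flat_states K r"
proof -
  note fin = orthonormalD(1)[OF D(1)]
  obtain ds where ds: "distinct ds" "set ds = D" using finite_distinct_list[OF fin] by auto
  let ?n = "real (card D)"
  have n: "0 < ?n" using r by (smt (verit) divide_pos_pos)
  \<comment> \<open>The normalised projection onto the span of \<open>D\<close> has trace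
    \<open>1\<close> and operator norm \<open>1 / ?n\<close>.\<close>
  have inv: "1 / ?n \<le> r" using r n by (simp add: field_simps)
  have "nsq ds = ?n"
    using ds orthonormalD(2)[OF D(1)] by (simp add: nsq_def sum_list_distinct_conv_sum_set)
  moreover have "qf ds e \<le> (norm e)\<^sup>2" for e
    using bessel[OF D(1), of e] ds
    by (simp add: qf_def sum_list_distinct_conv_sum_set cmod_cinner_commute[of e])
  then have "(1 / ?n) * qf ds e \<le> r * (norm e)\<^sup>2" for e
    using inv r by (intro mult_mono) auto
  moreover have "c *\<^sub>R k \<in> K" if "k \<in> D" for c k
    using cvec.subspace_scale[OF K, of k] that D(2) by (auto simp: scaleR_scaleC)
  ultimately have "map ((*\<^sub>R) (1 / sqrt ?n)) ds \<in> flat_states K r"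
    using n ds by (auto simp: flat_states_def power_divide)
  then show ?thesis using that ds by blast
qed

context unitary_representation
begin

lemma onproj_sum: "onproj E (\<Sum>i\<in>I. f i) = (\<Sum>i\<in>I. onproj E (f i))"
  by (induction I rule: infinite_finite_induct) (simp_all add: onproj_add onproj_def[of _ 0] cinner_simps)

lemma cinner_ortho_onproj: "z \<in> ortho E \<Longrightarrow> cinner (onproj E y) z = 0"
  using cinner_orthonormal_span[OF onproj_in_span, of E z y] cinner_zero_commute[of "onproj E y" z]
  by (simp add: ortho_def)

end

context invariant_state
begin

text \<open>Otherwise separation gives contractions whose summed displacement \<open>S\<close> pairs
  to at least \<open>\<delta>\<close> with every flat state, so \<open>S\<close> is at least
  \<open>\<delta>\<close> on \<open>K\<close> off a finite-dimensional subspace. A state that kills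
  finite rank operators must then give the compression of \<open>S\<close> at least
  \<open>\<delta> / 2\<close>, while invariance gives \<open>0\<close>.\<close>

theorem vanishing_state_almost_invariant:
  assumes E: "invariant_frame E" and KE: "K = ortho E" and van: "\<And>x. x \<in> K \<Longrightarrow> B x = 0"
    and F: "finite F" "F \<subseteq> carrier G" and r: "0 < r" and \<delta>: "0 < \<delta>"
    and inf: "\<And>n. \<exists>D. orthonormal D \<and> D \<subseteq> K \<and> n \<le> card D"
  shows "\<exists>vs\<in>flat_states K r. almost_invariant \<pi> F \<delta> vs"
proof (rule ccontr)
  assume "\<not> ?thesis"
  then have not: "\<not> almost_invariant \<pi> F \<delta> vs" if "vs \<in> flat_states K r" for vs using that by blast
  have gF: "g \<in> carrier G" if "g \<in> F" for g using F that by auto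
  have on: "orthonormal E" using E by (simp add: invariant_frame_def)
  have ne: "flat_states K r \<noteq> {}"
  proof -
    obtain D where D: "orthonormal D" "D \<subseteq> K" "nat \<lceil>1 / r\<rceil> \<le> card D" using inf by blast
    then have "1 / r \<le> real (card D)" by linarith
    then show ?thesis using flat_states_orthonormal[OF D(1,2) subspace_K r] by (metis empty_iff)
  qed
  have "\<exists>T. (\<forall>g\<in>F. hermitian_contraction (T g)) \<and> (\<forall>vs\<in>flat_states K r.
      \<delta> \<le> (\<Sum>v\<leftarrow>vs. \<Sum>g\<in>F. rin (T g (\<pi> g v)) (\<pi> g v) - rin (T g v) v))"
    using almost_invariant_or_operators[OF F(1) pi_linear[OF gF] subspace_K ne not] by simp
  then obtain T where "\<forall>g\<in>F. hermitian_contraction (T g)" "\<forall>vs\<in>flat_states K r.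
      \<delta> \<le> (\<Sum>v\<leftarrow>vs. \<Sum>g\<in>F. rin (T g (\<pi> g v)) (\<pi> g v) - rin (T g v) v)"
    by (elim exE conjE)
  note T = this[rule_format]
  have Tadd: "T g (x + y) = T g x + T g y" and Tsc: "T g (c *\<^sub>C x) = c *\<^sub>C T g x"
    and Tn: "norm (T g x) \<le> norm x" and Th: "cinner (T g x) y = cinner x (T g y)" if "g \<in> F" for g x y c
    using T(1)[OF that] by (auto simp: hermitian_contraction_def)
  \<comment> \<open>\<open>T g\<close> conjugated so that its pairing with \<open>\<pi> g v\<close>
    becomes a pairing with \<open>v\<close>.\<close>
  define W where "W g z = \<pi> (inv g) (T g (\<pi> g z))" for g z
  have Wadd: "W g (x + y) = W g x + W g y" and Wsc: "W g (c *\<^sub>C x) = c *\<^sub>C W g x"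
    and Wn: "norm (W g x) \<le> norm x" and Wc: "cinner (W g x) y = cinner (T g (\<pi> g x)) (\<pi> g y)"
    if "g \<in> F" for g x y c
  proof -
    note g = gF[OF that]
    show "W g (x + y) = W g x + W g y" "W g (c *\<^sub>C x) = c *\<^sub>C W g x"
      by (simp_all add: W_def pi_add pi_scaleC g Tadd[OF that] Tsc[OF that])
    show "norm (W g x) \<le> norm x" using Tn[OF that, of "\<pi> g x"] by (simp add: W_def g)
    show "cinner (W g x) y = cinner (T g (\<pi> g x)) (\<pi> g y)"
      using pi_cinner_left[OF inv_closed[OF g]] g by (simp add: W_def)
  qed
  have Wh: "cinner (W g x) y = cinner x (W g y)" if "g \<in> F" for g x y
  proof -
    have "cinner x (W g y) = cnj (cinner (W g y) x)" by (rule cinner_commute)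
    also have "\<dots> = cnj (cinner (T g (\<pi> g y)) (\<pi> g x))" by (simp only: Wc[OF that])
    also have "\<dots> = cinner (\<pi> g x) (T g (\<pi> g y))" by (rule cinner_commute[symmetric])
    finally show ?thesis by (simp only: Wc[OF that] Th[OF that])
  qed
  define S where "S z = (\<Sum>g\<in>F. W g z - T g z)" for z
  define L where "L = 2 * real (card F)"
  have L0: "0 \<le> L" by (simp add: L_def)
  have Sadd: "S (x + y) = S x + S y" for x y
    unfolding S_def sum.distrib[symmetric] by (intro sum.cong refl) (simp add: Wadd Tadd)
  have Ssc: "S (c *\<^sub>C x) = c *\<^sub>C S x" for c x
    unfolding S_def cvec.scale_sum_right by (intro sum.cong refl) (simp add: Wsc Tsc scaleC.diff_right)
  have Sn: "norm (S x) \<le> L * norm x" for x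
  proof -
    have "norm (S x) \<le> (\<Sum>g\<in>F. norm (W g x - T g x))" unfolding S_def by (rule norm_sum)
    also have "\<dots> \<le> (\<Sum>g\<in>F. 2 * norm x)"
    proof (intro sum_mono)
      fix g assume g: "g \<in> F"
      show "norm (W g x - T g x) \<le> 2 * norm x"
        using norm_triangle_ineq4[of "W g x" "T g x"] Wn[OF g, of x] Tn[OF g, of x] by linarith
    qed
    finally show ?thesis by (simp add: L_def)
  qed
  have Sh: "cinner (S x) y = cinner x (S y)" for x y
    unfolding S_def cinner.sum_left cinner.sum_right
    by (intro sum.cong refl) (simp add: cinner.diff_left cinner.diff_right Wh Th)
  have Sr: "rin (S v) v = (\<Sum>g\<in>F. rin (T g (\<pi> g v)) (\<pi> g v) - rin (T g v) v)" for v
    unfolding S_def cinner.sum_left Re_sum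
    by (intro sum.cong refl) (simp add: cinner.diff_left Wc)
  have Sflat: "\<delta> \<le> (\<Sum>v\<leftarrow>vs. rin (S v) v)" if "vs \<in> flat_states K r" for vs
    using T(2)[OF that] by (simp only: Sr)
  \<comment> \<open>The state knows only operators on \<open>K\<close>, so operators are compressed
    by the projection onto \<open>K\<close>; invariance of the frame makes compression commute with
    conjugation.\<close>
  define cmp where "cmp V = restrict_op K (\<lambda>z. V z - onproj E (V z))" for V
  have cmp_bdd: "cmp V \<in> bounded_ops K"
    if V: "\<And>x y. V (x + y) = V x + V y" "\<And>c x. V (c *\<^sub>C x) = c *\<^sub>C V x" "\<And>x. norm (V x) \<le> c * norm x" for V c
    unfolding cmp_def
  proof (rule restrict_in_bounded_ops)
    show "V x - onproj E (V x) \<in> K" for x unfolding KE by (rule diff_onproj_in_ortho[OF on])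
    show "norm (V x - onproj E (V x)) \<le> c * norm x" for x
    proof -
      have "(norm (V x - onproj E (V x)))\<^sup>2 \<le> (norm (V x))\<^sup>2" using pythagoras_onproj[OF on, of "V x"] by simp
      then have "norm (V x - onproj E (V x)) \<le> norm (V x)" by (rule power2_le_imp_le) simp
      then show ?thesis using V(3)[of x] by simp
    qed
  qed (simp_all add: V onproj_add onproj_scaleC scaleC.diff_right)
  have cT: "cmp (T g) \<in> bounded_ops K" if "g \<in> F" for g
    by (rule cmp_bdd[where c = 1]) (simp_all add: Tadd[OF that] Tsc[OF that] Tn[OF that])
  have cW: "cmp (W g) \<in> bounded_ops K" if "g \<in> F" for g
    by (rule cmp_bdd[where c = 1]) (simp_all add: Wadd[OF that] Wsc[OF that] Wn[OF that])
  have cS: "cmp S \<in> bounded_ops K"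
    by (rule cmp_bdd[where c = L]) (simp_all add: Sadd Ssc Sn)
  have phiW: "\<phi> (cmp (W g)) = \<phi> (cmp (T g))" if "g \<in> F" for g
  proof -
    note g = gF[OF that]
    have "cmp (W g) = subrep \<pi> K (inv g) \<circ> cmp (T g) \<circ> subrep \<pi> K (inv (inv g))"
    proof
      fix z
      show "cmp (W g) z = (subrep \<pi> K (inv g) \<circ> cmp (T g) \<circ> subrep \<pi> K (inv (inv g))) z"
      proof (cases "z \<in> K")
        case True
        have "T g (\<pi> g z) - onproj E (T g (\<pi> g z)) \<in> K" unfolding KE by (rule diff_onproj_in_ortho[OF on])
        then show ?thesis using True g K_inv[OF g True]
          by (simp add: subrep_def cmp_def restrict_op_def W_def pi_diff invariant_frame_onproj[OF E])
      next
        case False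
        have "T g (0 *\<^sub>C 0) = 0 *\<^sub>C T g 0" by (rule Tsc[OF that])
        then have "T g 0 = 0" by simp
        then show ?thesis using False g K_closed(1)
          by (simp add: subrep_def cmp_def restrict_op_def onproj_def cinner_simps)
      qed
    qed
    then show ?thesis using inv_state[OF inv_closed[OF g] cT[OF that]] by simp
  qed
  have m1: "(-1) *\<^sub>C x = - x" for x :: 'h by (metis cvec.scale_minus_left cvec.scale_one)
  have phiS: "\<phi> (cmp S) = 0"
  proof -
    have b: "(\<lambda>z. cmp (W g) z + (-1) *\<^sub>C cmp (T g) z) \<in> bounded_ops K" if "g \<in> F" for g
      by (intro bounded_ops_add bounded_ops_scale cW cT that)
    have "cmp S = (\<lambda>z. \<Sum>g\<in>F. cmp (W g) z + (-1) *\<^sub>C cmp (T g) z)"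
    proof
      fix z
      show "cmp S z = (\<Sum>g\<in>F. cmp (W g) z + (-1) *\<^sub>C cmp (T g) z)"
      proof (cases "z \<in> K")
        case True
        then show ?thesis
          unfolding m1
          by (simp add: cmp_def restrict_op_def S_def onproj_sum onproj_diff sum_subtractf sum.distrib)
      qed (simp add: cmp_def restrict_op_def)
    qed
    then have "\<phi> (cmp S) = (\<Sum>g\<in>F. \<phi> (\<lambda>z. cmp (W g) z + (-1) *\<^sub>C cmp (T g) z))"
      by (simp only: phi_sum(2)[where T = "\<lambda>g z. cmp (W g) z + (-1) *\<^sub>C cmp (T g) z", OF b])
    also have "\<dots> = (\<Sum>g\<in>F. \<phi> (cmp (W g)) + (-1) * \<phi> (cmp (T g)))"
      by (intro sum.cong refl) (simp only: phi_add[OF cW bounded_ops_scale[OF cT]] phi_scale[OF cT])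
    also have "\<dots> = 0" by (intro sum.neutral ballI) (simp add: phiW)
    finally show ?thesis .
  qed
  \<comment> \<open>More than \<open>1 / r\<close> such vectors would give a flat state that pairs
    with \<open>S\<close> to less than \<open>\<delta>\<close>.\<close>
  define P where "P D \<longleftrightarrow> orthonormal D \<and> D \<subseteq> K \<and> (\<forall>d\<in>D. rin (S d) d < \<delta>)" for D
  have S_R: "rin (S (c *\<^sub>R x)) (c *\<^sub>R x) = c\<^sup>2 * rin (S x) x" for c x
    by (simp add: scaleR_scaleC Ssc cinner_scaleC_left cinner_scaleC_right power2_eq_square)
  have card: "real (card D) \<le> 1 / r" if "P D" for D
  proof (rule ccontr)
    assume "\<not> ?thesis"
    then have gt: "1 / r \<le> real (card D)" by simp
    have D: "orthonormal D" "D \<subseteq> K" and lt: "\<And>d. d \<in> D \<Longrightarrow> rin (S d) d < \<delta>" using that by (auto simp: P_def)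
    let ?n = "real (card D)"
    obtain ds where ds: "distinct ds" "set ds = D" and fl: "map ((*\<^sub>R) (1 / sqrt ?n)) ds \<in> flat_states K r"
      by (rule flat_states_orthonormal[OF D subspace_K r gt])
    have "0 < 1 / r" using r by simp
    then have n: "0 < ?n" using gt by linarith
    have "\<delta> \<le> (\<Sum>v\<leftarrow>ds. (1 / ?n) * rin (S v) v)"
      using Sflat[OF fl] n by (simp add: comp_def S_R power_divide)
    also have "\<dots> = (1 / ?n) * (\<Sum>d\<in>D. rin (S d) d)"
      using ds by (simp add: sum_list_distinct_conv_sum_set sum_distrib_left)
    also have "\<dots> < (1 / ?n) * (\<Sum>d\<in>D. \<delta>)"
      using n orthonormalD(1)[OF D(1)] lt by (intro mult_strict_left_mono sum_strict_mono) auto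
    also have "\<dots> = \<delta>" using n by simp
    finally show False by simp
  qed
  have "\<exists>D. P D \<and> (\<forall>D'. P D' \<longrightarrow> card D' \<le> card D)"
    by (rule maximal_orthonormal[OF _ card]) (simp_all add: P_def)
  then obtain D where PD: "P D" "\<forall>D'. P D' \<longrightarrow> card D' \<le> card D"
    by (elim exE conjE)
  have D: "orthonormal D" "D \<subseteq> K" using PD(1) by (auto simp: P_def)
  have orth: "\<delta> * (norm u)\<^sup>2 \<le> rin (S u) u" if u: "u \<in> K" "\<And>d. d \<in> D \<Longrightarrow> cinner u d = 0" for u
  proof (rule ccontr)
    assume not: "\<not> ?thesis"
    then have u0: "u \<noteq> 0" by (auto simp: cinner_simps)
    let ?u = "(1 / norm u) *\<^sub>R u"
    have "norm ?u = 1" "\<And>d. d \<in> D \<Longrightarrow> cinner ?u d = 0" using u0 u by (simp_all add: cinner_simps)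
    note ins = orthonormal_insert[OF D(1) this]
    have "rin (S ?u) ?u < \<delta>" unfolding S_R using not u0 by (simp add: power_divide field_simps)
    then have "P (insert ?u D)" using ins PD(1) K_scaleR[OF u(1)] by (simp add: P_def)
    with PD(2) have "card (insert ?u D) \<le> card D" by blast
    then show False using ins(2) orthonormalD(1)[OF D(1)] by simp
  qed
  \<comment> \<open>Adding \<open>c\<close> times the projection onto the span of \<open>D\<close>
    makes the compression of \<open>S\<close> at least \<open>\<delta> / 2\<close>: \<open>L\<close>
    pays for the block on that span, \<open>2 * L\<^sup>2 / \<delta>\<close> for the cross terms,
    and \<open>\<delta> / 2\<close> for the subtracted multiple of the identity.\<close>
  define c where "c = L + 2 * L\<^sup>2 / \<delta> + \<delta> / 2"
  let ?R = "\<lambda>z. \<Sum>d\<in>D. rank1 d d z"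
  let ?I = "restrict_op K id"
  let ?M = "\<lambda>z. cmp S z + (of_real c *\<^sub>C ?R z + of_real (- (\<delta> / 2)) *\<^sub>C ?I z)"
  have r1: "rank1 d d \<in> bounded_ops K" if "d \<in> D" for d using D(2) that by (auto intro: rank1_bounded)
  have bR: "?R \<in> bounded_ops K" by (rule phi_sum(1)[OF r1])
  have bI: "?I \<in> bounded_ops K" by (rule restrict_in_bounded_ops[where B = 1]) auto
  have bM: "?M \<in> bounded_ops K" by (intro bounded_ops_add bounded_ops_scale bI bR cS)
  have "positive_op K ?M"
    unfolding positive_op_def
  proof (intro conjI bM ballI)
    fix z assume z: "z \<in> K"
    define w where "w = onproj D z"
    define u where "u = z - w"
    have wK: "w \<in> K" unfolding w_def onproj_def using D(2) by (intro K_closed) auto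
    have uK: "u \<in> K" unfolding u_def using z wK by (rule K_closed)
    have ud: "cinner u d = 0" if "d \<in> D" for d unfolding u_def w_def by (rule cinner_diff_onproj[OF D(1) that])
    have uw: "cinner u w = 0" using cinner_orthonormal_span[OF onproj_in_span[of D z], of u] ud by (simp add: w_def)
    have zw: "z = u + w" by (simp add: u_def)
    have n2: "(norm z)\<^sup>2 = (norm u)\<^sup>2 + (norm w)\<^sup>2"
      unfolding zw norm_add_sq by (simp add: uw)
    have "?M z = (S z - onproj E (S z)) + (of_real c *\<^sub>C w + of_real (- (\<delta> / 2)) *\<^sub>C z)"
      using z by (simp add: cmp_def restrict_op_def rank1_def w_def onproj_def)
    moreover have "cinner w z = of_real ((norm w)\<^sup>2)"
      unfolding zw cinner_add_right using uw cinner_zero_commute[of u w] by (simp only: cinner_self) simp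
    moreover have "cinner (onproj E (S z)) z = 0" using z unfolding KE by (rule cinner_ortho_onproj)
    moreover have "cinner (S z) z = of_real (rin (S z) z)"
    proof -
      have "cinner (S z) z = cnj (cinner (S z) z)" using Sh[of z z] cinner_commute[of "S z" z] by simp
      then have "Im (cinner (S z) z) = 0" by (metis Reals_cnj_iff complex_is_Real_iff)
      then show ?thesis by (simp add: complex_eq_iff)
    qed
    ultimately have "cinner (?M z) z = of_real (rin (S z) z) + of_real c * of_real ((norm w)\<^sup>2)
        + of_real (- (\<delta> / 2)) * of_real ((norm z)\<^sup>2)"
      by (simp only: cinner_add_left cinner.diff_left cinner_scaleC_left cinner_self) simp
    also have "\<dots> = of_real (rin (S z) z + c * (norm w)\<^sup>2 + - (\<delta> / 2) * (norm z)\<^sup>2)"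
      by (simp only: of_real_add of_real_mult)
    also have "\<dots> \<in> \<real>\<^sub>\<ge>\<^sub>0"
    proof -
      have e: "rin (S z) z = rin (S u) u + 2 * rin (S u) w + rin (S w) w"
      proof -
        have "rin (S w) u = rin (S u) w" using Sh[of w u] Re_cinner_commute[of w "S u"] by simp
        then show ?thesis unfolding zw Sadd by (simp add: cinner_simps)
      qed
      have cs: "- (L * norm x * norm y) \<le> rin (S x) y" for x y
      proof -
        have "- rin (S x) y \<le> norm (S x) * norm y" using Re_cinner_le[of "- S x" y] by (simp add: cinner_simps)
        also have "\<dots> \<le> (L * norm x) * norm y" by (intro mult_right_mono Sn) simp
        finally show ?thesis by simp
      qed
      \<comment> \<open>Of the available \<open>\<delta> * (norm u)\<^sup>2\<close>, one half
        absorbs the cross terms.\<close>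
      have am: "2 * (L * norm u * norm w) \<le> \<delta> / 2 * (norm u)\<^sup>2 + 2 * L\<^sup>2 / \<delta> * (norm w)\<^sup>2"
      proof -
        have "0 \<le> (\<delta> * norm u - 2 * L * norm w)\<^sup>2 / (2 * \<delta>)" using \<delta> by simp
        also have "\<dots> = \<delta> / 2 * (norm u)\<^sup>2 + 2 * L\<^sup>2 / \<delta> * (norm w)\<^sup>2 - 2 * (L * norm u * norm w)"
          using \<delta> by (simp add: power2_eq_square field_simps)
        finally show ?thesis by simp
      qed
      define X Y Z U V where "X = \<delta> / 2 * (norm u)\<^sup>2" "Y = 2 * L\<^sup>2 / \<delta> * (norm w)\<^sup>2"
        "Z = \<delta> / 2 * (norm w)\<^sup>2" "U = L * norm u * norm w" "V = L * (norm w)\<^sup>2"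
      note XYZ = this
      have "2 * X \<le> rin (S u) u" using orth[OF uK ud] by (simp add: XYZ)
      moreover have "- U \<le> rin (S u) w" using cs[of u w] by (simp add: XYZ)
      moreover have "- V \<le> rin (S w) w" using cs[of w w] by (simp add: XYZ power2_eq_square mult.assoc)
      moreover have "c * (norm w)\<^sup>2 = V + Y + Z" by (simp add: c_def distrib_right XYZ)
      moreover have "- (\<delta> / 2) * (norm z)\<^sup>2 = - X - Z"
        unfolding n2 XYZ by (simp only: distrib_left mult_minus_left)
      moreover have "2 * U \<le> X + Y" using am by (simp only: XYZ)
      ultimately have "0 \<le> rin (S z) z + c * (norm w)\<^sup>2 + - (\<delta> / 2) * (norm z)\<^sup>2"
        unfolding e by linarith
      then show ?thesis by (simp only: nonneg_Reals_of_real_iff)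
    qed
    finally show "cinner (?M z) z \<in> \<real>\<^sub>\<ge>\<^sub>0" .
  qed
  note M = this
  have ps: "\<phi> ?R = (\<Sum>d\<in>D. \<phi> (rank1 d d))" by (rule phi_sum(2)[OF r1])
  from phi_pos[OF M] have "0 \<le> Re (of_real c * (\<Sum>d\<in>D. \<phi> (rank1 d d)) + of_real (- (\<delta> / 2)))"
    unfolding phi_add[OF cS bounded_ops_add[OF bounded_ops_scale[OF bR] bounded_ops_scale[OF bI]]]
      phi_add[OF bounded_ops_scale[OF bR] bounded_ops_scale[OF bI]] phi_scale[OF bR] phi_scale[OF bI]
      phi_one phiS ps by simp
  moreover have "(\<Sum>d\<in>D. Re (\<phi> (rank1 d d))) = 0"
    using van D(2) by (intro sum.neutral) (auto simp: B_def)
  ultimately show False using \<delta> by simp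
qed

end

section \<open>Enlarging invariant frames, and the existence of almost invariant flat states\<close>

context unitary_representation
begin

lemma large_orthonormal:
  assumes inf: "\<not> finite_cdim (UNIV :: 'h set)" and E: "orthonormal E"
  shows "\<exists>D. orthonormal D \<and> D \<subseteq> ortho E \<and> n \<le> card D"
proof (induction n)
  case 0
  then show ?case by (intro exI[of _ "{}"]) simp
next
  case (Suc n)
  then obtain D where D: "orthonormal D" "D \<subseteq> ortho E" "n \<le> card D" by blast
  have un: "orthonormal (E \<union> D)"
  proof -
    have "cinner d e = 0" "cinner e d = 0" if "d \<in> D" "e \<in> E" for d e
      using D(2) that cinner_zero_commute[of d e] by (auto simp: ortho_def)
    moreover have "d \<notin> E" if "d \<in> D" for d
      using calculation(1)[OF that, of d] orthonormalD(4)[OF D(1) that] by auto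
    ultimately show ?thesis using E D(1) unfolding orthonormal_def by (auto 4 4)
  qed
  have "cvec.span (E \<union> D) \<noteq> UNIV"
    using inf orthonormalD(1)[OF un] unfolding finite_cdim_def by (metis order_refl)
  then obtain y where "y \<notin> cvec.span (E \<union> D)" by blast
  then have ne: "y \<noteq> onproj (E \<union> D) y" using onproj_in_span[of "E \<union> D" y] by auto
  note u = orthonormal_extend[OF un ne]
  let ?u = "(1 / norm (y - onproj (E \<union> D) y)) *\<^sub>R (y - onproj (E \<union> D) y)"
  have "cinner ?u e = 0" if "e \<in> E \<union> D" for e
    using cinner_diff_onproj[OF un that, of y] unfolding cinner_scaleR_left by simp
  then have "orthonormal (insert ?u D)" "?u \<notin> D" "?u \<in> ortho E"
    using orthonormal_insert[OF D(1) u(3)] by (auto simp: ortho_def)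
  then show ?case using D orthonormalD(1)[OF D(1)] by (intro exI[of _ "insert ?u D"]) auto
qed

lemma invariant_frame_union:
  assumes E: "invariant_frame E" and E': "invariant_frame E'" "E' \<subseteq> ortho E" "E' \<noteq> {}"
  shows "invariant_frame (E \<union> E')" "card E < card (E \<union> E')"
proof -
  have on: "orthonormal E" "orthonormal E'" using E E' by (auto simp: invariant_frame_def)
  have z: "cinner d e = 0" "cinner e d = 0" if "d \<in> E'" "e \<in> E" for d e
    using E'(2) that cinner_zero_commute[of d e] by (auto simp: ortho_def)
  have nin: "d \<notin> E" if "d \<in> E'" for d
    using z(1)[OF that, of d] orthonormalD(4)[OF on(2) that] by auto
  have "orthonormal (E \<union> E')" using on z nin unfolding orthonormal_def by (auto 4 4)
  moreover have "cvec.span E \<subseteq> cvec.span (E \<union> E')" "cvec.span E' \<subseteq> cvec.span (E \<union> E')"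
    by (auto intro!: cvec.span_mono)
  ultimately show "invariant_frame (E \<union> E')"
    using E E'(1) by (auto simp: invariant_frame_def)
  have "E \<subset> E \<union> E'" using nin E'(3) by auto
  then show "card E < card (E \<union> E')"
    using orthonormalD(1)[OF on(1)] orthonormalD(1)[OF on(2)] by (intro psubset_card_mono) auto
qed

lemma flat_states_mono: "K \<subseteq> K' \<Longrightarrow> flat_states K r \<subseteq> flat_states K' r"
  by (auto simp: flat_states_def)

text \<open>If no flat state is almost invariant, the state on the complement of any invariant frame
  cannot vanish on finite rank operators and enlarges the frame. A frame of at least
  \<open>1 / r\<close> vectors refutes the assumption, since its normalised projection is exactly
  invariant.\<close>

theorem almost_invariant_exists:
  assumes inf: "\<not> finite_cdim (UNIV :: 'h set)"
    and am: "\<And>K. closed_invariant_subspace G \<pi> K \<Longrightarrow> finite_codim K \<Longrightarrow> amenable_rep G K (subrep \<pi> K)"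
    and F: "finite F" "F \<subseteq> carrier G" and r: "0 < r" and \<delta>: "0 < \<delta>"
  shows "\<exists>vs\<in>flat_states UNIV r. almost_invariant \<pi> F \<delta> vs"
proof (rule ccontr)
  assume not: "\<not> ?thesis"
  have "\<exists>E. invariant_frame E \<and> n \<le> card E" for n
  proof (induction n)
    case 0
    then show ?case by (intro exI[of _ "{}"]) (simp add: invariant_frame_def)
  next
    case (Suc n)
    then obtain E where E: "invariant_frame E" "n \<le> card E" by blast
    have on: "orthonormal E" using E by (simp add: invariant_frame_def)
    let ?K = "ortho E"
    obtain \<phi> where \<phi>: "state_on ?K \<phi>"
      "\<forall>g\<in>carrier G. \<forall>T\<in>bounded_ops ?K. \<phi> (subrep \<pi> ?K g \<circ> T \<circ> subrep \<pi> ?K (inv g)) = \<phi> T"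
      using am[OF ortho_frame[OF E(1)]] by (auto simp: amenable_rep_def)
    interpret invariant_state G \<pi> ?K \<phi>
      by unfold_locales (use \<phi> ortho_frame[OF E(1)] in auto)
    have "\<not> (\<forall>x\<in>?K. B x = 0)"
    proof
      assume "\<forall>x\<in>?K. B x = 0"
      then have "\<exists>vs\<in>flat_states ?K r. almost_invariant \<pi> F \<delta> vs"
        by (intro vanishing_state_almost_invariant[OF E(1) refl _ F r \<delta>] large_orthonormal inf on) auto
      then show False using not flat_states_mono[of ?K UNIV r] by auto
    qed
    then obtain x where "x \<in> ?K" "B x \<noteq> 0" by blast
    then obtain E' where E': "invariant_frame E'" "E' \<subseteq> ?K" "E' \<noteq> {}"
      by (rule invariant_frame_of_nonvanishing)
    show ?case using invariant_frame_union[OF E(1) E'] E(2) by (intro exI[of _ "E \<union> E'"]) auto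
  qed
  then obtain E where E: "invariant_frame E" "nat \<lceil>1 / r\<rceil> \<le> card E" by blast
  have on: "orthonormal E" using E by (simp add: invariant_frame_def)
  have c: "1 / r \<le> real (card E)" using E(2) by linarith
  let ?c = "1 / sqrt (real (card E))"
  obtain es where es: "distinct es" "set es = E" and fl: "map ((*\<^sub>R) ?c) es \<in> flat_states UNIV r"
    by (rule flat_states_orthonormal[OF on subset_UNIV cvec.subspace_UNIV r c])
  have q: "qf (map (\<pi> g) es) e = qf es e" if g: "g \<in> carrier G" for g e
  proof -
    have es_q: "qf es y = (norm (onproj E y))\<^sup>2" for y
      using es by (simp add: qf_def norm_onproj[OF on] sum_list_distinct_conv_sum_set cmod_cinner_commute[of _ y])
    have "qf (map (\<pi> g) es) e = qf es (\<pi> (inv g) e)"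
      by (simp add: qf_def comp_def pi_cinner_left[OF g])
    also have "\<dots> = qf es e"
      by (simp add: es_q invariant_frame_onproj[OF E(1) inv_closed[OF g]] g)
    finally show ?thesis .
  qed
  have "qf (map (\<pi> g) (map ((*\<^sub>R) ?c) es)) - qf (map ((*\<^sub>R) ?c) es) = qf [] - qf []" if "g \<in> F" for g
  proof -
    have g: "g \<in> carrier G" using that F by auto
    have "map (\<pi> g) (map ((*\<^sub>R) ?c) es) = map ((*\<^sub>R) ?c) (map (\<pi> g) es)"
      by (simp add: linear_scale[OF pi_linear[OF g]])
    then show ?thesis by (simp only: fun_eq_iff minus_apply qf_simps q[OF g]) simp
  qed
  then have "almost_invariant \<pi> F \<delta> (map ((*\<^sub>R) ?c) es)"
    unfolding almost_invariant_def using \<delta> by (intro ballI exI[of _ "[]"] conjI) (simp_all del: map_map)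
  then show False using not fl by blast
qed

end

section \<open>From amenability to concentration\<close>

text \<open>Passing from \<open>v\<close> to the pair \<open>v\<close>, \<open>\<i> v\<close> turns the real quadratic form of \<open>gmean\<close> into the
  complex one of \<open>qf\<close>.\<close>

definition cpx :: "'h::complex_hilbert list \<Rightarrow> 'h list"
  where "cpx vs = concat (map (\<lambda>v. [v, \<i> *\<^sub>C v]) vs)"

lemma cpx_simps [simp]: "cpx [] = []" "cpx (v # vs) = v # \<i> *\<^sub>C v # cpx vs" "cpx (us @ vs) = cpx us @ cpx vs"
  by (simp_all add: cpx_def)

lemma cpx_qf: "(\<Sum>w\<leftarrow>cpx vs. (rin w e)\<^sup>2) = qf vs e"
  by (induction vs) (simp_all add: cinner_simps cmod_power2)

lemma cpx_nsq: "(\<Sum>w\<leftarrow>cpx vs. (norm w)\<^sup>2) = 2 * nsq vs"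
  by (induction vs) (simp_all add: norm_scaleC)

text \<open>As a function of the starting point, the mean over \<open>us\<close> is again Lipschitz
  with constant \<open>1\<close>; independent noise along \<open>zs\<close> changes it by at most
  the mean norm of the noise.\<close>

lemma gmean_append_le:
  fixes zs :: "'h::complex_hilbert list"
  assumes f: "1-lipschitz_on UNIV f"
  shows "\<bar>gmean (us @ zs) f - gmean us f\<bar> \<le> sqrt (\<Sum>z\<leftarrow>zs. (norm z)\<^sup>2)"
proof -
  define F where "F x = gmean us (\<lambda>y. f (x + y))" for x
  have L: "1-lipschitz_on UNIV F" unfolding F_def by (rule gmean_lipschitz[OF f])
  have lF: "lip F" by (rule lipI[OF L])
  have "gmean (us @ zs) f - gmean us f = gmean zs (\<lambda>x. F x - F 0)"
    by (simp add: gmean_append F_def[symmetric] gmean_diff lF gmean_const) (simp add: F_def)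
  also have "\<bar>\<dots>\<bar> \<le> gmean zs (\<lambda>x. \<bar>F x - F 0\<bar>)" by (intro gmean_abs_le lip_diff lF lip_const)
  also have "\<dots> \<le> gmean zs norm"
    using lipschitz_on_abs_diff[OF L, of _ 0] by (intro gmean_mono lip_abs lip_diff lF lip_const lip_norm) simp
  also have "\<dots> \<le> sqrt (\<Sum>z\<leftarrow>zs. (norm z)\<^sup>2)" by (rule gmean_norm_le)
  finally show ?thesis .
qed

text \<open>Adding \<open>\<beta>\<close> to \<open>us\<close> and \<open>\<alpha>\<close> to
  \<open>vs\<close> produces equal quadratic forms, hence equal Gaussian means. Each addition costs
  at most \<open>sqrt (2 * \<delta>)\<close>, where \<open>2\<close> comes from the trace doubled by
  \<open>cpx\<close>.\<close>

lemma gmean_cpx_perturb: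
  assumes f: "1-lipschitz_on UNIV f" and eq: "qf us - qf vs = qf \<alpha> - qf \<beta>" and \<delta>: "nsq \<alpha> + nsq \<beta> < \<delta>"
  shows "\<bar>gmean (cpx us) f - gmean (cpx vs) f\<bar> \<le> 2 * sqrt (2 * \<delta>)"
proof -
  have "qf us e + qf \<beta> e = qf vs e + qf \<alpha> e" for e
    using fun_cong[OF eq, of e] by simp
  then have "gmean (cpx (us @ \<beta>)) f = gmean (cpx (vs @ \<alpha>)) f"
    by (intro gmean_quadratic_form_unique lipI[OF f]) (simp add: cpx_qf del: cpx_simps)
  moreover have "\<bar>gmean (cpx (zs @ \<gamma>)) f - gmean (cpx zs) f\<bar> \<le> sqrt (2 * \<delta>)" if "nsq \<gamma> < \<delta>" for zs \<gamma>
  proof -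
    have "\<bar>gmean (cpx (zs @ \<gamma>)) f - gmean (cpx zs) f\<bar> \<le> sqrt (2 * nsq \<gamma>)"
      using gmean_append_le[OF f, of "cpx zs" "cpx \<gamma>"] by (simp add: cpx_nsq)
    also have "\<dots> \<le> sqrt (2 * \<delta>)" using that by simp
    finally show ?thesis .
  qed
  from this[of \<alpha> vs] this[of \<beta> us] have "\<bar>gmean (cpx (vs @ \<alpha>)) f - gmean (cpx vs) f\<bar> \<le> sqrt (2 * \<delta>)"
    "\<bar>gmean (cpx (us @ \<beta>)) f - gmean (cpx us) f\<bar> \<le> sqrt (2 * \<delta>)"
    using \<delta> nsq_nonneg[of \<alpha>] nsq_nonneg[of \<beta>] by linarith+
  ultimately show ?thesis by linarith
qed

text \<open>Over an orthonormal basis of the span of \<open>vs\<close>, the form of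
  \<open>cpx vs\<close> sums to \<open>nsq vs = 1\<close>.\<close>

lemma gmean_cpx_norm_ge:
  fixes vs :: "'h::complex_hilbert list"
  assumes "nsq vs = 1"
  shows "gabs \<le> gmean (cpx vs) norm"
proof -
  obtain E where E: "orthonormal E" "cvec.span E = cvec.span (set vs)"
    by (rule gram_schmidt[of "set vs"]) auto
  have v: "(\<Sum>e\<in>E. (cmod (cinner v e))\<^sup>2) = (norm v)\<^sup>2" if "v \<in> set vs" for v
    using norm_onproj[OF E(1), of v] onproj_span_id[OF E(1), of v] cvec.span_base[OF that] E(2) by simp
  have swap: "(\<Sum>e\<in>E. \<Sum>v\<leftarrow>us. g v e) = (\<Sum>v\<leftarrow>us. \<Sum>e\<in>E. g v e)" for us and g :: "'h \<Rightarrow> 'h \<Rightarrow> real"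
    by (induction us) (simp_all add: sum.distrib)
  have "(\<Sum>e\<in>E. \<Sum>w\<leftarrow>cpx vs. (rin w e)\<^sup>2) = (\<Sum>v\<leftarrow>vs. \<Sum>e\<in>E. (cmod (cinner v e))\<^sup>2)"
    by (simp only: cpx_qf qf_def swap)
  also have "\<dots> = (\<Sum>v\<leftarrow>vs. (norm v)\<^sup>2)" by (rule arg_cong[of _ _ sum_list]) (simp add: v)
  also have "\<dots> = 1" using assms by (simp add: nsq_def)
  finally show ?thesis using gmean_norm_ge[OF E(1), of "cpx vs"] by simp
qed

text \<open>A supremum of linear functionals, hence convex, and for nonempty subsets of the unit
  sphere Lipschitz with constant \<open>1\<close>. Its value at a unit vector measures the nearness
  of that vector to \<open>A\<close>.\<close>

definition support :: "'h::complex_hilbert set \<Rightarrow> 'h \<Rightarrow> real"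
  where "support A x = (SUP a\<in>A. rin x a)"

lemma
  assumes A: "A \<subseteq> sphere 0 1" "A \<noteq> {}"
  shows support_upper: "a \<in> A \<Longrightarrow> rin x a \<le> support A x"
    and support_le_norm: "support A x \<le> norm x"
    and support_approx: "c < support A x \<Longrightarrow> \<exists>a\<in>A. c < rin x a"
    and subgradable_support: "subgradable (support A)"
proof -
  have le: "rin x a \<le> norm x" if "a \<in> A" for x a
    using Re_cinner_le[of x a] that A(1) by auto
  have bdd: "bdd_above ((\<lambda>a. rin x a) ` A)" for x using le by (intro bdd_aboveI[of _ "norm x"]) auto
  show up: "rin x a \<le> support A x" if "a \<in> A" for x a
    unfolding support_def by (rule cSUP_upper[OF that bdd])
  show "support A x \<le> norm x"
    unfolding support_def by (rule cSUP_least[OF A(2) le])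
  show ap: "\<exists>a\<in>A. c < rin x a" if "c < support A x" for c x
    using that less_cSUP_iff[OF A(2) bdd, of c x] by (simp add: support_def)
  show "subgradable (support A)"
    unfolding subgradable_def
  proof (intro allI impI)
    fix x and \<eta> :: real assume "0 < \<eta>"
    then obtain a where a: "a \<in> A" "support A x - \<eta> < rin x a" using ap[of "support A x - \<eta>" x] by auto
    have "support A x - support A y \<le> rin (x - y) a + \<eta>" for y
      using a(2) up[OF a(1), of y] by (simp add: cinner_simps)
    moreover have "norm a \<le> 1" using a(1) A(1) by auto
    ultimately show "\<exists>a. norm a \<le> 1 \<and> (\<forall>y. support A x - support A y \<le> rin (x - y) a + \<eta>)" by blast
  qed
qed

lemma subgradable_norm: "subgradable (norm :: 'h::complex_hilbert \<Rightarrow> real)"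
  unfolding subgradable_def
proof (intro allI impI)
  fix x :: 'h and \<eta> :: real assume \<eta>: "0 < \<eta>"
  \<comment> \<open>At \<open>x = 0\<close> division by zero gives \<open>a = 0\<close>, which is a
    subgradient there.\<close>
  define a where "a = (1 / norm x) *\<^sub>R x"
  have a: "norm a \<le> 1" by (simp add: a_def)
  have "rin x a = norm x" by (simp add: a_def cinner_simps Re_cinner_self power2_eq_square)
  moreover have "rin y a \<le> norm y" for y
    using Re_cinner_le[of y a] a mult_left_mono[OF a, of "norm y"] by simp
  ultimately have "norm x - norm y \<le> rin (x - y) a + \<eta>" for y using \<eta> by (simp add: cinner_simps add_increasing2)
  then show "\<exists>a. norm a \<le> 1 \<and> (\<forall>y. norm x - norm y \<le> rin (x - y) a + \<eta>)" using a by blast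
qed

text \<open>Concentration makes all support functions of a finite cover nearly constant; since their
  maximum is the norm, one of them nearly equals the norm in mean.\<close>

lemma support_mean_near_norm:
  fixes \<C> :: "'h::complex_hilbert set set"
  assumes C: "finite \<C>" "\<Union>\<C> = sphere 0 1" "\<And>A. A \<in> \<C> \<Longrightarrow> A \<noteq> {}" "\<C> \<noteq> {}"
    and r: "0 < r" "\<And>a. norm a \<le> 1 \<Longrightarrow> (\<Sum>v\<leftarrow>vs. (rin v a)\<^sup>2) \<le> r"
  shows "\<exists>A\<in>\<C>. gmean vs norm - gmean vs (support A) \<le> 4 * ((real (card \<C>) + 1) * (pi * gabs * sqrt r))"
proof -
  define \<tau> where "\<tau> = (real (card \<C>) + 1) * (pi * gabs * sqrt r)"
  have \<tau>: "0 < \<tau>" using r(1) gabs_pos by (simp add: \<tau>_def)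
  have sub: "A \<subseteq> sphere 0 1" if "A \<in> \<C>" for A using C(2) that by auto
  note sg = subgradable_support[OF sub C(3)]
  define D where "D f x = \<bar>f x - gmean vs f\<bar>" for f and x :: 'h
  have lD: "lip (D f)" if "subgradable f" for f
    unfolding D_def by (intro lip_abs lip_diff lip_subgradable[OF that] lip_const)
  have mD: "gmean vs (D f) \<le> pi * gabs * sqrt r" if "subgradable f" for f
    unfolding D_def by (rule gmean_deviation[OF that r(2)])
  define H where "H x = D norm x + (\<Sum>A\<in>\<C>. D (support A) x)" for x
  have lS: "lip (\<lambda>x. \<Sum>A\<in>\<C>. D (support A) x)" by (intro lip_sum lD sg)
  have lH: "lip H" unfolding H_def by (intro lip_add lD subgradable_norm lS)
  have "gmean vs H = gmean vs (D norm) + (\<Sum>A\<in>\<C>. gmean vs (D (support A)))"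
    unfolding H_def by (simp add: gmean_add lD subgradable_norm lS gmean_sum sg)
  also have "\<dots> \<le> pi * gabs * sqrt r + (\<Sum>A\<in>\<C>. pi * gabs * sqrt r)"
    by (intro add_mono sum_mono mD subgradable_norm sg)
  also have "\<dots> = \<tau>" by (simp add: \<tau>_def distrib_right)
  \<comment> \<open>At one point the total deviation is at most twice the bound on its mean, so the
    norm and all support functions are close to their means simultaneously.\<close>
  finally obtain x where x: "H x \<le> \<tau> + \<tau>" using gmean_le_exists[OF lH _ \<tau>] by blast
  have D0: "0 \<le> D f x" for f by (simp add: D_def)
  have Dn: "D norm x \<le> 2 * \<tau>" using x D0 unfolding H_def
    by (smt (verit) sum_nonneg)
  have DA: "D (support A) x \<le> 2 * \<tau>" if "A \<in> \<C>" for A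
  proof -
    have "D (support A) x \<le> (\<Sum>A\<in>\<C>. D (support A) x)" using C(1) that D0 by (intro member_le_sum) auto
    then show ?thesis using x D0[of norm] unfolding H_def by linarith
  qed
  \<comment> \<open>The member that contains the direction of \<open>x\<close>; its support function
    reaches the norm there.\<close>
  obtain A where A: "A \<in> \<C>" "norm x \<le> support A x"
  proof (cases "x = 0")
    case True
    obtain A where A: "A \<in> \<C>" using C(4) by auto
    obtain a where "a \<in> A" using C(3)[OF A] by auto
    then have "0 \<le> support A x" using support_upper[OF sub[OF A] C(3)[OF A], of a x] True by (simp add: cinner_simps)
    then show ?thesis using that A True by simp
  next
    case False
    let ?u = "(1 / norm x) *\<^sub>R x"
    have "?u \<in> \<Union>\<C>" unfolding C(2) using False by simp
    then obtain A where A: "A \<in> \<C>" "?u \<in> A" by auto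
    have "rin x ?u = norm x" using False by (simp add: cinner_simps Re_cinner_self power2_eq_square)
    then show ?thesis using that[OF A(1)] support_upper[OF sub[OF A(1)] C(3)[OF A(1)] A(2), of x] by simp
  qed
  have "gmean vs norm - gmean vs (support A) \<le> 4 * \<tau>"
    using Dn DA[OF A(1)] A(2) unfolding D_def by linarith
  then show ?thesis using A(1) unfolding \<tau>_def by blast
qed

section \<open>Invariant vectors, non-essential sets and the main estimate\<close>

context unitary_representation
begin

lemma map_pi_cpx: "g \<in> carrier G \<Longrightarrow> map (\<pi> g) (cpx vs) = cpx (map (\<pi> g) vs)"
  by (induction vs) (simp_all add: pi_scaleC)

text \<open>The normalised invariant vector lies in some member of the cover and in every translate
  of its neighbourhoods.\<close>

lemma concentration_of_invariant_vector:
  assumes v: "v \<noteq> 0" "\<And>g. g \<in> carrier G \<Longrightarrow> \<pi> g v = v"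
  shows "concentration_property G \<pi>"
  unfolding concentration_property_def
proof (intro allI impI)
  fix \<C> :: "'h set set" assume C: "finite \<C> \<and> \<Union>\<C> = sphere 0 1"
  let ?u = "(1 / norm v) *\<^sub>R v"
  have u: "?u \<in> sphere 0 1" using v(1) by simp
  then obtain A where A: "A \<in> \<C>" "?u \<in> A" using C by blast
  have "\<pi> g ?u = ?u" if "g \<in> carrier G" for g
    using v(2)[OF that] by (simp add: linear_scale[OF pi_linear[OF that]])
  moreover have "?u \<in> sphere_nhd \<epsilon> A" if "0 < \<epsilon>" for \<epsilon>
    using u A(2) that unfolding sphere_nhd_def by (metis (mono_tags, lifting) dist_self mem_Collect_eq)
  ultimately have "?u \<in> \<pi> g ` sphere_nhd \<epsilon> A" if "g \<in> carrier G" "0 < \<epsilon>" for g \<epsilon>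
    using that by (metis imageI)
  then have "?u \<in> sphere 0 1 \<inter> (\<Inter>g\<in>F. \<pi> g ` sphere_nhd \<epsilon> A)" if "F \<subseteq> carrier G" "0 < \<epsilon>" for F \<epsilon>
    using that u by blast
  moreover have "A \<subseteq> sphere 0 1" using A(1) C by blast
  ultimately have "essential G \<pi> A" unfolding essential_def by blast
  then show "\<exists>A\<in>\<C>. essential G \<pi> A" using A(1) by blast
qed

lemma not_essentialD:
  assumes A: "A \<subseteq> sphere 0 1" and ne: "\<not> essential G \<pi> A"
  shows "\<exists>\<epsilon> F. 0 < \<epsilon> \<and> finite F \<and> F \<subseteq> carrier G \<and> sphere 0 1 \<inter> (\<Inter>g\<in>F. \<pi> g ` sphere_nhd \<epsilon> A) = {}"
proof (rule ccontr)
  assume none: "\<not> ?thesis"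
  have "essential G \<pi> A"
    unfolding essential_def
  proof (intro conjI allI impI A)
    fix \<epsilon> :: real and F assume *: "0 < \<epsilon>" "finite F \<and> F \<subseteq> carrier G"
    show "sphere 0 1 \<inter> (\<Inter>g\<in>F. \<pi> g ` sphere_nhd \<epsilon> A) \<noteq> {}"
    proof
      assume **: "sphere 0 1 \<inter> (\<Inter>g\<in>F. \<pi> g ` sphere_nhd \<epsilon> A) = {}"
      have "\<exists>\<epsilon> F. 0 < \<epsilon> \<and> finite F \<and> F \<subseteq> carrier G \<and> sphere 0 1 \<inter> (\<Inter>g\<in>F. \<pi> g ` sphere_nhd \<epsilon> A) = {}"
        by (rule exI[of _ \<epsilon>], rule exI[of _ F]) (use * ** in simp)
      with none show False by (rule notE)
    qed
  qed
  with ne show False by (rule notE)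
qed

text \<open>Unit vectors \<open>y\<close> and \<open>a\<close> at distance at least
  \<open>\<epsilon>\<close> satisfy \<open>rin y a \<le> 1 - \<epsilon>\<^sup>2 / 2\<close>, and the
  direction of \<open>x\<close> misses one of the translates. The two radii allow one
  \<open>\<epsilon>\<close> for all members of a finite cover.\<close>

lemma not_essential_gap:
  assumes A: "A \<subseteq> sphere 0 1" "A \<noteq> {}" and \<epsilon>: "0 < \<epsilon>" "\<epsilon> \<le> \<epsilon>'"
    and F: "F \<subseteq> carrier G" "sphere 0 1 \<inter> (\<Inter>g\<in>F. \<pi> g ` sphere_nhd \<epsilon>' A) = {}" and x: "x \<noteq> 0"
  shows "\<exists>g\<in>F. support A (\<pi> (inv g) x) \<le> (1 - \<epsilon>\<^sup>2 / 2) * norm x"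
proof (rule ccontr)
  assume not: "\<not> ?thesis"
  let ?u = "(1 / norm x) *\<^sub>R x"
  have u: "?u \<in> sphere 0 1" using x by simp
  have "?u \<in> \<pi> g ` sphere_nhd \<epsilon>' A" if gF: "g \<in> F" for g
  proof -
    have g: "g \<in> carrier G" using gF F by auto
    let ?y = "\<pi> (inv g) ?u"
    have y: "?y \<in> sphere 0 1" using x g by simp
    have gt: "(1 - \<epsilon>\<^sup>2 / 2) * norm x < support A (\<pi> (inv g) x)" using not gF by force
    obtain a where a: "a \<in> A" "(1 - \<epsilon>\<^sup>2 / 2) * norm x < rin (\<pi> (inv g) x) a"
      using support_approx[OF A gt] by blast
    have "?y = (1 / norm x) *\<^sub>R \<pi> (inv g) x" by (rule linear_scale[OF pi_linear[OF inv_closed[OF g]]])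
    then have "rin ?y a = rin (\<pi> (inv g) x) a / norm x" by (simp add: cinner_simps)
    moreover have "1 - \<epsilon>\<^sup>2 / 2 < rin (\<pi> (inv g) x) a / norm x" using a(2) x by (simp add: pos_less_divide_eq)
    ultimately have "1 - \<epsilon>\<^sup>2 / 2 < rin ?y a" by (simp only:)
    moreover have "norm a = 1" "norm ?y = 1" using a(1) A(1) y by auto
    ultimately have "(norm (?y - a))\<^sup>2 < \<epsilon>\<^sup>2" unfolding norm_diff_sq by simp
    then have "norm (?y - a) < \<epsilon>" using \<epsilon>(1) by (simp add: power_less_imp_less_base)
    then have "?y \<in> sphere_nhd \<epsilon>' A" using y a(1) \<epsilon>(2) by (force simp: sphere_nhd_def dist_norm)
    then have "\<pi> g ?y \<in> \<pi> g ` sphere_nhd \<epsilon>' A" by (rule imageI)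
    then show ?thesis using g by simp
  qed
  then show False using u F(2) by blast
qed

theorem concentration_of_amenable:
  assumes inf: "\<not> finite_cdim (UNIV :: 'h set)"
    and am: "\<And>K. closed_invariant_subspace G \<pi> K \<Longrightarrow> finite_codim K \<Longrightarrow> amenable_rep G K (subrep \<pi> K)"
  shows "concentration_property G \<pi>"
  unfolding concentration_property_def
proof (intro allI impI, rule ccontr)
  fix \<C>0 :: "'h set set" assume C0: "finite \<C>0 \<and> \<Union>\<C>0 = sphere 0 1" and no: "\<not> (\<exists>A\<in>\<C>0. essential G \<pi> A)"
  \<comment> \<open>The supremum defining \<open>support\<close> is meaningful only for nonempty
    sets.\<close>
  define \<C> where "\<C> = \<C>0 - {{}}"
  have C: "finite \<C>" "\<Union>\<C> = sphere 0 1" "\<And>A. A \<in> \<C> \<Longrightarrow> A \<noteq> {}" using C0 by (auto simp: \<C>_def)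
  have sub: "A \<subseteq> sphere 0 1" if "A \<in> \<C>" for A using C(2) that by auto
  have Cne: "\<C> \<noteq> {}"
  proof
    assume "\<C> = {}"
    then have s: "sphere 0 1 = ({} :: 'h set)" using C(2) by auto
    have "x = 0" for x :: 'h
    proof (rule ccontr)
      assume "x \<noteq> 0"
      then have "(1 / norm x) *\<^sub>R x \<in> sphere 0 1" by simp
      then show False using s by blast
    qed
    then have "UNIV \<subseteq> cvec.span ({} :: 'h set)" by auto
    then show False using inf unfolding finite_cdim_def by blast
  qed
  have "\<exists>\<epsilon> F. 0 < \<epsilon> \<and> finite F \<and> F \<subseteq> carrier G \<and> sphere 0 1 \<inter> (\<Inter>g\<in>F. \<pi> g ` sphere_nhd \<epsilon> A) = {}"
    if "A \<in> \<C>" for A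
  proof -
    have "\<not> essential G \<pi> A" using no that by (simp add: \<C>_def)
    then show ?thesis by (rule not_essentialD[OF sub[OF that]])
  qed
  then have "\<forall>A. \<exists>\<epsilon> F. A \<in> \<C> \<longrightarrow> 0 < \<epsilon> \<and> finite F \<and> F \<subseteq> carrier G \<and>
      sphere 0 1 \<inter> (\<Inter>g\<in>F. \<pi> g ` sphere_nhd \<epsilon> A) = {}" by simp
  from this[THEN choice] obtain eps where "\<forall>A. \<exists>F. A \<in> \<C> \<longrightarrow> 0 < eps A \<and> finite F \<and> F \<subseteq> carrier G \<and>
      sphere 0 1 \<inter> (\<Inter>g\<in>F. \<pi> g ` sphere_nhd (eps A) A) = {}" ..
  from this[THEN choice] obtain FF where FF: "\<forall>A. A \<in> \<C> \<longrightarrow> 0 < eps A \<and> finite (FF A) \<and> FF A \<subseteq> carrier G \<and>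
      sphere 0 1 \<inter> (\<Inter>g\<in>FF A. \<pi> g ` sphere_nhd (eps A) A) = {}" ..
  have ef: "0 < eps A" "finite (FF A)" "FF A \<subseteq> carrier G"
    "sphere 0 1 \<inter> (\<Inter>g\<in>FF A. \<pi> g ` sphere_nhd (eps A) A) = {}" if "A \<in> \<C>" for A
    using FF[rule_format, OF that] by simp_all
  define F where "F = (\<Union>A\<in>\<C>. FF A)"
  have F: "finite F" "F \<subseteq> carrier G" using ef C(1) by (auto simp: F_def)
  define \<epsilon> where "\<epsilon> = Min (insert 1 (eps ` \<C>))"
  have \<epsilon>: "0 < \<epsilon>" "\<epsilon> \<le> 1" unfolding \<epsilon>_def using C(1) ef(1) by auto
  have \<epsilon>A: "\<epsilon> \<le> eps A" if "A \<in> \<C>" for A unfolding \<epsilon>_def using C(1) that by auto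
  define \<kappa> where "\<kappa> = \<epsilon>\<^sup>2 / 2"
  have \<kappa>: "0 < \<kappa>" using \<epsilon> by (simp add: \<kappa>_def)
  \<comment> \<open>The group element that detects the gap depends on \<open>x\<close>; as all
    summands are nonnegative, summing over \<open>F\<close> gives an inequality to which the mean
    can be applied.\<close>
  have gap: "\<kappa> * norm x \<le> (\<Sum>g\<in>F. norm x - support A (\<pi> (inv g) x))" if A: "A \<in> \<C>" for A x
  proof -
    have nn: "0 \<le> norm x - support A (\<pi> (inv g) x)" if "g \<in> F" for g
      using support_le_norm[OF sub[OF A] C(3)[OF A], of "\<pi> (inv g) x"] that F(2) by auto
    show ?thesis
    proof (cases "x = 0")
      case True
      then show ?thesis using sum_nonneg[OF nn] by simp
    next
      case False
      obtain g where g: "g \<in> FF A" "support A (\<pi> (inv g) x) \<le> (1 - \<epsilon>\<^sup>2 / 2) * norm x"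
        using not_essential_gap[OF sub[OF A] C(3)[OF A] \<epsilon>(1) \<epsilon>A[OF A] ef(3)[OF A] ef(4)[OF A] False] by blast
      have gF: "g \<in> F" using g(1) A by (auto simp: F_def)
      have "\<kappa> * norm x \<le> norm x - support A (\<pi> (inv g) x)" using g(2) by (simp add: \<kappa>_def algebra_simps)
      also have "\<dots> \<le> (\<Sum>g\<in>F. norm x - support A (\<pi> (inv g) x))"
        using F(1) gF nn by (intro member_le_sum) auto
      finally show ?thesis .
    qed
  qed
  let ?n = "real (card F) + 1" and ?k = "real (card \<C>) + 1"
  \<comment> \<open>The error from concentration and the error from almost invariance each add up
    over \<open>F\<close> to at most \<open>\<kappa> * gabs / 4\<close>.\<close>
  define r where "r = (\<kappa> / (16 * ?n * ?k * pi))\<^sup>2"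
  define \<delta> where "\<delta> = (\<kappa> * gabs / (8 * ?n))\<^sup>2 / 2"
  have r: "0 < r" "sqrt r = \<kappa> / (16 * ?n * ?k * pi)"
    unfolding r_def using \<kappa> by (auto simp: add_nonneg_eq_0_iff)
  have \<delta>: "0 < \<delta>" "sqrt (2 * \<delta>) = \<kappa> * gabs / (8 * ?n)"
    unfolding \<delta>_def using \<kappa> gabs_pos by (auto simp: add_nonneg_eq_0_iff)
  have Fi: "finite ((\<lambda>g. inv g) ` F)" "(\<lambda>g. inv g) ` F \<subseteq> carrier G" using F by auto
  obtain vs where vs: "vs \<in> flat_states UNIV r" "almost_invariant \<pi> ((\<lambda>g. inv g) ` F) \<delta> vs"
    using almost_invariant_exists[OF inf am Fi r(1) \<delta>(1)] by blast
  let ?M = "gmean (cpx vs)"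
  have rbound: "(\<Sum>v\<leftarrow>cpx vs. (rin v a)\<^sup>2) \<le> r" if "norm a \<le> 1" for a
  proof -
    have "qf vs a \<le> r * (norm a)\<^sup>2" using vs(1) by (simp add: flat_states_def)
    also have "\<dots> \<le> r * 1" using r(1) that by (intro mult_left_mono) (auto simp: power_le_one)
    finally show ?thesis by (simp add: cpx_qf)
  qed
  obtain A where A: "A \<in> \<C>" "?M norm - ?M (support A) \<le> 4 * (?k * (pi * gabs * sqrt r))"
    using support_mean_near_norm[OF C Cne r(1) rbound] by blast
  have sg: "subgradable (support A)" by (rule subgradable_support[OF sub[OF A(1)] C(3)[OF A(1)]])
  note L = subgradable_lipschitz[OF sg] and lA = lip_subgradable[OF sg]
  have bl: "bounded_linear (\<pi> (inv g))" if "g \<in> F" for g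
    by (rule bounded_linear_intro[where K = 1]) (use that F in \<open>auto simp: pi_add linear_scale[OF pi_linear]\<close>)
  have lAg: "lip (\<lambda>x. support A (\<pi> (inv g) x))" if "g \<in> F" for g
    by (rule lip_compose_linear0[OF lA bl[OF that]])
  have shift: "?M norm - ?M (\<lambda>x. support A (\<pi> (inv g) x)) \<le> 4 * (?k * (pi * gabs * sqrt r)) + 2 * sqrt (2 * \<delta>)"
    if g: "g \<in> F" for g
  proof -
    have gi: "inv g \<in> carrier G" using g F by auto
    have "?M (\<lambda>x. support A (\<pi> (inv g) x)) = gmean (cpx (map (\<pi> (inv g)) vs)) (support A)"
      unfolding map_pi_cpx[OF gi, symmetric] by (rule gmean_linear_map[OF pi_linear[OF gi]])
    moreover obtain \<alpha> \<beta> where "qf (map (\<pi> (inv g)) vs) - qf vs = qf \<alpha> - qf \<beta>" "nsq \<alpha> + nsq \<beta> < \<delta>"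
      using vs(2) g unfolding almost_invariant_def by blast
    then have "\<bar>gmean (cpx (map (\<pi> (inv g)) vs)) (support A) - ?M (support A)\<bar> \<le> 2 * sqrt (2 * \<delta>)"
      by (rule gmean_cpx_perturb[OF L])
    ultimately show ?thesis using A(2) by linarith
  qed
  have "\<kappa> * gabs \<le> \<kappa> * ?M norm"
    using gmean_cpx_norm_ge[of vs] vs(1) \<kappa> by (simp add: flat_states_def)
  also have "\<dots> = ?M (\<lambda>x. \<kappa> * norm x)" by (simp add: gmean_cmult lip_norm)
  also have "\<dots> \<le> ?M (\<lambda>x. \<Sum>g\<in>F. norm x - support A (\<pi> (inv g) x))"
    by (intro gmean_mono gap A(1) lip_cmult lip_norm lip_sum lip_diff lAg)
  also have "\<dots> = (\<Sum>g\<in>F. ?M norm - ?M (\<lambda>x. support A (\<pi> (inv g) x)))"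
    by (simp add: gmean_sum gmean_diff lip_norm lip_diff lAg)
  also have "\<dots> \<le> (\<Sum>g\<in>F. 4 * (?k * (pi * gabs * sqrt r)) + 2 * sqrt (2 * \<delta>))"
    by (intro sum_mono shift)
  also have "\<dots> = real (card F) * (4 * (?k * (pi * gabs * sqrt r)) + 2 * sqrt (2 * \<delta>))" by simp
  also have "\<dots> \<le> ?n * (4 * (?k * (pi * gabs * sqrt r)) + 2 * sqrt (2 * \<delta>))"
    using gabs_pos r(1) \<delta>(1) by (intro mult_right_mono) auto
  also have "\<dots> = \<kappa> * gabs / 2"
    unfolding r(2) \<delta>(2) by (simp add: field_simps add_nonneg_eq_0_iff)
  finally show False using \<kappa> gabs_pos by simp
qed

end

section \<open>From concentration to amenability\<close>

lemma finite_net: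
  assumes "bounded S" "0 < e"
  obtains Z :: "complex set" where "finite Z" "S \<subseteq> (\<Union>z\<in>Z. ball z e)"
proof -
  have "compact (closure S)" using assms(1) by simp
  then obtain Z where "finite Z" "closure S \<subseteq> (\<Union>z\<in>Z. ball z e)"
    using assms(2) unfolding compact_eq_totally_bounded by blast
  then show ?thesis using that closure_subset[of S] by blast
qed

lemma continuous_on_eval: "continuous_on UNIV (\<lambda>f. f T)" for T :: 'i
  by (rule continuous_on_product_coordinates)

text \<open>Tychonoff's theorem for pointwise convergence, in the role of weak-star
  compactness.\<close>

lemma compact_bounded_functions:
  fixes b :: "'i \<Rightarrow> real"
  shows "compact {f :: 'i \<Rightarrow> complex. \<forall>i. cmod (f i) \<le> b i}"
proof -
  have "compactin (product_topology (\<lambda>i::'i. euclidean) UNIV) (PiE UNIV (\<lambda>i. cball (0::complex) (b i)))"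
    by (subst compactin_PiE) auto
  then have "compact (PiE UNIV (\<lambda>i. cball (0::complex) (b i)))"
    by (simp add: euclidean_product_topology)
  moreover have "PiE UNIV (\<lambda>i. cball (0::complex) (b i)) = {f. \<forall>i. cmod (f i) \<le> b i}"
    by (auto simp: PiE_def Pi_def)
  ultimately show ?thesis by simp
qed

section \<open>Almost invariant unit vectors from concentration\<close>

context unitary_representation
begin

lemma essentialD:
  assumes "essential G \<pi> A" "0 < \<epsilon>" "finite F" "F \<subseteq> carrier G"
  shows "\<exists>x\<in>sphere 0 1. \<forall>g\<in>F. x \<in> \<pi> g ` sphere_nhd \<epsilon> A"
proof -
  have "sphere 0 1 \<inter> (\<Inter>g\<in>F. \<pi> g ` sphere_nhd \<epsilon> A) \<noteq> {}"
    using assms by (simp add: essential_def)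
  then obtain x where "x \<in> sphere 0 1 \<inter> (\<Inter>g\<in>F. \<pi> g ` sphere_nhd \<epsilon> A)"
    by (rule ex_in_conv[THEN iffD2, THEN exE])
  then show ?thesis by (intro bexI[of _ x] ballI) (simp_all only: Int_iff INT_iff)
qed

text \<open>Finitely many cells, on each of which every \<open>h\<close> varies by less than
  \<open>e / 4\<close>, cover the sphere. For an essential cell there is a unit vector
  \<open>x\<close> such that \<open>x\<close> and all \<open>\<pi> g x\<close> with
  \<open>g \<in> F\<close> lie near the cell, and the Lipschitz bounds compare the values.\<close>

lemma essential_almost_invariant:
  fixes H :: "('h \<Rightarrow> complex) set"
  assumes conc: "concentration_property G \<pi>" and H: "finite H"
    and bdd: "\<And>h. h \<in> H \<Longrightarrow> bounded (h ` sphere 0 1)"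
    and lip: "\<And>h. h \<in> H \<Longrightarrow> \<exists>L. \<forall>x\<in>sphere 0 1. \<forall>y\<in>sphere 0 1. cmod (h x - h y) \<le> L * dist x y"
    and F: "finite F" "F \<subseteq> carrier G" and e: "0 < e"
  shows "\<exists>x\<in>sphere 0 1. \<forall>g\<in>F. \<forall>h\<in>H. cmod (h (\<pi> g x) - h x) < e"
proof -
  have "\<exists>Z. finite Z \<and> h ` sphere 0 1 \<subseteq> (\<Union>z\<in>Z. ball z (e / 8))" if "h \<in> H" for h
    using finite_net[OF bdd[OF that], of "e / 8"] e by (metis divide_pos_pos zero_less_numeral)
  then obtain Z where Z: "\<And>h. h \<in> H \<Longrightarrow> finite (Z h)"
    "\<And>h. h \<in> H \<Longrightarrow> h ` sphere 0 1 \<subseteq> (\<Union>z\<in>Z h. ball z (e / 8))" by metis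
  have "\<exists>z\<in>Z h. cmod (h x - z) < e / 8" if "h \<in> H" "x \<in> sphere 0 1" for h x
    using Z(2)[OF that(1)] that(2) by (force simp: dist_norm norm_minus_commute)
  then obtain c where c: "\<And>h x. h \<in> H \<Longrightarrow> x \<in> sphere 0 1 \<Longrightarrow> c h x \<in> Z h"
    "\<And>h x. h \<in> H \<Longrightarrow> x \<in> sphere 0 1 \<Longrightarrow> cmod (h x - c h x) < e / 8" by metis
  define cell where "cell p = {x \<in> sphere 0 1. restrict (\<lambda>h. c h x) H = p}" for p
  let ?C = "cell ` PiE H Z"
  have "finite ?C" using Z(1) H by (intro finite_imageI finite_PiE) auto
  moreover have "\<Union>?C = sphere 0 1"
  proof
    show "sphere 0 1 \<subseteq> \<Union>?C"
    proof
      fix x :: 'h assume x: "x \<in> sphere 0 1"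
      then have "restrict (\<lambda>h. c h x) H \<in> PiE H Z" using c(1) by auto
      moreover have "x \<in> cell (restrict (\<lambda>h. c h x) H)" using x by (simp add: cell_def)
      ultimately show "x \<in> \<Union>?C" by blast
    qed
  qed (auto simp: cell_def)
  ultimately obtain p where ess: "essential G \<pi> (cell p)"
    using conc unfolding concentration_property_def by blast
  have osc: "cmod (h a - h b) < e / 4" if "h \<in> H" "a \<in> cell p" "b \<in> cell p" for h a b
  proof -
    have ab: "a \<in> sphere 0 1" "b \<in> sphere 0 1" using that by (auto simp: cell_def)
    have "restrict (\<lambda>h. c h a) H h = restrict (\<lambda>h. c h b) H h" using that by (simp add: cell_def)
    then have eq: "c h a = c h b" using that(1) by simp
    have "cmod (h a - h b) \<le> cmod (h a - c h a) + cmod (h b - c h a)"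
      using norm_triangle_ineq4[of "h a - c h a" "h b - c h a"] by simp
    also have "\<dots> < e / 8 + e / 8"
      using c(2)[OF that(1) ab(1)] c(2)[OF that(1) ab(2)] unfolding eq by (intro add_strict_mono)
    finally show ?thesis by simp
  qed
  obtain L where L: "\<And>h x y. h \<in> H \<Longrightarrow> x \<in> sphere 0 1 \<Longrightarrow> y \<in> sphere 0 1 \<Longrightarrow> cmod (h x - h y) \<le> L h * dist x y"
    using lip by metis
  define M where "M = Max (insert 1 (L ` H))"
  have M: "1 \<le> M" "\<And>h. h \<in> H \<Longrightarrow> L h \<le> M" unfolding M_def using H by auto
  define d where "d = e / (8 * M)"
  have d: "0 < d" using e M by (simp add: d_def)
  have near: "\<exists>a\<in>cell p. \<forall>h\<in>H. cmod (h y - h a) \<le> e / 8" if y: "y \<in> sphere_nhd d (cell p)" for y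
  proof -
    obtain a where a: "a \<in> cell p" "dist y a < d" and ys: "y \<in> sphere 0 1" using y by (auto simp: sphere_nhd_def)
    have "cmod (h y - h a) \<le> e / 8" if h: "h \<in> H" for h
    proof -
      have "cmod (h y - h a) \<le> L h * dist y a" using L[OF h ys] a(1) by (auto simp: cell_def)
      also have "\<dots> \<le> M * d" using M(1) M(2)[OF h] a(2) by (intro mult_mono) auto
      also have "\<dots> = e / 8" using M(1) by (simp add: d_def)
      finally show ?thesis .
    qed
    then show ?thesis using a(1) by blast
  qed
  have one: "\<one> \<in> carrier G" using group.is_monoid[OF group_G] by (rule monoid.one_closed)
  \<comment> \<open>The unit puts \<open>x\<close> itself near the cell. Inverses occur because
    \<open>x\<close> in the image under \<open>\<pi> (inv g)\<close> means that
    \<open>\<pi> g x\<close> is near the cell.\<close>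
  let ?F = "insert \<one> ((\<lambda>g. inv g) ` F)"
  have "finite ?F" "?F \<subseteq> carrier G" using F one by auto
  from essentialD[OF ess d this] obtain x
    where x0: "x \<in> sphere 0 1" "\<forall>g\<in>?F. x \<in> \<pi> g ` sphere_nhd d (cell p)" by (rule bexE)
  note x = x0(1) x0(2)[rule_format]
  have x1: "x \<in> sphere_nhd d (cell p)" using x(2)[of \<one>] by (auto simp: pi_one)
  from near[OF this] obtain a where a0: "a \<in> cell p" "\<forall>h\<in>H. cmod (h x - h a) \<le> e / 8" by (rule bexE)
  note a = a0(1) a0(2)[rule_format]
  have "cmod (h (\<pi> g x) - h x) < e" if g: "g \<in> F" and h: "h \<in> H" for g h
  proof -
    obtain y where y: "y \<in> sphere_nhd d (cell p)" "x = \<pi> (inv g) y" using x(2)[of "inv g"] g by auto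
    have "\<pi> g x = y" using y(2) g F by auto
    from near[OF y(1)] obtain b where b0: "b \<in> cell p" "\<forall>h\<in>H. cmod (h y - h b) \<le> e / 8" by (rule bexE)
    note b = b0(1) b0(2)[rule_format]
    have "h y - h x = (h y - h b) + (h b - h a) - (h x - h a)" by simp
    then have "cmod (h y - h x) \<le> cmod (h y - h b) + cmod (h b - h a) + cmod (h x - h a)"
      using norm_triangle_ineq4[of "(h y - h b) + (h b - h a)" "h x - h a"]
        norm_triangle_ineq[of "h y - h b" "h b - h a"] by simp
    then show ?thesis using b(2)[OF h] a(2)[OF h] osc[OF h b(1) a(1)] e \<open>\<pi> g x = y\<close> by simp
  qed
  then show ?thesis by (intro bexI[OF _ x(1)] ballI)
qed

text \<open>Compactness of the shell \<open>\<epsilon> \<le> norm y \<le> 1\<close> in the span of an invariant frame.\<close>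

lemma frame_displacement:
  assumes no: "\<forall>v. (\<forall>g\<in>carrier G. \<pi> g v = v) \<longrightarrow> v = 0"
    and E: "orthonormal E" and \<epsilon>: "0 < \<epsilon>"
  shows "\<exists>F \<eta>. finite F \<and> F \<subseteq> carrier G \<and> 0 < \<eta> \<and>
    (\<forall>y. y \<in> cvec.span E \<longrightarrow> norm y \<le> 1 \<longrightarrow> (\<forall>g\<in>F. norm (\<pi> g y - y) < \<eta>) \<longrightarrow> norm y < \<epsilon>)"
proof -
  let ?K = "{(\<Sum>e\<in>E. c e *\<^sub>C e) | c. \<forall>e\<in>E. cmod (c e) \<le> 1}"
  have in_K: "y \<in> ?K" if "y \<in> cvec.span E" "norm y \<le> 1" for y
  proof -
    have "cmod (cinner y e) \<le> 1" if "e \<in> E" for e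
      using cmod_cinner_le[of y e] orthonormalD(2)[OF E that] \<open>norm y \<le> 1\<close> by simp
    then have c: "\<forall>e\<in>E. cmod ((\<lambda>e. cinner y e) e) \<le> 1" by simp
    have "y = (\<Sum>e\<in>E. cinner y e *\<^sub>C e)"
      using onproj_span_id[OF E that(1)] by (simp add: onproj_def)
    then show ?thesis using c by blast
  qed
  define S where "S = ?K \<inter> {y. \<epsilon> \<le> norm y}"
  have "closed {y :: 'h. \<epsilon> \<le> norm y}" by (intro closed_Collect_le continuous_intros)
  then have cpt: "compact S"
    unfolding S_def by (intro compact_Int_closed compact_finite_combinations orthonormalD(1)[OF E])
  define U where "U i = {y. inverse (real (Suc (snd i))) < norm (\<pi> (fst i) y - y)}" for i
  have cont: "continuous_on UNIV (\<pi> g)" if g: "g \<in> carrier G" for g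
  proof -
    have "1-lipschitz_on UNIV (\<pi> g)"
      by (rule lipschitz_onI) (simp_all add: dist_norm pi_diff[OF g, symmetric] g)
    then show ?thesis by (rule lipschitz_on_continuous_on)
  qed
  have "open (U i)" if "i \<in> carrier G \<times> UNIV" for i
    unfolding U_def using that by (intro open_Collect_less continuous_intros cont) auto
  moreover have "S \<subseteq> (\<Union>i\<in>carrier G \<times> UNIV. U i)"
  proof
    fix y assume "y \<in> S"
    then have "y \<noteq> 0" using \<epsilon> by (auto simp: S_def)
    then obtain g where g: "g \<in> carrier G" "\<pi> g y \<noteq> y" using no by blast
    then obtain n where "inverse (real (Suc n)) < norm (\<pi> g y - y)"
      using reals_Archimedean[of "norm (\<pi> g y - y)"] by auto
    then have "y \<in> U (g, n)" by (simp add: U_def)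
    then show "y \<in> (\<Union>i\<in>carrier G \<times> UNIV. U i)" using g(1) by blast
  qed
  ultimately obtain I where I: "I \<subseteq> carrier G \<times> UNIV" "finite I" "S \<subseteq> (\<Union>i\<in>I. U i)"
    by (rule compactE_image[OF cpt])
  define n where "n = Max (insert 0 (snd ` I))"
  have n: "snd i \<le> n" if "i \<in> I" for i unfolding n_def using I(2) that by auto
  show ?thesis
  proof (intro exI conjI allI impI)
    show "finite (fst ` I)" "fst ` I \<subseteq> carrier G" using I by auto
    show "0 < inverse (real (Suc n))" by simp
    fix y assume y: "y \<in> cvec.span E" "norm y \<le> 1"
      and small: "\<forall>g\<in>fst ` I. norm (\<pi> g y - y) < inverse (real (Suc n))"
    show "norm y < \<epsilon>"
    proof (rule ccontr)
      assume "\<not> norm y < \<epsilon>"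
      then have "y \<in> S" using in_K[OF y] by (simp add: S_def)
      then obtain i where i: "i \<in> I" "y \<in> U i" using I(3) by blast
      have "inverse (real (Suc n)) \<le> inverse (real (Suc (snd i)))" using n[OF i(1)] by (simp add: field_simps)
      also have "\<dots> < norm (\<pi> (fst i) y - y)" using i(2) by (simp add: U_def)
      finally show False using small[rule_format, of "fst i"] i(1) by force
    qed
  qed
qed

text \<open>The coordinates along the frame are added to \<open>H\<close>. Their almost invariance
  at \<open>x\<close> means that finitely many group elements hardly move the projection of
  \<open>x\<close>, and \<open>frame_displacement\<close> then makes that projection small.\<close>

lemma concentration_small_component:
  fixes H :: "('h \<Rightarrow> complex) set"
  assumes conc: "concentration_property G \<pi>"
    and no: "\<forall>v. (\<forall>g\<in>carrier G. \<pi> g v = v) \<longrightarrow> v = 0"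
    and E: "invariant_frame E" and H: "finite H"
    and bdd: "\<And>h. h \<in> H \<Longrightarrow> bounded (h ` sphere 0 1)"
    and lip: "\<And>h. h \<in> H \<Longrightarrow> \<exists>L. \<forall>x\<in>sphere 0 1. \<forall>y\<in>sphere 0 1. cmod (h x - h y) \<le> L * dist x y"
    and F: "finite F" "F \<subseteq> carrier G" and e: "0 < e"
  shows "\<exists>x\<in>sphere 0 1. (\<forall>g\<in>F. \<forall>h\<in>H. cmod (h (\<pi> g x) - h x) < e) \<and> norm (onproj E x) < e"
proof -
  have on: "orthonormal E" using E by (simp add: invariant_frame_def)
  obtain F' \<eta> where F': "finite F'" "F' \<subseteq> carrier G" "0 < \<eta>"
    "\<forall>y. y \<in> cvec.span E \<longrightarrow> norm y \<le> 1 \<longrightarrow> (\<forall>g\<in>F'. norm (\<pi> g y - y) < \<eta>) \<longrightarrow> norm y < e"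
    using frame_displacement[OF no on e] by (elim exE conjE)
  let ?H = "H \<union> (\<lambda>e x. cinner x e) ` E"
  \<comment> \<open>The coordinate errors must add up to less than \<open>\<eta>\<close>; the added
    \<open>1\<close> also covers the empty frame.\<close>
  define d where "d = min e (\<eta> / (real (card E) + 1))"
  have d: "0 < d" using e F'(3) by (simp add: d_def add_nonneg_pos)
  have "\<exists>x\<in>sphere 0 1. \<forall>g\<in>F \<union> F'. \<forall>h\<in>?H. cmod (h (\<pi> g x) - h x) < d"
  proof (rule essential_almost_invariant[OF conc])
    show "finite ?H" "finite (F \<union> F')" "F \<union> F' \<subseteq> carrier G" using H F F' orthonormalD(1)[OF on] by auto
    show "0 < d" by (rule d)
    fix h assume "h \<in> ?H"
    then consider "h \<in> H" | f where "f \<in> E" "h = (\<lambda>x. cinner x f)" by auto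
    then have "bounded (h ` sphere 0 1) \<and>
        (\<exists>L. \<forall>x\<in>sphere 0 1. \<forall>y\<in>sphere 0 1. cmod (h x - h y) \<le> L * dist x y)"
    proof cases
      case 1
      then show ?thesis using bdd lip by blast
    next
      case 2
      have le: "cmod (h z) \<le> norm z" for z
        using cmod_cinner_le[of z f] orthonormalD(2)[OF on 2(1)] by (simp add: 2(2))
      have "bounded (h ` sphere 0 1)" unfolding bounded_iff
      proof (intro exI[of _ 1] ballI)
        fix z assume "z \<in> h ` sphere 0 1"
        then obtain x where "x \<in> sphere 0 1" "z = h x" by auto
        then show "norm z \<le> 1" using le[of x] by simp
      qed
      moreover have "cmod (h x - h y) \<le> 1 * dist x y" for x y
        using le[of "x - y"] by (simp add: 2(2) cinner.diff_left dist_norm)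
      ultimately show ?thesis by blast
    qed
    then show "bounded (h ` sphere 0 1)"
      "\<exists>L. \<forall>x\<in>sphere 0 1. \<forall>y\<in>sphere 0 1. cmod (h x - h y) \<le> L * dist x y" by blast+
  qed
  then obtain x where x0: "x \<in> sphere 0 1" "\<forall>g\<in>F \<union> F'. \<forall>h\<in>?H. cmod (h (\<pi> g x) - h x) < d" by (rule bexE)
  note x = x0(1) x0(2)[rule_format]
  have "norm (onproj E x) < e"
  proof (rule F'(4)[rule_format, OF onproj_in_span])
    show "norm (onproj E x) \<le> 1"
    proof -
      have "(norm (x - onproj E x))\<^sup>2 + (norm (onproj E x))\<^sup>2 = 1"
        using pythagoras_onproj[OF on, of x] x(1) by simp
      then have "(norm (onproj E x))\<^sup>2 \<le> 1" using zero_le_power2[of "norm (x - onproj E x)"] by linarith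
      then have "(norm (onproj E x))\<^sup>2 \<le> 1\<^sup>2" by simp
      then show ?thesis by (rule power2_le_imp_le) simp
    qed
    fix g assume g: "g \<in> F'"
    then have gG: "g \<in> carrier G" using F'(2) by auto
    have "\<pi> g (onproj E x) - onproj E x = (\<Sum>e\<in>E. (cinner (\<pi> g x) e - cinner x e) *\<^sub>C e)"
      unfolding invariant_frame_onproj[OF E gG, symmetric] unfolding onproj_def
      by (simp add: scaleC.diff_left sum_subtractf)
    also have "norm \<dots> \<le> (\<Sum>e\<in>E. norm ((cinner (\<pi> g x) e - cinner x e) *\<^sub>C e))" by (rule norm_sum)
    also have "\<dots> \<le> (\<Sum>e\<in>E. d)"
    proof (intro sum_mono)
      fix f assume f: "f \<in> E"
      then have "(\<lambda>x. cinner x f) \<in> ?H" "g \<in> F \<union> F'" using g by auto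
      from x(2)[OF this(2,1)] have "cmod (cinner (\<pi> g x) f - cinner x f) < d" .
      then show "norm ((cinner (\<pi> g x) f - cinner x f) *\<^sub>C f) \<le> d"
        using orthonormalD(2)[OF on f] by (simp add: norm_scaleC)
    qed
    also have "\<dots> = real (card E) * d" by simp
    also have "\<dots> < (real (card E) + 1) * d" using d by simp
    also have "\<dots> \<le> (real (card E) + 1) * (\<eta> / (real (card E) + 1))"
      by (intro mult_left_mono) (auto simp: d_def)
    also have "\<dots> = \<eta>" by (simp add: add_nonneg_eq_0_iff)
    finally show "norm (\<pi> g (onproj E x) - onproj E x) < \<eta>" .
  qed
  moreover have "cmod (h (\<pi> g x) - h x) < e" if "g \<in> F" "h \<in> H" for g h
    using x(2)[of g h] that unfolding d_def by auto
  ultimately show ?thesis by (intro bexI[OF _ x(1)] conjI ballI)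
qed

section \<open>Infinite dimension, and invariant states on subspaces of finite codimension\<close>

lemma infinite_dim_of_concentration:
  assumes conc: "concentration_property G \<pi>"
    and no: "\<forall>v. (\<forall>g\<in>carrier G. \<pi> g v = v) \<longrightarrow> v = 0"
  shows "\<not> finite_cdim (UNIV :: 'h set)"
proof
  assume "finite_cdim (UNIV :: 'h set)"
  then obtain B :: "'h set" where B: "finite B" "UNIV \<subseteq> cvec.span B" by (auto simp: finite_cdim_def)
  obtain E where E: "orthonormal E" "cvec.span E = cvec.span B" by (rule gram_schmidt[OF B(1)])
  \<comment> \<open>A basis of the whole space is an invariant frame onto which no unit vector has
    small projection.\<close>
  have "invariant_frame E" using E B(2) by (auto simp: invariant_frame_def)
  from concentration_small_component[OF conc no this, of "{}" "{}" "1 / 2"]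
  obtain x where x: "x \<in> sphere 0 1" "norm (onproj E x) < 1 / 2" by auto
  have "onproj E x = x" using E B(2) by (intro onproj_span_id) auto
  then show False using x by simp
qed

text \<open>If \<open>B\<close> spans modulo \<open>K\<close>, the components of its elements
  orthogonal to \<open>K\<close> span the orthogonal complement, which is invariant by
  unitarity.\<close>

lemma finite_codim_frame:
  assumes K: "closed_invariant_subspace G \<pi> K" "finite_codim K"
  obtains E where "invariant_frame E" "K = ortho E"
proof -
  have sub: "cvec.subspace K" and cl: "closed K" and inv: "\<And>g k. g \<in> carrier G \<Longrightarrow> k \<in> K \<Longrightarrow> \<pi> g k \<in> K"
    using K(1) by (auto simp: closed_invariant_subspace_def)
  obtain B where B: "finite B" "cvec.span (K \<union> B) = UNIV" using K(2) by (auto simp: finite_codim_def)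
  have "\<forall>x. \<exists>p. p \<in> K \<and> (\<forall>k\<in>K. cinner (x - p) k = 0)"
  proof
    fix x
    show "\<exists>p. p \<in> K \<and> (\<forall>k\<in>K. cinner (x - p) k = 0)"
      by (rule orthogonal_decomposition[OF sub cl, of x]) auto
  qed
  from choice[OF this] obtain p where p0: "\<forall>x. p x \<in> K \<and> (\<forall>k\<in>K. cinner (x - p x) k = 0)" ..
  then have p: "p x \<in> K" "k \<in> K \<Longrightarrow> cinner (x - p x) k = 0" for x k by auto
  obtain E where E: "orthonormal E" "cvec.span E = cvec.span ((\<lambda>b. b - p b) ` B)"
    by (rule gram_schmidt[of "(\<lambda>b. b - p b) ` B"]) (use B in auto)
  have KE: "cinner k x = 0" if "k \<in> K" "x \<in> cvec.span E" for k x
    using that(2) unfolding E(2)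
    by (rule cinner_orthonormal_span) (use p(2) that(1) cinner_zero_commute in auto)
  have Kon: "onproj E k = 0" if "k \<in> K" for k
    by (rule onproj_orthogonal) (rule KE[OF that cvec.span_base])
  \<comment> \<open>Checked on generators: elements of \<open>K\<close> have zero projection, and
    from \<open>b \<in> B\<close> the projection removes exactly \<open>b - p b\<close>.\<close>
  have diff: "x - onproj E x \<in> K" for x
  proof -
    have "x \<in> cvec.span (K \<union> B)" using B(2) by simp
    then show ?thesis
    proof (induction rule: cvec.span_induct_alt)
      case base
      then show ?case using cvec.subspace_0[OF sub] by (simp add: onproj_def cinner_simps)
    next
      case (step c y z)
      have "y - onproj E y \<in> K"
      proof (cases "y \<in> K")
        case True
        then show ?thesis using Kon by simp
      next
        case False
        then have y: "y \<in> B" using step by auto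
        have "y - p y \<in> cvec.span E" unfolding E(2) using y by (intro cvec.span_base) auto
        then have "onproj E (y - p y) = y - p y" by (rule onproj_span_id[OF E(1)])
        then have "onproj E y = y - p y" using Kon[OF p(1)[of y]] by (simp add: onproj_diff)
        then show ?thesis using p(1)[of y] by simp
      qed
      then have "c *\<^sub>C (y - onproj E y) + (z - onproj E z) \<in> K"
        using step sub by (intro cvec.subspace_add cvec.subspace_scale)
      then show ?case by (simp add: onproj_add onproj_scaleC scaleC.diff_right algebra_simps)
    qed
  qed
  have K_eq: "K = ortho E"
  proof
    show "K \<subseteq> ortho E" using KE cvec.span_base by (auto simp: ortho_def)
    show "ortho E \<subseteq> K"
    proof
      fix x assume "x \<in> ortho E"
      then have "onproj E x = 0" by (intro onproj_orthogonal) (simp add: ortho_def)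
      then show "x \<in> K" using diff[of x] by simp
    qed
  qed
  have "\<pi> g e \<in> cvec.span E" if g: "g \<in> carrier G" and e: "e \<in> E" for g e
  proof -
    let ?d = "\<pi> g e - onproj E (\<pi> g e)"
    have dK: "?d \<in> K" by (rule diff)
    have "cinner (\<pi> g e) ?d = cnj (cinner (\<pi> (inv g) ?d) e)"
      unfolding pi_cinner_left[OF g] by (rule cinner_commute)
    also have "\<dots> = 0" using KE[OF inv[OF inv_closed[OF g] dK] cvec.span_base[OF e]] by simp
    finally have 1: "cinner (\<pi> g e) ?d = 0" .
    have 2: "cinner (onproj E (\<pi> g e)) ?d = 0"
      using KE[OF dK onproj_in_span] cinner_zero_commute by blast
    have "cinner ?d ?d = cinner (\<pi> g e) ?d - cinner (onproj E (\<pi> g e)) ?d" by (rule cinner.diff_left)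
    then have "cinner ?d ?d = 0" using 1 2 by simp
    then have "?d = 0" by (simp add: cinner_self)
    then have "\<pi> g e = onproj E (\<pi> g e)" by simp
    then show ?thesis using onproj_in_span[of E "\<pi> g e"] by metis
  qed
  then have "invariant_frame E" using E(1) by (simp add: invariant_frame_def)
  from this K_eq show ?thesis by (rule that)
qed

text \<open>The functionals \<open>\<Phi> x\<close> lie in a compact set, and almost invariant
  vectors with small frame component satisfy any finite family of invariance and normalisation
  constraints up to prescribed tolerances; the finite intersection property gives a common
  solution.\<close>

theorem amenable_of_concentration:
  assumes conc: "concentration_property G \<pi>"
    and no: "\<forall>v. (\<forall>g\<in>carrier G. \<pi> g v = v) \<longrightarrow> v = 0"
    and K: "closed_invariant_subspace G \<pi> K" "finite_codim K"
  shows "amenable_rep G K (subrep \<pi> K)"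
proof -
  obtain E where E: "invariant_frame E" "K = ortho E" by (rule finite_codim_frame[OF K])
  have on: "orthonormal E" using E by (simp add: invariant_frame_def)
  have sub: "cvec.subspace K" and inv: "\<And>g k. g \<in> carrier G \<Longrightarrow> k \<in> K \<Longrightarrow> \<pi> g k \<in> K"
    using K(1) by (auto simp: closed_invariant_subspace_def)
  note K0 = cvec.subspace_0[OF sub]
  define P where "P x = x - onproj E x" for x
  have PK: "P x \<in> K" for x unfolding P_def E(2) by (rule diff_onproj_in_ortho[OF on])
  have Pn: "norm (P x) \<le> norm x" for x
    by (rule power2_le_imp_le[OF _ norm_ge_zero]) (simp add: P_def pythagoras_onproj[OF on, of x])
  have Pd: "P x - P y = P (x - y)" for x y by (simp add: P_def onproj_diff)
  have Pg: "P (\<pi> g x) = \<pi> g (P x)" if "g \<in> carrier G" for g x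
    using that by (simp add: P_def invariant_frame_onproj[OF E(1)] pi_diff)
  define conj where "conj g T = subrep \<pi> K g \<circ> T \<circ> subrep \<pi> K (inv g)" for g T
  have bd: "T x \<in> K" "T (x + y) = T x + T y" "T (c *\<^sub>C x) = c *\<^sub>C T x"
    if "T \<in> bounded_ops K" "x \<in> K" "y \<in> K" for T x y c
    using that by (auto simp: bounded_ops_def)
  have T0: "T 0 = 0" if "T \<in> bounded_ops K" for T
    using bd(3)[OF that K0 K0, of 0] by simp
  have Tout: "T x = 0" if "T \<in> bounded_ops K" "x \<notin> K" for T x using that by (auto simp: bounded_ops_def)
  have Ton: "norm (T x) \<le> onorm T * norm x" if T: "T \<in> bounded_ops K" for T x
  proof (cases "x = 0")
    case True
    then show ?thesis using T0[OF T] by simp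
  next
    case False
    obtain b where b: "\<forall>x\<in>K. norm (T x) \<le> b * norm x" using T by (auto simp: bounded_ops_def)
    have "norm (T y) / norm y \<le> max b 0" for y
    proof (cases "y \<in> K \<and> y \<noteq> 0")
      case True
      then have "norm (T y) / norm y \<le> b" using b by (simp add: field_simps)
      then show ?thesis by simp
    qed (use Tout[OF T] T0[OF T] in auto)
    then have "bdd_above (range (\<lambda>y. norm (T y) / norm y))" by (intro bdd_aboveI[of _ "max b 0"]) auto
    then have "norm (T x) / norm x \<le> onorm T" unfolding onorm_def by (intro cSUP_upper) auto
    then show ?thesis using False by (simp add: field_simps)
  qed
  have onorm0: "0 \<le> onorm T" if T: "T \<in> bounded_ops K" for T
  proof (cases "\<exists>x::'h. x \<noteq> 0")
    case True
    then obtain x :: 'h where "x \<noteq> 0" by blast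
    moreover have "0 \<le> onorm T * norm x" using Ton[OF T, of x] norm_ge_zero[of "T x"] by linarith
    ultimately show ?thesis by (simp add: zero_le_mult_iff)
  next
    case False
    then have z: "x = 0" for x :: 'h by blast
    \<comment> \<open>On the zero space every quotient is \<open>0 / 0 = 0\<close>.\<close>
    have "(\<lambda>x. norm (T x) / norm x) = (\<lambda>x. 0)" using z by (auto simp: fun_eq_iff)
    show ?thesis unfolding onorm_def \<open>(\<lambda>x. norm (T x) / norm x) = (\<lambda>x. 0)\<close> by simp
  qed
  have conj_in: "conj g T x = \<pi> g (T (\<pi> (inv g) x))" if "g \<in> carrier G" "T \<in> bounded_ops K" "x \<in> K" for g T x
    using inv[OF inv_closed[OF that(1)] that(3)] that(3) bd(1)[OF that(2) _ K0]
    by (simp add: conj_def subrep_def restrict_op_def)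
  have conj_b: "conj g T \<in> bounded_ops K" if g: "g \<in> carrier G" and T: "T \<in> bounded_ops K" for g T
  proof (rule bounded_opsI[where B = "onorm T"])
    note i = inv[OF inv_closed[OF g]]
    show "conj g T x = 0" if "x \<notin> K" for x
      using that T0[OF T] K0 g by (simp add: conj_def subrep_def restrict_op_def)
    fix x assume x: "x \<in> K"
    show "conj g T x \<in> K" using inv[OF g bd(1)[OF T i[OF x] K0]] by (simp add: conj_in g T x)
    show "norm (conj g T x) \<le> onorm T * norm x"
      using Ton[OF T, of "\<pi> (inv g) x"] g by (simp add: conj_in T x)
    show "conj g T (c *\<^sub>C x) = c *\<^sub>C conj g T x" for c
      using bd(3)[OF T i[OF x] K0, of c] x
      by (simp add: conj_in g T cvec.subspace_scale[OF sub] pi_scaleC)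
    show "conj g T (x + y) = conj g T x + conj g T y" if "y \<in> K" for y
      using bd(2)[OF T i[OF x] i[OF that]] x that
      by (simp add: conj_in g T cvec.subspace_add[OF sub] pi_add)
  qed
  have id_b: "restrict_op K id \<in> bounded_ops K"
    by (rule restrict_op_bounded[OF sub, where B = 1]) auto
  note add_b = bounded_ops_plus[OF sub] and scale_b = bounded_ops_scaleC[OF sub]
  \<comment> \<open>The value \<open>0\<close> at functions that are not operators on
    \<open>K\<close> allows the product topology over all functions. \<open>P x\<close> is not
    normalised; its length enters through the constraint on \<open>one\<close>.\<close>
  define \<Phi> where "\<Phi> x T = (if T \<in> bounded_ops K then cinner (T (P x)) (P x) else 0)" for x T
  define bnd where "bnd T = (if T \<in> bounded_ops K then onorm T else 0)" for T
  define one where "one = restrict_op K (id :: 'h \<Rightarrow> 'h)"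
  have \<Phi>_le: "cmod (\<Phi> x T) \<le> bnd T" if x: "x \<in> sphere 0 1" for x T
  proof (cases "T \<in> bounded_ops K")
    case True
    have "cmod (cinner (T (P x)) (P x)) \<le> norm (T (P x)) * norm (P x)" by (rule cmod_cinner_le)
    also have "\<dots> \<le> (onorm T * norm (P x)) * norm (P x)" by (intro mult_right_mono Ton True) simp
    also have "\<dots> = onorm T * (norm (P x) * norm (P x))" by simp
    also have "\<dots> \<le> onorm T * (1 * 1)"
      using Pn[of x] x onorm0[OF True] by (intro mult_left_mono mult_mono) auto
    finally show ?thesis using True by (simp add: \<Phi>_def bnd_def)
  qed (simp add: \<Phi>_def bnd_def)
  have \<Phi>_lip: "cmod (\<Phi> x T - \<Phi> y T) \<le> (2 * bnd T) * dist x y"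
    if xy: "x \<in> sphere 0 1" "y \<in> sphere 0 1" for x y T
  proof (cases "T \<in> bounded_ops K")
    case True
    have Td: "T (P x) = T (P y) + T (P (x - y))" using bd(2)[OF True PK PK, of y "x - y"] Pd[of x y] by (simp add: algebra_simps)
    have n1: "norm (P x) \<le> 1" "norm (P y) \<le> 1" using Pn[of x] Pn[of y] xy by auto
    have "\<Phi> x T - \<Phi> y T = cinner (T (P (x - y))) (P x) + cinner (T (P y)) (P (x - y))"
      using True by (simp add: \<Phi>_def Td cinner.add_left cinner.diff_right Pd[of x y, symmetric])
    also have "cmod \<dots> \<le> norm (T (P (x - y))) * norm (P x) + norm (T (P y)) * norm (P (x - y))"
      by (intro order_trans[OF norm_triangle_ineq] add_mono cmod_cinner_le)
    also have "\<dots> \<le> (onorm T * norm (x - y)) * 1 + (onorm T * 1) * norm (x - y)"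
    proof (intro add_mono mult_mono)
      show "norm (T (P (x - y))) \<le> onorm T * norm (x - y)"
        using Ton[OF True, of "P (x - y)"] mult_left_mono[OF Pn[of "x - y"] onorm0[OF True]] by linarith
      show "norm (T (P y)) \<le> onorm T * 1"
        using Ton[OF True, of "P y"] mult_left_mono[OF n1(2) onorm0[OF True]] by linarith
    qed (use n1 Pn onorm0[OF True] in auto)
    finally show ?thesis using True by (simp add: bnd_def dist_norm)
  qed (simp add: \<Phi>_def bnd_def)
  have \<Phi>_conj: "\<Phi> x (conj g T) = \<Phi> (\<pi> (inv g) x) T" if g: "g \<in> carrier G" and T: "T \<in> bounded_ops K" for g T x
  proof -
    have "conj g T (P x) = \<pi> g (T (\<pi> (inv g) (P x)))" by (rule conj_in[OF g T PK])
    then show ?thesis using conj_b[OF g T] T g by (simp add: \<Phi>_def pi_cinner_left Pg)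
  qed
  have \<Phi>_one: "\<Phi> x one = of_real (1 - (norm (onproj E x))\<^sup>2)" if "x \<in> sphere 0 1" for x
  proof -
    have "\<Phi> x one = of_real ((norm (P x))\<^sup>2)"
      using id_b PK[of x] unfolding \<Phi>_def one_def by (simp add: restrict_op_def cinner_self)
    also have "(norm (P x))\<^sup>2 = 1 - (norm (onproj E x))\<^sup>2"
      using pythagoras_onproj[OF on, of x] that by (simp add: P_def)
    finally show ?thesis .
  qed
  \<comment> \<open>The conditions on a state that every \<open>\<Phi> x\<close> satisfies exactly
    and that survive pointwise limits.\<close>
  define A where "A = {\<phi> :: ('h \<Rightarrow> 'h) \<Rightarrow> complex.
    (\<forall>S\<in>bounded_ops K. \<forall>T\<in>bounded_ops K. \<phi> (\<lambda>x. S x + T x) = \<phi> S + \<phi> T) \<and>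
    (\<forall>c. \<forall>T\<in>bounded_ops K. \<phi> (\<lambda>x. c *\<^sub>C T x) = c * \<phi> T) \<and>
    (\<forall>T. positive_op K T \<longrightarrow> 0 \<le> Re (\<phi> T) \<and> Im (\<phi> T) = 0)}"
  note ev = continuous_on_eval
  have "closed A"
  proof -
    have 1: "closed {\<phi> :: ('h \<Rightarrow> 'h) \<Rightarrow> complex. \<phi> (\<lambda>x. S x + T x) = \<phi> S + \<phi> T}" for S T
      by (intro closed_Collect_eq continuous_intros ev)
    have 2: "closed {\<phi> :: ('h \<Rightarrow> 'h) \<Rightarrow> complex. \<phi> (\<lambda>x. c *\<^sub>C T x) = c * \<phi> T}" for c T
      by (intro closed_Collect_eq continuous_intros ev)
    have 3: "closed {\<phi> :: ('h \<Rightarrow> 'h) \<Rightarrow> complex. 0 \<le> Re (\<phi> T)}" for T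
      by (intro closed_Collect_le continuous_intros ev)
    have 4: "closed {\<phi> :: ('h \<Rightarrow> 'h) \<Rightarrow> complex. Im (\<phi> T) = 0}" for T
      by (intro closed_Collect_eq continuous_intros ev)
    have "A = (\<Inter>S\<in>bounded_ops K. \<Inter>T\<in>bounded_ops K. {\<phi>. \<phi> (\<lambda>x. S x + T x) = \<phi> S + \<phi> T}) \<inter>
      (\<Inter>c. \<Inter>T\<in>bounded_ops K. {\<phi>. \<phi> (\<lambda>x. c *\<^sub>C T x) = c * \<phi> T}) \<inter>
      (\<Inter>T\<in>{T. positive_op K T}. {\<phi>. 0 \<le> Re (\<phi> T)} \<inter> {\<phi>. Im (\<phi> T) = 0})"
      unfolding A_def by blast
    also have "closed \<dots>" by (intro closed_Int closed_INT ballI 1 2 3 4)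
    finally show ?thesis .
  qed
  then have cpt: "compact ({\<phi>. \<forall>T. cmod (\<phi> T) \<le> bnd T} \<inter> A)"
    by (intro compact_Int_closed compact_bounded_functions)
  have \<Phi>A: "\<Phi> x \<in> A" for x
  proof -
    have "\<Phi> x (\<lambda>x. S x + T x) = \<Phi> x S + \<Phi> x T" if "S \<in> bounded_ops K" "T \<in> bounded_ops K" for S T
      using that add_b[OF that] by (simp add: \<Phi>_def cinner_simps)
    moreover have "\<Phi> x (\<lambda>x. c *\<^sub>C T x) = c * \<Phi> x T" if "T \<in> bounded_ops K" for c T
      using that scale_b[OF that] by (simp add: \<Phi>_def cinner_simps)
    moreover have "0 \<le> Re (\<Phi> x T) \<and> Im (\<Phi> x T) = 0" if "positive_op K T" for T
      using that PK[of x] by (auto simp: \<Phi>_def positive_op_def complex_nonneg_Reals_iff)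
    ultimately show ?thesis by (simp add: A_def)
  qed
  \<comment> \<open>One constraint for each group element, operator and tolerance; over all
    tolerances together, invariance and normalisation become exact.\<close>
  define I where "I = carrier G \<times> bounded_ops K \<times> {0::real<..}"
  define Z where "Z i = {\<phi> :: ('h \<Rightarrow> 'h) \<Rightarrow> complex.
    cmod (\<phi> (conj (fst i) (fst (snd i))) - \<phi> (fst (snd i))) \<le> snd (snd i) \<and> cmod (\<phi> one - 1) \<le> snd (snd i)}" for i
  have "({\<phi>. \<forall>T. cmod (\<phi> T) \<le> bnd T} \<inter> A) \<inter> \<Inter>(Z ` I) \<noteq> {}"
  proof (rule compact_imp_fip[OF cpt])
    fix W assume "W \<in> Z ` I"
    then obtain i where W: "W = Z i" by blast
    have 1: "closed {\<phi> :: ('h \<Rightarrow> 'h) \<Rightarrow> complex. cmod (\<phi> S - \<phi> T) \<le> c}" for S T c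
      by (intro closed_Collect_le continuous_intros ev)
    have 2: "closed {\<phi> :: ('h \<Rightarrow> 'h) \<Rightarrow> complex. cmod (\<phi> S - 1) \<le> c}" for S c
      by (intro closed_Collect_le continuous_intros ev)
    show "closed W" unfolding W Z_def Collect_conj_eq by (intro closed_Int 1 2)
  next
    fix F' assume "finite F'" "F' \<subseteq> Z ` I"
    then obtain J where J: "finite J" "J \<subseteq> I" "F' = Z ` J" by (meson finite_subset_image)
    define e where "e = Min (insert 1 ((\<lambda>i. snd (snd i)) ` J))"
    have e: "0 < e" "e \<le> 1" unfolding e_def using J by (auto simp: I_def)
    have eJ: "e \<le> snd (snd i)" if "i \<in> J" for i unfolding e_def using J(1) that by auto
    let ?H = "(\<lambda>i x. \<Phi> x (fst (snd i))) ` J"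
    let ?F = "(\<lambda>i. inv (fst i)) ` J"
    have JG: "fst i \<in> carrier G" "fst (snd i) \<in> bounded_ops K" if "i \<in> J" for i using J(2) that by (auto simp: I_def)
    have "\<exists>x\<in>sphere 0 1. (\<forall>g\<in>?F. \<forall>h\<in>?H. cmod (h (\<pi> g x) - h x) < e) \<and> norm (onproj E x) < e"
    proof (rule concentration_small_component[OF conc no E(1)])
      show "finite ?H" "finite ?F" "?F \<subseteq> carrier G" using J(1) JG by auto
      show "0 < e" by (rule e)
      fix h assume "h \<in> ?H"
      then obtain T where h: "h = (\<lambda>x. \<Phi> x T)" by blast
      show "bounded (h ` sphere 0 1)" unfolding h bounded_iff using \<Phi>_le by blast
      show "\<exists>L. \<forall>x\<in>sphere 0 1. \<forall>y\<in>sphere 0 1. cmod (h x - h y) \<le> L * dist x y"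
        unfolding h using \<Phi>_lip by blast
    qed
    then obtain x where x: "x \<in> sphere 0 1" "norm (onproj E x) < e"
      and x3: "\<forall>g\<in>?F. \<forall>h\<in>?H. cmod (h (\<pi> g x) - h x) < e" by (elim bexE conjE)
    have "\<Phi> x \<in> Z i" if i: "i \<in> J" for i
    proof -
      have "cmod (\<Phi> x (conj (fst i) (fst (snd i))) - \<Phi> x (fst (snd i))) \<le> snd (snd i)"
      proof -
        have "inv (fst i) \<in> ?F" "(\<lambda>x. \<Phi> x (fst (snd i))) \<in> ?H" using i by auto
        from x3[rule_format, OF this]
        have "cmod (\<Phi> (\<pi> (inv (fst i)) x) (fst (snd i)) - \<Phi> x (fst (snd i))) < e" .
        then show ?thesis using eJ[OF i] by (simp add: \<Phi>_conj JG[OF i])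
      qed
      moreover have "\<Phi> x one - 1 = of_real (- (norm (onproj E x))\<^sup>2)" unfolding \<Phi>_one[OF x(1)] by simp
      then have "cmod (\<Phi> x one - 1) = (norm (onproj E x))\<^sup>2" by (simp only: norm_of_real) simp
      moreover have "(norm (onproj E x))\<^sup>2 \<le> e * 1"
        unfolding power2_eq_square using x(2) e by (intro mult_mono) auto
      ultimately show ?thesis using eJ[OF i] by (simp add: Z_def)
    qed
    then have "\<Phi> x \<in> \<Inter>F'" using J(3) by blast
    moreover have "\<Phi> x \<in> {\<phi>. \<forall>T. cmod (\<phi> T) \<le> bnd T} \<inter> A" using \<Phi>A \<Phi>_le[OF x(1)] by blast
    ultimately show "({\<phi>. \<forall>T. cmod (\<phi> T) \<le> bnd T} \<inter> A) \<inter> \<Inter>F' \<noteq> {}" by blast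
  qed
  then obtain \<phi> where \<phi>: "\<And>T. cmod (\<phi> T) \<le> bnd T" "\<phi> \<in> A" "\<And>i. i \<in> I \<Longrightarrow> \<phi> \<in> Z i" by blast
  have Zi: "cmod (\<phi> (conj g T) - \<phi> T) \<le> e" "cmod (\<phi> one - 1) \<le> e"
    if "g \<in> carrier G" "T \<in> bounded_ops K" "0 < e" for g T e
    using \<phi>(3)[of "(g, T, e)"] that by (auto simp: I_def Z_def)
  have "state_on K \<phi>"
    unfolding state_on_def
  proof (intro conjI)
    show "\<forall>S\<in>bounded_ops K. \<forall>T\<in>bounded_ops K. \<phi> (\<lambda>x. S x + T x) = \<phi> S + \<phi> T"
      "\<forall>c. \<forall>T\<in>bounded_ops K. \<phi> (\<lambda>x. c *\<^sub>C T x) = c * \<phi> T"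
      "\<forall>T. positive_op K T \<longrightarrow> \<phi> T \<in> \<real>\<^sub>\<ge>\<^sub>0"
      using \<phi>(2) by (auto simp: A_def complex_nonneg_Reals_iff)
    show "\<exists>M. \<forall>T\<in>bounded_ops K. cmod (\<phi> T) \<le> M * onorm T"
      using \<phi>(1) by (intro exI[of _ 1] ballI) (metis bnd_def mult_1)
    have one_in: "\<one> \<in> carrier G" using group.is_monoid[OF group_G] by (rule monoid.one_closed)
    have "cmod (\<phi> one - 1) \<le> 0"
      by (rule field_le_epsilon) (use Zi(2)[OF one_in id_b] in simp)
    then show "\<phi> (restrict_op K id) = 1" by (simp add: one_def)
  qed
  moreover have "\<phi> (conj g T) = \<phi> T" if "g \<in> carrier G" "T \<in> bounded_ops K" for g T
  proof -
    have "cmod (\<phi> (conj g T) - \<phi> T) \<le> 0"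
      by (rule field_le_epsilon) (use Zi(1)[OF that] in simp)
    then show ?thesis by simp
  qed
  ultimately show ?thesis unfolding amenable_rep_def conj_def by blast
qed

end

theorem theorem7p1:
  fixes G :: "('g, 'm) monoid_scheme"
    and \<pi> :: "'g \<Rightarrow> 'h::complex_hilbert \<Rightarrow> 'h"
  assumes "unitary_rep G \<pi>"
  shows "concentration_property G \<pi> \<longleftrightarrow>
    (\<exists>v. v \<noteq> 0 \<and> (\<forall>g\<in>carrier G. \<pi> g v = v)) \<or>
    (\<not> finite_cdim (UNIV :: 'h set) \<and>
      (\<forall>K. closed_invariant_subspace G \<pi> K \<and> finite_codim K \<longrightarrow>
        amenable_rep G K (subrep \<pi> K)))"
proof -
  interpret unitary_representation G \<pi> by unfold_locales fact
  show ?thesis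
  proof (cases "\<exists>v. v \<noteq> 0 \<and> (\<forall>g\<in>carrier G. \<pi> g v = v)")
    case True
    then show ?thesis using concentration_of_invariant_vector by blast
  next
    case False
    then have no: "\<forall>v. (\<forall>g\<in>carrier G. \<pi> g v = v) \<longrightarrow> v = 0" by blast
    have "\<not> finite_cdim (UNIV :: 'h set) \<and>
        (\<forall>K. closed_invariant_subspace G \<pi> K \<and> finite_codim K \<longrightarrow> amenable_rep G K (subrep \<pi> K))"
      if c: "concentration_property G \<pi>"
      using infinite_dim_of_concentration[OF c no] amenable_of_concentration[OF c no] by simp
    moreover have "concentration_property G \<pi>" if "\<not> finite_cdim (UNIV :: 'h set) \<and>
        (\<forall>K. closed_invariant_subspace G \<pi> K \<and> finite_codim K \<longrightarrow> amenable_rep G K (subrep \<pi> K))"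
      using that by (intro concentration_of_amenable) simp_all
    ultimately show ?thesis using False by argo
  qed
qed

end
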